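(* Let $F=F(y)$ be a Minkowski metric on $\mathbb{R}^{m+1}$ such that its $m$-harmonic symmetrization $F_{\mathrm{sym}}$ is also a Finsler metric on $\mathbb{R}^{m+1}$. Let $\Omega\subset\mathbb{R}^m$ be a bounded domain with $C^1$-boundary $\partial\Omega$, and let $K\subset\Omega$ be compact with $\mathscr{H}^{m-1}(K)=0$ such that $\Omega\setminus K$ is connected. Assume that $f_1,f_2\in C^0(\overline{\Omega}\setminus K)\cap C^2(\Omega\setminus K)$ are functions that define two Finsler-minimal graphs over $\Omega\setminus K$, i.e. $u\mapsto(u,f_i(u))\in\mathbb{R}^{m+1}$, $u\in\Omega\setminus K$, is a Finsler-minimal immersion for $i=1,2$. If $f_1=f_2$ on $\partial\Omega$, then $f_1=f_2$ on $\overline{\Omega}\setminus K$.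
   Context: **Finsler and Minkowski metrics.** A Finsler metric on $\mathbb{R}^{n}$ is a non-negative function $F=F(x,y)$ on $\mathbb{R}^{n}\times\mathbb{R}^{n}$, smooth for $y\neq0$, with (F1) $F(x,ty)=tF(x,y)$ for all $t>0$, and (F2) the matrix $\big((F^2/2)_{y^iy^j}(x,y)\big)_{ij}$ is positive definite for all $x$ and all $y\ne 0$. It is called a Minkowski metric if it depends only on $y$. **$m$-harmonic symmetrization.** For $F$ on $\mathbb{R}^{m+1}$, $$F_{\mathrm{sym}}(x,y):=\Big[\frac{2}{F^{-m}(x,y)+F^{-m}(x,-y)}\Big]^{1/m}\ (y\neq 0),$$ extended by zero at $y=0$. **Finsler area (Busemann–Hausdorff).** For an immersion $X:\mathscr{M}^k\to\mathbb{R}^{n}$ of a smooth $k$-manifold, $\mathrm{area}^F_\Omega(X):=\int_\Omega\sigma_{X^*F}(u)\,du^1\wedge\dots\wedge du^k$, where in local coordinates $$\sigma_{X^*F}(u):=\frac{\mathscr{H}^k(B^k_1(0))}{\mathscr{H}^k(\{v\in\mathbb{R}^k: F(X(u),dX|_u(v^\delta\partial_{u^\delta}))\le1\})},$$ $B^k_1(0)$ is the Euclidean unit ball in $\mathbb{R}^k$ and $\mathscr{H}^k$ is $k$-dimensional Hausdorff measure. **Finsler-minimal.** A $C^2$-immersion $X$ is Finsler-minimal if it is critical for Finsler area, i.e. the first variation of $\mathrm{area}^F_\Omega$ at $X$ vanishes for all smooth variations compactly supported in the interior (with $\Omega$ relatively compact and containing the support). *)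

theory Defs
  imports "HOL-Analysis.Analysis"
begin

definition partial_deriv ::
  "'a::euclidean_space \<Rightarrow> ('a \<Rightarrow> 'b::real_normed_vector) \<Rightarrow> 'a \<Rightarrow> 'b" where
  "partial_deriv i f x = frechet_derivative f (at x) i"

(* Meant for open S: the derivatives are two-sided ones, taken at points of S. *)
primrec Ck_on ::
  "nat \<Rightarrow> 'a::euclidean_space set \<Rightarrow> ('a \<Rightarrow> 'b::real_normed_vector) \<Rightarrow> bool" where
  "Ck_on 0 S f \<longleftrightarrow> continuous_on S f"
| "Ck_on (Suc k) S f \<longleftrightarrow>
     f differentiable_on S \<and> (\<forall>i\<in>Basis. Ck_on k S (partial_deriv i f))"

definition smooth_on ::
  "'a::euclidean_space set \<Rightarrow> ('a \<Rightarrow> 'b::real_normed_vector) \<Rightarrow> bool" where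
  "smooth_on S f \<longleftrightarrow> (\<forall>k. Ck_on k S f)"


section \<open>Hausdorff measure of integer dimension\<close>

(* Covering sets are required to be bounded because diameter is unspecified on unbounded sets.
   Empty covering sets contribute 0 and nonempty ones of diameter 0 contribute
   0 ^ 0 = 1 when k = 0, so the 0-dimensional measure is the counting measure. *)
definition hausdorff_premeasure :: "nat \<Rightarrow> real \<Rightarrow> 'a::metric_space set \<Rightarrow> ennreal" where
  "hausdorff_premeasure k \<delta> A =
     (INF C \<in> {C :: nat \<Rightarrow> 'a set.
                 A \<subseteq> (\<Union>i. C i) \<and> (\<forall>i. bounded (C i) \<and> diameter (C i) \<le> \<delta>)}.
        \<Sum>i. if C i = {} then 0
            else ennreal (unit_ball_vol (real k) * (diameter (C i) / 2) ^ k))"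

definition hausdorff_measure :: "nat \<Rightarrow> 'a::metric_space set \<Rightarrow> ennreal" where
  "hausdorff_measure k A = (SUP \<delta>\<in>{0<..}. hausdorff_premeasure k \<delta> A)"


section \<open>Finsler metrics\<close>

definition finsler_metric :: "('n::euclidean_space \<Rightarrow> 'n \<Rightarrow> real) \<Rightarrow> bool" where
  "finsler_metric F \<longleftrightarrow>
     (\<forall>x y. 0 \<le> F x y) \<and>
     smooth_on {(x, y). y \<noteq> 0} (\<lambda>(x, y). F x y) \<and>
     (\<forall>x y t. 0 < t \<longrightarrow> F x (t *\<^sub>R y) = t * F x y) \<and>
     (\<forall>x y \<xi>. y \<noteq> 0 \<longrightarrow> \<xi> \<noteq> 0 \<longrightarrow>
        0 < (\<Sum>i\<in>Basis. \<Sum>j\<in>Basis.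
               partial_deriv j (partial_deriv i (\<lambda>z. (F x z)\<^sup>2 / 2)) y * (\<xi> \<bullet> i) * (\<xi> \<bullet> j)))"

definition minkowski_metric :: "('n::euclidean_space \<Rightarrow> 'n \<Rightarrow> real) \<Rightarrow> bool" where
  "minkowski_metric F \<longleftrightarrow> finsler_metric F \<and> (\<forall>x x' y. F x y = F x' y)"

definition harmonic_symmetrization ::
  "nat \<Rightarrow> ('n::euclidean_space \<Rightarrow> 'n \<Rightarrow> real) \<Rightarrow> 'n \<Rightarrow> 'n \<Rightarrow> real" where
  "harmonic_symmetrization m F x y =
     (if y = 0 then 0
      else (2 / (F x y powi (- int m) + F x (- y) powi (- int m))) powr (1 / real m))"


section \<open>Finsler area and Finsler-minimal immersions\<close>

(* The parameter manifold is an open subset of a Euclidean space, which serves as a global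
   coordinate chart; the parametrization X is a total function, considered on that subset only. *)

definition area_density ::
  "('n::euclidean_space \<Rightarrow> 'n \<Rightarrow> real) \<Rightarrow> ('k::euclidean_space \<Rightarrow> 'n) \<Rightarrow> 'k \<Rightarrow> real" where
  "area_density F X u =
     enn2real (hausdorff_measure DIM('k) (ball (0::'k) 1) /
       hausdorff_measure DIM('k) {v. F (X u) (frechet_derivative X (at u) v) \<le> 1})"

definition finsler_area ::
  "('n::euclidean_space \<Rightarrow> 'n \<Rightarrow> real) \<Rightarrow> 'k::euclidean_space set \<Rightarrow> ('k \<Rightarrow> 'n) \<Rightarrow> real" where
  "finsler_area F \<Omega> X = (LINT u:\<Omega>|lborel. area_density F X u)"

definition C2_immersion_on ::
  "'k::euclidean_space set \<Rightarrow> ('k \<Rightarrow> 'n::euclidean_space) \<Rightarrow> bool" where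
  "C2_immersion_on U X \<longleftrightarrow> Ck_on 2 U X \<and> (\<forall>u\<in>U. inj (frechet_derivative X (at u)))"

(* As X itself is only of class C^2, smoothness is required of the displacement Y t - X. *)
definition smooth_variation ::
  "'k::euclidean_space set \<Rightarrow> ('k \<Rightarrow> 'n::euclidean_space) \<Rightarrow> 'k set \<Rightarrow> real \<Rightarrow>
     (real \<Rightarrow> 'k \<Rightarrow> 'n) \<Rightarrow> bool" where
  "smooth_variation U X C \<epsilon> Y \<longleftrightarrow>
     0 < \<epsilon> \<and> compact C \<and> C \<subseteq> U \<and>
     (\<forall>u\<in>U. Y 0 u = X u) \<and>
     (\<forall>t\<in>{-\<epsilon><..<\<epsilon>}. \<forall>u\<in>U - C. Y t u = X u) \<and>
     smooth_on ({-\<epsilon><..<\<epsilon>} \<times> U) (\<lambda>(t, u). Y t u - X u)"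

definition finsler_minimal_on ::
  "('n::euclidean_space \<Rightarrow> 'n \<Rightarrow> real) \<Rightarrow> 'k::euclidean_space set \<Rightarrow> ('k \<Rightarrow> 'n) \<Rightarrow> bool" where
  "finsler_minimal_on F U X \<longleftrightarrow>
     C2_immersion_on U X \<and>
     (\<forall>\<Omega> C \<epsilon> Y.
        open \<Omega> \<and> compact (closure \<Omega>) \<and> closure \<Omega> \<subseteq> U \<and> C \<subseteq> \<Omega> \<and> smooth_variation U X C \<epsilon> Y \<longrightarrow>
        ((\<lambda>t. finsler_area F \<Omega> (Y t)) has_real_derivative 0) (at 0))"


section \<open>Domains with continuously differentiable boundary\<close>

(* Near each boundary point the set is the strict epigraph, in the direction of a unit vector
   \<nu>, of a C^1 function on the hyperplane orthogonal to \<nu>; such a function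
   is represented by any C^1 function \<gamma> on the whole space that restricts to it. *)
definition C1_boundary :: "'a::euclidean_space set \<Rightarrow> bool" where
  "C1_boundary \<Omega> \<longleftrightarrow>
     (\<forall>p\<in>frontier \<Omega>. \<exists>r>0. \<exists>\<nu> (\<gamma> :: 'a \<Rightarrow> real).
        norm \<nu> = 1 \<and> Ck_on 1 UNIV \<gamma> \<and>
        \<Omega> \<inter> ball p r = {x \<in> ball p r. \<gamma> (x - (x \<bullet> \<nu>) *\<^sub>R \<nu>) < x \<bullet> \<nu>})"

end

theory Submission
  imports Defs
begin

text \<open>
The area of a graph u \<mapsto> (u, f(u)) is the integral of A(\<nabla> f), where A(p) is the volume of the
Euclidean unit ball divided by that of {v. F(v, p \<bullet> v) \<le> 1}, the projection of the section of the
Finsler unit ball by the tangent hyperplane. The proof rests on two properties of A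
(theorem \<open>area_integrand_strictly_convex_Lipschitz\<close>): it is strictly convex and Lipschitz.

Strict convexity is a form of Busemann's theorem on central sections
(\<open>reciprocal_section_volume_strictly_convex\<close>). For slopes on a line p0 + sq, projective coordinates
turn the volume of the section into a multiple of \<integral> \<Phi>(x,s)^-m dx over m-1 variables. The function \<Phi>
is the m-harmonic symmetrization of F restricted to an affine hyperplane, on which a Finsler
metric is strictly convex. By the Borell--Brascamp--Lieb inequality on the line, integrating one variable out of
\<Phi>^(-(n+1)) and taking the power -1/n preserves strict convexity; after m-1 such steps the
reciprocal of the volume is strictly convex in s (\<open>integrate_out_strictly_convex\<close>). Linear growth
of A follows from an elementary volume bound, and a convex function of linear growth is Lipschitz. The
volumes are Hausdorff measures, which are constant multiples of Lebesgue measure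
(\<open>hausdorff_measure_eq_const_lborel\<close>).

Convexity replaces the Euler--Lagrange equation: the area of f + t\<phi> is convex in t, hence a
minimal graph has least area among compactly supported perturbations, first smooth ones and then,
by mollification, continuously differentiable ones (\<open>minimal_graph_C1_comparison\<close>).

Let w = f1 - f2 be positive at a point where the gradients differ. Lowering f1 and raising f2 by half of
\<phi> = \<eta> g(w), with a truncation g and a cutoff \<eta> that vanishes near K, moves the two gradients
towards each other. Strict convexity makes the total area drop by a fixed amount, up to an error of at most
L \<integral> |\<nabla>\<eta>|, because A is Lipschitz and g is bounded. This integral is as small as desired since K has
vanishing (m-1)-dimensional measure (\<open>hausdorff_null_cutoff\<close>), which contradicts minimality. So
the gradient of w vanishes wherever w \<noteq> 0; as the domain without K is connected, w is a constant, and
this constant is zero because w vanishes on the boundary.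
\<close>

section \<open>Increasing transport and the strict Borell--Brascamp--Lieb inequality on the line\<close>

lemma pos_nn_integral_finite_imp_integrable:
  fixes g :: "real \<Rightarrow> real"
  assumes "continuous_on UNIV g" "\<And>x. 0 < g x" "(\<integral>\<^sup>+x. ennreal (g x) \<partial>lborel) < \<infinity>"
  shows "integrable lborel g"
proof (rule integrableI_nonneg)
  show "g \<in> borel_measurable lborel"
    using borel_measurable_continuous_onI[OF assms(1)] by simp
qed (use assms less_imp_le in auto)

text \<open>A positive continuous density has a continuously differentiable distribution function with
positive derivative, which can therefore be inverted on the open interval of its values.\<close>

lemma positive_density_cdf:
  fixes g :: "real \<Rightarrow> real"
  assumes cont: "continuous_on UNIV g" and pos: "\<And>x. 0 < g x" and int: "integrable lborel g"
  obtains \<Phi> where "\<And>x. (\<Phi> has_real_derivative g x) (at x)" "strict_mono \<Phi>"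
    "\<And>x. 0 < \<Phi> x" "\<And>x. \<Phi> x < (LINT y|lborel. g y)"
    "\<And>c. 0 < c \<Longrightarrow> c < (LINT y|lborel. g y) \<Longrightarrow> \<exists>x. \<Phi> x = c"
proof -
  define I where "I = (LINT y|lborel. g y)"
  have seti: "set_integrable lborel S g" if "S \<in> sets borel" for S
    unfolding set_integrable_def using integrable_mult_indicator[OF _ int, of S] that by simp
  define \<Phi> where "\<Phi> x = (LINT y:{..x}|lborel. g y)" for x
  \<comment> \<open>On bounded intervals the fundamental theorem of calculus is available.\<close>
  have eq: "\<Phi> x - \<Phi> a = integral {a..x} g" if "a \<le> x" for a x
  proof -
    have "{..x} = {..a} \<union> {a<..x}" using that by auto
    then have "\<Phi> x = \<Phi> a + (LINT y:{a<..x}|lborel. g y)"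
      unfolding \<Phi>_def by (subst \<open>{..x} = _\<close>, subst set_integral_Un) (auto simp: seti)
    also have "(LINT y:{a<..x}|lborel. g y) = (LINT y:{a..x}|lborel. g y)"
    proof -
      have "AE y in lborel. indicat_real {a<..x} y *\<^sub>R g y = indicat_real {a..x} y *\<^sub>R g y"
        using AE_lborel_singleton[of a] by eventually_elim (auto simp: indicator_def)
      then show ?thesis unfolding set_lebesgue_integral_def
        using integral_cong_AE[of "\<lambda>y. indicat_real {a<..x} y *\<^sub>R g y" lborel] borel_measurable_continuous_onI[OF cont]
        by simp
    qed
    also have "\<dots> = integral {a..x} g"
      by (rule set_borel_integral_eq_integral(2)) (simp add: seti)
    finally show ?thesis by simp
  qed
  have der: "(\<Phi> has_real_derivative g x) (at x)" for x
  proof -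
    have "((\<lambda>u. integral {x-1..u} g) has_real_derivative g x) (at x within {x-1..x+1})"
      by (rule integral_has_real_derivative) (auto intro: continuous_on_subset[OF cont])
    then have "((\<lambda>u. \<Phi> (x-1) + integral {x-1..u} g) has_real_derivative g x) (at x within {x-1..x+1})"
      by (auto intro!: derivative_eq_intros)
    then have "(\<Phi> has_real_derivative g x) (at x within {x-1..x+1})"
    proof (rule has_field_derivative_transform_within[where d=1])
      fix u assume "u \<in> {x-1..x+1}"
      then show "\<Phi> (x-1) + integral {x-1..u} g = \<Phi> u" using eq[of "x-1" u] by simp
    qed auto
    moreover have "at x within {x-1..x+1} = at x" by (rule at_within_interior) auto
    ultimately show ?thesis by simp
  qed
  have smono: "strict_mono \<Phi>"
    by (rule strict_monoI) (metis DERIV_pos_imp_increasing der pos)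
  have lim_top: "(\<Phi> \<longlongrightarrow> I) at_top"
    unfolding \<Phi>_def I_def set_lebesgue_integral_def by (rule tendsto_integral_at_top) (auto simp: int)
  have lim_bot: "(\<Phi> \<longlongrightarrow> 0) at_bot"
  proof -
    have "((\<lambda>x. \<Phi> (- x)) \<longlongrightarrow> 0) at_top"
    proof (rule tendsto_at_topI_sequentially)
      fix X :: "nat \<Rightarrow> real" assume X: "filterlim X at_top sequentially"
      have "(\<lambda>n. LINT y|lborel. indicator {..- X n} y *\<^sub>R g y) \<longlonglongrightarrow> (LINT y|(lborel::real measure). 0)"
      proof (rule integral_dominated_convergence)
        show "integrable lborel (\<lambda>x. norm (g x))" using int by simp
        show "AE y in lborel. (\<lambda>n. indicator {..- X n} y *\<^sub>R g y) \<longlonglongrightarrow> 0"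
        proof
          fix y
          have "eventually (\<lambda>n. - y + 1 \<le> X n) sequentially"
            using X unfolding filterlim_at_top_ge[where c="-y+1"] by auto
          then have "eventually (\<lambda>n. indicator {..- X n} y *\<^sub>R g y = 0) sequentially"
            by eventually_elim (auto simp: indicator_def)
          then show "(\<lambda>n. indicator {..- X n} y *\<^sub>R g y) \<longlonglongrightarrow> 0" by (rule tendsto_eventually)
        qed
        show "AE y in lborel. norm (indicator {..- X n} y *\<^sub>R g y) \<le> norm (g y)" for n
          by (auto split: split_indicator)
      qed (use int in auto)
      then show "(\<lambda>n. \<Phi> (- X n)) \<longlonglongrightarrow> 0" unfolding \<Phi>_def set_lebesgue_integral_def by simp
    qed
    then show ?thesis by (simp add: filterlim_at_bot_mirror)
  qed
  have lt: "\<Phi> x < I" for x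
  proof -
    have "eventually (\<lambda>y. \<Phi> (x+1) \<le> \<Phi> y) at_top"
      using eventually_ge_at_top[of "x+1"] by eventually_elim (simp add: smono strict_mono_less_eq)
    from tendsto_lowerbound[OF lim_top this] have "\<Phi> (x+1) \<le> I" by simp
    then show ?thesis using smono by (meson less_add_one less_le_trans strict_mono_less)
  qed
  have gt: "0 < \<Phi> x" for x
  proof -
    have "eventually (\<lambda>y. \<Phi> y \<le> \<Phi> (x-1)) at_bot"
      using eventually_le_at_bot[of "x-1"] by eventually_elim (simp add: smono strict_mono_less_eq)
    from tendsto_upperbound[OF lim_bot this] have "0 \<le> \<Phi> (x-1)" by simp
    moreover have "\<Phi> (x-1) < \<Phi> x" using smono by (simp add: strict_mono_less)
    ultimately show ?thesis by simp
  qed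
  have surj: "\<exists>x. \<Phi> x = c" if "0 < c" "c < I" for c
  proof -
    obtain a where a: "\<Phi> a < c"
      using order_tendstoD(2)[OF lim_bot \<open>0 < c\<close>] eventually_happens'[OF trivial_limit_at_bot_linorder] by blast
    obtain b where b: "c < \<Phi> b"
      using order_tendstoD(1)[OF lim_top \<open>c < I\<close>] eventually_happens'[OF trivial_limit_at_top_linorder] by blast
    have "a \<le> b" using a b smono by (meson less_trans not_le order.asym strict_mono_less)
    then show ?thesis
      using IVT'[of \<Phi> a c b] a b der by (meson DERIV_isCont continuous_at_imp_continuous_on less_imp_le)
  qed
  show ?thesis using that[OF der smono gt] lt surj unfolding I_def by blast
qed

text \<open>The map T matches the two distribution functions after normalizing their total masses.
Since the densities are continuous, it is differentiable at every point, and the formula for its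
derivative is the change of variables rule for densities.\<close>

lemma increasing_transport:
  fixes g0 g1 :: "real \<Rightarrow> real"
  assumes "continuous_on UNIV g0" and pos0: "\<And>x. 0 < g0 x" and "integrable lborel g0"
    and "continuous_on UNIV g1" and pos1: "\<And>x. 0 < g1 x" and "integrable lborel g1"
  obtains T where "continuous_on UNIV T"
    "\<And>x. (T has_real_derivative ((LINT y|lborel. g1 y) / (LINT y|lborel. g0 y) * (g0 x / g1 (T x)))) (at x)"
proof -
  define I0 I1 where "I0 = (LINT y|lborel. g0 y)" and "I1 = (LINT y|lborel. g1 y)"
  obtain \<Phi> where \<Phi>: "\<And>x. (\<Phi> has_real_derivative g0 x) (at x)" "strict_mono \<Phi>"
    "\<And>x. 0 < \<Phi> x" "\<And>x. \<Phi> x < I0" "\<And>c. 0 < c \<Longrightarrow> c < I0 \<Longrightarrow> \<exists>x. \<Phi> x = c"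
    using positive_density_cdf[OF assms(1-3)] unfolding I0_def by metis
  obtain \<Psi> where \<Psi>: "\<And>x. (\<Psi> has_real_derivative g1 x) (at x)" "strict_mono \<Psi>"
    "\<And>x. 0 < \<Psi> x" "\<And>x. \<Psi> x < I1" "\<And>c. 0 < c \<Longrightarrow> c < I1 \<Longrightarrow> \<exists>x. \<Psi> x = c"
    using positive_density_cdf[OF assms(4-6)] unfolding I1_def by metis
  have I: "0 < I0" "0 < I1" using \<Phi>(3,4) \<Psi>(3,4) less_trans by blast+
  define c where "c = I1 / I0"
  have c: "0 < c" using I by (simp add: c_def)
  define T where "T x = inv \<Psi> (c * \<Phi> x)" for x
  have inv: "inv \<Psi> (\<Psi> x) = x" for x using \<Psi>(2) by (simp add: strict_mono_imp_inj_on)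
  have T: "\<Psi> (T x) = c * \<Phi> x" for x
  proof -
    have "c * \<Phi> x < I1" using \<Phi>(4)[of x] I by (simp add: c_def field_simps)
    then obtain y where "\<Psi> y = c * \<Phi> x" using \<Psi>(5)[of "c * \<Phi> x"] c \<Phi>(3) by auto
    then show ?thesis unfolding T_def using inv by metis
  qed
  have dinv: "(inv \<Psi> has_real_derivative inverse (g1 y)) (at (\<Psi> y))" for y
  proof (rule DERIV_inverse_function[where f=\<Psi> and a="\<Psi> (y-1)" and b="\<Psi> (y+1)"])
    show "DERIV \<Psi> (inv \<Psi> (\<Psi> y)) :> g1 y" using \<Psi>(1) inv by simp
    show "\<Psi> (inv \<Psi> z) = z" if "\<Psi> (y - 1) < z" "z < \<Psi> (y + 1)" for z
      using \<Psi>(5)[of z] that \<Psi>(3)[of "y-1"] \<Psi>(4)[of "y+1"] inv by (metis less_trans)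
    show "isCont (inv \<Psi>) (\<Psi> y)"
      by (rule isCont_inverse_function2[where a="y-1" and b="y+1"]) (auto simp: inv intro: DERIV_isCont \<Psi>(1))
  qed (use pos1[of y] \<Psi>(2) in \<open>auto simp: strict_mono_less\<close>)
  have der: "(T has_real_derivative (c * (g0 x / g1 (T x)))) (at x)" for x
  proof -
    have "(inv \<Psi> has_real_derivative inverse (g1 (T x))) (at (c * \<Phi> x))"
      using dinv[of "T x"] by (simp add: T)
    moreover have "((\<lambda>x. c * \<Phi> x) has_real_derivative c * g0 x) (at x)"
      using \<Phi>(1) by (rule DERIV_cmult)
    ultimately have "((\<lambda>x. inv \<Psi> (c * \<Phi> x)) has_real_derivative inverse (g1 (T x)) * (c * g0 x)) (at x)"
      by (rule DERIV_chain2)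
    then show ?thesis unfolding T_def by (simp add: field_simps)
  qed
  have "continuous_on UNIV T"
    using der by (meson DERIV_isCont continuous_at_imp_continuous_on)
  then show ?thesis using that der unfolding c_def I0_def I1_def by blast
qed

text \<open>Convexity of (a, \<alpha>) \<mapsto> a^(n+1) / \<alpha>^n, the perspective of a power. It is Jensen's inequality
for the power at the points a/\<alpha> and b/\<beta>, with weights proportional to (1-t)\<alpha> and t\<beta>.\<close>

lemma power_perspective_convex:
  fixes a b \<alpha> \<beta> t :: real
  assumes t: "0 < t" "t < 1" and pos: "0 < a" "0 < b" "0 < \<alpha>" "0 < \<beta>"
  shows "((1-t)*a + t*b) ^ Suc n / ((1-t)*\<alpha> + t*\<beta>) ^ n
     \<le> (1-t) * (a ^ Suc n / \<alpha> ^ n) + t * (b ^ Suc n / \<beta> ^ n)"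
proof -
  define D where "D = (1-t)*\<alpha> + t*\<beta>"
  have D: "0 < D" unfolding D_def using assms by (simp add: add_pos_pos)
  have cvx: "convex_on {0::real..} (\<lambda>x. x ^ Suc n)"
  proof (cases "even (Suc n)")
    case True then show ?thesis using convex_on_subset[OF convex_power_even] by blast
  next
    case False then show ?thesis by (rule convex_power_odd)
  qed
  define l where "l = t*\<beta>/D"
  have l: "0 \<le> l" "l \<le> 1" "1 - l = (1-t)*\<alpha>/D"
    using assms D unfolding l_def by (auto simp: field_simps) (auto simp: D_def algebra_simps)
  have "((1-l) *\<^sub>R (a/\<alpha>) + l *\<^sub>R (b/\<beta>)) ^ Suc n \<le> (1-l) * (a/\<alpha>)^Suc n + l * (b/\<beta>)^Suc n"
    using convex_onD[OF cvx, of l "a/\<alpha>" "b/\<beta>"] l pos by simp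
  moreover have "(1-l) *\<^sub>R (a/\<alpha>) + l *\<^sub>R (b/\<beta>) = ((1-t)*a + t*b)/D"
    unfolding l(3) unfolding l_def using pos D by (simp add: add_divide_distrib)
  ultimately have "D * (((1-t)*a + t*b)/D) ^ Suc n \<le> D * ((1-l) * (a/\<alpha>)^Suc n + l * (b/\<beta>)^Suc n)"
    using D by (simp del: power_Suc)
  moreover have "D * (((1-t)*a + t*b)/D) ^ Suc n = ((1-t)*a + t*b) ^ Suc n / D ^ n"
    using D by (simp add: power_divide)
  moreover have "D * ((1-l) * (a/\<alpha>)^Suc n + l * (b/\<beta>)^Suc n) = (1-t) * (a ^ Suc n / \<alpha> ^ n) + t * (b ^ Suc n / \<beta> ^ n)"
    unfolding l(3) unfolding l_def using pos D by (simp add: power_divide field_simps)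
  ultimately show ?thesis by (simp add: D_def)
qed

text \<open>The one-dimensional Borell--Brascamp--Lieb inequality for f = F^(-(n+1)), in terms of the
numbers \<alpha>, \<beta>, \<gamma> whose -n-th powers are the integrals. Let T transport f0 to f1 and move
the points along z(x) = (1-t)x + tT(x). The hypothesis bounds ft(z) from below and the
derivative of T is explicit, so that the perspective inequality gives
ft(z) z' > (\<alpha>^n/D^n) f0 with D = (1-t)\<alpha> + t\<beta>. Integration in x turns this into
1/\<gamma>^n > 1/D^n. Strictness survives because the pointwise inequality is strict everywhere.\<close>

lemma borell_brascamp_lieb_strict:
  fixes F0 F1 Ft :: "real \<Rightarrow> real"
  assumes t: "0 < t" "t < 1"
    and cont: "continuous_on UNIV F0" "continuous_on UNIV F1" "continuous_on UNIV Ft"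
    and pos: "\<And>x. 0 < F0 x" "\<And>x. 0 < F1 x" "\<And>x. 0 < Ft x"
    and int: "integrable lborel (\<lambda>x. 1 / F0 x ^ Suc n)" "integrable lborel (\<lambda>x. 1 / F1 x ^ Suc n)"
       "integrable lborel (\<lambda>x. 1 / Ft x ^ Suc n)"
    and ineq: "\<And>x y. Ft ((1-t)*x + t*y) < (1-t)* F0 x + t * F1 y"
    and \<alpha>: "0 < \<alpha>" "(LINT x|lborel. 1 / F0 x ^ Suc n) = 1 / \<alpha> ^ n"
    and \<beta>: "0 < \<beta>" "(LINT x|lborel. 1 / F1 x ^ Suc n) = 1 / \<beta> ^ n"
    and \<gamma>: "0 < \<gamma>" "(LINT x|lborel. 1 / Ft x ^ Suc n) = 1 / \<gamma> ^ n"
  shows "\<gamma> < (1-t) * \<alpha> + t * \<beta>"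
proof -
  define D where "D = (1-t)*\<alpha> + t*\<beta>"
  have D: "0 < D" unfolding D_def using t \<alpha> \<beta> by (simp add: add_pos_pos)
  define f0 f1 ft where "f0 x = 1 / F0 x ^ Suc n" and "f1 x = 1 / F1 x ^ Suc n" and "ft x = 1 / Ft x ^ Suc n" for x
  have fpos: "0 < f0 x" "0 < f1 x" "0 < ft x" for x unfolding f0_def f1_def ft_def using pos by simp_all
  have fcont: "continuous_on UNIV f0" "continuous_on UNIV f1" "continuous_on UNIV ft"
    unfolding f0_def f1_def ft_def
    by (intro continuous_intros cont; metis pos less_irrefl power_eq_0_iff)+
  obtain T where Tc: "continuous_on UNIV T"
    and T': "\<And>x. (T has_real_derivative ((LINT y|lborel. f1 y) / (LINT y|lborel. f0 y) * (f0 x / f1 (T x)))) (at x)"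
    using increasing_transport[of f0 f1] fcont fpos int unfolding f0_def f1_def by metis
  define c where "c = (LINT y|lborel. f1 y) / (LINT y|lborel. f0 y)"
  have c: "c = \<alpha>^n / \<beta>^n" "0 < c" unfolding c_def f0_def f1_def \<alpha>(2) \<beta>(2) using \<alpha>(1) \<beta>(1) by auto
  define z where "z x = (1-t)*x + t * T x" for x
  define z' where "z' x = (1-t) + t * (c * (f0 x / f1 (T x)))" for x
  have z: "(z has_real_derivative z' x) (at x)" for x
    unfolding z_def z'_def c_def using T' by (auto intro!: derivative_eq_intros)
  have zc: "continuous_on UNIV z" unfolding z_def by (intro continuous_intros Tc)
  have f1T: "continuous_on UNIV (\<lambda>x. f1 (T x))" using continuous_on_compose2[OF fcont(2) Tc] by simp
  have z'c: "continuous_on UNIV z'" unfolding z'_def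
    by (intro continuous_intros f1T fcont) (metis fpos(2) less_irrefl)
  have z'pos: "0 < z' x" for x unfolding z'_def
    using t c(2) fpos by (intro add_pos_pos mult_pos_pos divide_pos_pos) auto
  have ftz: "continuous_on UNIV (\<lambda>x. ft (z x))" using continuous_on_compose2[OF fcont(3) zc] by simp
  define h where "h x = ft (z x) * z' x" for x
  have hc: "continuous_on UNIV h" unfolding h_def by (intro continuous_intros ftz z'c)
  have hpos: "0 < h x" for x unfolding h_def using fpos z'pos by simp
  have key: "\<alpha>^n / D^n * f0 x < h x" for x
  proof -
    let ?a = "F0 x" and ?b = "F1 (T x)"
    let ?m = "(1-t) * ?a + t * ?b"
    have m: "0 < ?m" using pos t by (simp add: add_pos_pos)
    have "Ft (z x) < ?m" unfolding z_def by (rule ineq)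
    then have "Ft (z x) ^ Suc n < ?m ^ Suc n" using pos(3) by (intro power_strict_mono) (auto intro: less_imp_le)
    then have "1 / ?m ^ Suc n < ft (z x)" unfolding ft_def using pos(3) m by (intro divide_strict_left_mono) auto
    then have 1: "1 / ?m ^ Suc n * z' x < h x" unfolding h_def using z'pos by (rule mult_strict_right_mono)
    have "?m ^ Suc n / D ^ n \<le> (1-t) * (?a ^ Suc n / \<alpha> ^ n) + t * (?b ^ Suc n / \<beta> ^ n)"
      unfolding D_def using power_perspective_convex[OF t pos(1) pos(2) \<alpha>(1) \<beta>(1)] .
    then have "\<alpha>^n * f0 x * (?m ^ Suc n / D ^ n) \<le> \<alpha>^n * f0 x * ((1-t) * (?a ^ Suc n / \<alpha> ^ n) + t * (?b ^ Suc n / \<beta> ^ n))"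
      using \<alpha>(1) fpos(1)[of x] by (intro mult_left_mono) auto
    also have "\<dots> = z' x" unfolding z'_def c f0_def f1_def using \<alpha>(1) \<beta>(1) pos(1)[of x] pos(2)[of "T x"]
      by (simp add: field_simps)
    finally have 2: "\<alpha>^n / D^n * f0 x * ?m ^ Suc n \<le> z' x" by simp
    have "\<alpha>^n / D^n * f0 x \<le> 1 / ?m ^ Suc n * z' x"
      using 2 zero_less_power[OF m, of "Suc n"] by (simp add: pos_le_divide_eq del: power_Suc)
    with 1 show ?thesis by simp
  qed
  have meas: "h \<in> borel_measurable borel" "ft \<in> borel_measurable borel" "f0 \<in> borel_measurable borel"
    using hc fcont by (auto intro: borel_measurable_continuous_onI)
  have bound: "(\<integral>\<^sup>+x. ennreal (h x) \<partial>lborel) \<le> (\<integral>\<^sup>+x. ennreal (ft x) \<partial>lborel)"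
  proof -
    \<comment> \<open>The substitution rule holds on compact intervals; monotone convergence extends it to the line.\<close>
    define hN where "hN (N::nat) x = ennreal (h x * indicat_real {-real N..real N} x)" for N x
    have "(\<integral>\<^sup>+x. hN N x \<partial>lborel) \<le> (\<integral>\<^sup>+x. ennreal (ft x) \<partial>lborel)" for N
    proof -
      have "(\<integral>\<^sup>+x. hN N x \<partial>lborel) = (\<integral>\<^sup>+x. ennreal (ft x * indicat_real {z (-real N)..z (real N)} x) \<partial>lborel)"
        unfolding hN_def h_def
      proof (rule nn_integral_substitution[symmetric])
        show "set_borel_measurable borel {z (- real N)..z (real N)} ft"
          unfolding set_borel_measurable_def using meas(2) by measurable
        show "continuous_on {- real N..real N} z'" by (rule continuous_on_subset[OF z'c]) simp
      qed (use z z'pos less_imp_le in auto)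
      also have "\<dots> \<le> (\<integral>\<^sup>+x. ennreal (ft x) \<partial>lborel)"
        by (intro nn_integral_mono ennreal_leI) (auto simp: indicator_def intro: less_imp_le fpos)
      finally show ?thesis .
    qed
    moreover have "(\<integral>\<^sup>+x. (SUP N. hN N x) \<partial>lborel) = (SUP N. \<integral>\<^sup>+x. hN N x \<partial>lborel)"
    proof (rule nn_integral_monotone_convergence_SUP)
      show "incseq hN" unfolding hN_def
        by (intro monoI le_funI ennreal_leI mult_left_mono) (auto simp: indicator_def intro: less_imp_le hpos)
      show "hN N \<in> borel_measurable lborel" for N unfolding hN_def using meas by measurable
    qed
    moreover have "(SUP N. hN N x) = ennreal (h x)" for x
    proof (rule antisym)
      show "(SUP N. hN N x) \<le> ennreal (h x)" unfolding hN_def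
        by (intro SUP_least ennreal_leI) (auto simp: indicator_def intro: less_imp_le hpos)
      obtain N :: nat where "\<bar>x\<bar> \<le> real N" using real_arch_simple by blast
      then have "ennreal (h x) = hN N x" unfolding hN_def by (auto simp: indicator_def)
      then show "ennreal (h x) \<le> (SUP N. hN N x)" by (metis UNIV_I SUP_upper)
    qed
    ultimately show ?thesis by (simp add: SUP_least)
  qed
  have ift: "(\<integral>\<^sup>+x. ennreal (ft x) \<partial>lborel) = ennreal (1 / \<gamma>^n)"
    unfolding \<gamma>(2)[symmetric] ft_def
    by (rule nn_integral_eq_integral[OF int(3) AE_I2]) (simp add: less_imp_le[OF pos(3)])
  have inth: "integrable lborel h"
    by (rule pos_nn_integral_finite_imp_integrable[OF hc hpos]) (use bound ift in \<open>auto simp: le_less_trans\<close>)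
  have "ennreal (LINT x|lborel. h x) \<le> ennreal (1 / \<gamma>^n)"
    using bound unfolding ift nn_integral_eq_integral[OF inth AE_I2[OF less_imp_le[OF hpos]]] .
  then have le: "(LINT x|lborel. h x) \<le> 1 / \<gamma>^n" using \<gamma>(1) by (simp add: ennreal_le_iff)
  have int0: "integrable lborel (\<lambda>x. \<alpha>^n / D^n * f0 x)" using int(1) unfolding f0_def by (rule integrable_mult_right)
  \<comment> \<open>A positive function has a positive integral.\<close>
  have "(LINT x|lborel. \<alpha>^n / D^n * f0 x) < (LINT x|lborel. h x)"
  proof -
    have d: "integrable lborel (\<lambda>x. h x - \<alpha>^n / D^n * f0 x)" using inth int0 by simp
    have "0 \<le> (LINT x|lborel. h x - \<alpha>^n / D^n * f0 x)"
      by (intro integral_nonneg_AE AE_I2) (use key in \<open>auto intro: less_imp_le\<close>)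
    moreover have "(LINT x|lborel. h x - \<alpha>^n / D^n * f0 x) \<noteq> 0"
    proof
      assume "(LINT x|lborel. h x - \<alpha>^n / D^n * f0 x) = 0"
      then have "AE x in lborel. h x - \<alpha>^n / D^n * f0 x = 0"
        by (subst (asm) integral_nonneg_eq_0_iff_AE[OF d]) (use key in \<open>auto intro: less_imp_le\<close>)
      then have "AE x in (lborel::real measure). False" by eventually_elim (metis key diff_gt_0_iff_gt less_irrefl)
      then show False by (simp add: ae_filter_eq_bot_iff)
    qed
    ultimately show ?thesis using inth int0 by simp
  qed
  moreover have "(LINT x|lborel. \<alpha>^n / D^n * f0 x) = 1 / D^n"
    unfolding f0_def integral_mult_right_zero \<alpha>(2) using \<alpha>(1) by simp
  ultimately have "1 / D^n < 1 / \<gamma>^n" using le by linarith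
  then have "\<gamma>^n < D^n" using D \<gamma>(1) by (simp add: field_simps)
  then show ?thesis unfolding D_def[symmetric] using D power_less_imp_less_base less_imp_le by blast
qed

section \<open>Marginals of strictly convex functions\<close>

lemma nn_integral_inverse_power_finite:
  assumes "0 < n"
  shows "(\<integral>\<^sup>+x. ennreal (1 / (1 + \<bar>x::real\<bar>) ^ Suc n) \<partial>lborel) < \<infinity>"
proof -
  define f where "f x = ennreal (1 / (1 + \<bar>x::real\<bar>)^2) * indicator {0..} x" for x :: real
  have [measurable]: "f \<in> borel_measurable borel" unfolding f_def by measurable
  have "(\<integral>\<^sup>+x. f x \<partial>lborel) = (\<integral>\<^sup>+x. ennreal (1 / (1 + \<bar>x\<bar>)^2) * indicator {0..} x \<partial>lborel)"
    unfolding f_def ..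
  also have "\<dots> = ennreal (0 - (- 1 / (1 + 0)))"
  proof (rule nn_integral_FTC_atLeast[where F="\<lambda>x::real. - 1 / (1+x)"])
    show "((\<lambda>x. - 1 / (1 + x)) has_real_derivative 1 / (1 + \<bar>x\<bar>)\<^sup>2) (at x)" if "0 \<le> x" for x :: real
      using that by (auto intro!: derivative_eq_intros simp: power2_eq_square field_simps)
    show "((\<lambda>x::real. - 1 / (1 + x)) \<longlongrightarrow> 0) at_top"
      by (rule tendsto_divide_0[OF tendsto_const])
        (rule filterlim_at_top_imp_at_infinity, rule filterlim_tendsto_add_at_top[OF tendsto_const filterlim_ident])
  qed auto
  finally have f: "(\<integral>\<^sup>+x. f x \<partial>lborel) < \<infinity>" by simp
  have "(\<integral>\<^sup>+x. f x \<partial>lborel) = (\<integral>\<^sup>+x. f (- x) \<partial>lborel)"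
    using nn_integral_real_affine[of f "-1" 0] by simp
  then have "(\<integral>\<^sup>+x. f x + f (- x) \<partial>lborel) < \<infinity>"
    using f by (subst nn_integral_add) auto
  moreover have "(\<integral>\<^sup>+x. ennreal (1 / (1 + \<bar>x::real\<bar>) ^ Suc n) \<partial>lborel) \<le> (\<integral>\<^sup>+x. f x + f (- x) \<partial>lborel)"
  proof (rule nn_integral_mono)
    fix x :: real
    have "(1 + \<bar>x\<bar>)^2 \<le> (1 + \<bar>x\<bar>) ^ Suc n" using assms by (intro power_increasing) auto
    then have "1 / (1 + \<bar>x\<bar>) ^ Suc n \<le> 1 / (1 + \<bar>x\<bar>)^2" by (intro divide_left_mono) auto
    then have "ennreal (1 / (1 + \<bar>x\<bar>) ^ Suc n) \<le> ennreal (1 / (1 + \<bar>x\<bar>)^2)" by (rule ennreal_leI)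
    also have "\<dots> \<le> f x + f (- x)" by (cases "0 \<le> x") (auto simp: f_def indicator_def)
    finally show "ennreal (1 / (1 + \<bar>x\<bar>) ^ Suc n) \<le> f x + f (- x)" .
  qed
  ultimately show ?thesis by (rule le_less_trans[rotated])
qed

lemma nn_integral_inverse_power_scaled:
  assumes "0 < N" "0 < c"
  shows "(\<integral>\<^sup>+x. ennreal (1 / (c * (N + \<bar>x::real\<bar>)) ^ Suc n) \<partial>lborel)
     = ennreal (1 / (c ^ Suc n * N ^ n)) * (\<integral>\<^sup>+x. ennreal (1 / (1 + \<bar>x::real\<bar>) ^ Suc n) \<partial>lborel)"
proof -
  have "(\<integral>\<^sup>+x. ennreal (1 / (c * (N + \<bar>x::real\<bar>)) ^ Suc n) \<partial>lborel)
      = ennreal \<bar>N\<bar> * (\<integral>\<^sup>+x. ennreal (1 / (c * (N + \<bar>0 + N * x\<bar>)) ^ Suc n) \<partial>lborel)"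
    by (rule nn_integral_real_affine) (use assms in auto)
  also have "(\<integral>\<^sup>+x. ennreal (1 / (c * (N + \<bar>0 + N * x\<bar>)) ^ Suc n) \<partial>lborel)
     = (\<integral>\<^sup>+x. ennreal (1 / (c * N) ^ Suc n) * ennreal (1 / (1 + \<bar>x::real\<bar>) ^ Suc n) \<partial>lborel)"
  proof (rule nn_integral_cong)
    fix x :: real
    have "c * (N + \<bar>0 + N * x\<bar>) = (c * N) * (1 + \<bar>x\<bar>)" using assms by (simp add: abs_mult algebra_simps)
    then have "1 / (c * (N + \<bar>0 + N * x\<bar>)) ^ Suc n = 1 / (c * N) ^ Suc n * (1 / (1 + \<bar>x\<bar>) ^ Suc n)"
      by (simp only: power_mult_distrib) simp
    moreover have "ennreal (1 / (c * N) ^ Suc n * (1 / (1 + \<bar>x\<bar>) ^ Suc n)) = ennreal (1 / (c * N) ^ Suc n) * ennreal (1 / (1 + \<bar>x\<bar>) ^ Suc n)"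
      by (rule ennreal_mult) (use assms in auto)
    ultimately show "ennreal (1 / (c * (N + \<bar>0 + N * x\<bar>)) ^ Suc n) = ennreal (1 / (c * N) ^ Suc n) * ennreal (1 / (1 + \<bar>x::real\<bar>) ^ Suc n)"
      by metis
  qed
  also have "\<dots> = ennreal (1 / (c * N) ^ Suc n) * (\<integral>\<^sup>+x. ennreal (1 / (1 + \<bar>x::real\<bar>) ^ Suc n) \<partial>lborel)"
    by (rule nn_integral_cmult) auto
  also have "ennreal \<bar>N\<bar> * \<dots> = ennreal (1 / (c ^ Suc n * N ^ n)) * (\<integral>\<^sup>+x. ennreal (1 / (1 + \<bar>x::real\<bar>) ^ Suc n) \<partial>lborel)"
    using assms by (subst mult.assoc[symmetric], subst ennreal_mult[symmetric]) (auto simp: power_mult_distrib field_simps)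
  finally show ?thesis .
qed

lemma powr_neg_inverse_power:
  assumes "0 < J" "0 < n"
  shows "1 / (J powr (- 1 / real n)) ^ n = (J::real)"
proof -
  have "(J powr (- 1 / real n)) ^ n = J powr (real n * (- 1 / real n))"
    by (rule powr_power) (use assms in simp)
  then have e: "(J powr (- 1 / real n)) ^ n = 1 / J" using assms by (simp add: powr_minus_divide)
  show ?thesis by (simp only: e) simp
qed

text \<open>Linear growth with offset N makes the slice integrable. The bound on J says that
J^(-1/n) is at least a constant multiple of N, so that linear growth in the remaining variables
is inherited when N depends on them.\<close>

lemma integrate_out_one_variable:
  fixes F :: "real \<Rightarrow> real"
  assumes n: "0 < n"
    and growth: "0 < c" "0 < N" "\<And>x. c * (N + \<bar>x\<bar>) \<le> F x"
    and conv: "\<And>x y t. 0 < t \<Longrightarrow> t < 1 \<Longrightarrow> F ((1-t)*x + t*y) \<le> (1-t) * F x + t * F y"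
  defines "J \<equiv> LINT x|lborel. 1 / F x ^ Suc n"
  shows "continuous_on UNIV F" "\<And>x. 0 < F x" "integrable lborel (\<lambda>x. 1 / F x ^ Suc n)" "0 < J"
     "J * c ^ Suc n * N ^ n \<le> enn2real (\<integral>\<^sup>+x. ennreal (1 / (1 + \<bar>x::real\<bar>) ^ Suc n) \<partial>lborel)"
     "(\<integral>\<^sup>+x. ennreal (1 / F x ^ Suc n) \<partial>lborel) = ennreal J"
proof -
  have "convex_on UNIV F"
    by (rule convex_onI) (use conv in auto)
  then show cont: "continuous_on UNIV F" by (rule convex_on_continuous[rotated]) simp
  show pos: "0 < F x" for x using growth(3)[of x] growth(1,2) by (meson add_pos_nonneg abs_ge_zero less_le_trans mult_pos_pos)
  have c1: "continuous_on UNIV (\<lambda>x. 1 / F x ^ Suc n)"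
    by (intro continuous_intros cont) (metis pos less_irrefl power_eq_0_iff)
  have p1: "0 < 1 / F x ^ Suc n" for x using pos by simp
  let ?C = "\<integral>\<^sup>+x. ennreal (1 / (1 + \<bar>x::real\<bar>) ^ Suc n) \<partial>lborel"
  have C: "?C < \<infinity>" using nn_integral_inverse_power_finite[OF n] .
  have le: "(\<integral>\<^sup>+x. ennreal (1 / F x ^ Suc n) \<partial>lborel) \<le> ennreal (1 / (c ^ Suc n * N ^ n)) * ?C"
    unfolding nn_integral_inverse_power_scaled[OF growth(2,1), symmetric]
  proof (intro nn_integral_mono ennreal_leI divide_left_mono power_mono growth(3))
    fix x show "0 \<le> c * (N + \<bar>x\<bar>)" using growth(1,2) by simp
    show "0 < F x ^ Suc n * (c * (N + \<bar>x\<bar>)) ^ Suc n" using growth(1,2) pos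
      by (intro mult_pos_pos zero_less_power) (auto intro: add_pos_nonneg)
  qed simp
  have "(\<integral>\<^sup>+x. ennreal (1 / F x ^ Suc n) \<partial>lborel) < \<infinity>"
    using le C by (metis ennreal_mult_less_top ennreal_less_top infinity_ennreal_def le_less_trans)
  from pos_nn_integral_finite_imp_integrable[OF c1 p1 this]
  show int: "integrable lborel (\<lambda>x. 1 / F x ^ Suc n)" .
  show eq: "(\<integral>\<^sup>+x. ennreal (1 / F x ^ Suc n) \<partial>lborel) = ennreal J"
    unfolding J_def by (rule nn_integral_eq_integral[OF int]) (use p1 less_imp_le in auto)
  have J0: "0 \<le> J" unfolding J_def by (intro integral_nonneg_AE AE_I2) (use p1 less_imp_le in auto)
  have "J \<noteq> 0"
  proof
    assume "J = 0"
    then have "AE x in lborel. 1 / F x ^ Suc n = 0"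
      unfolding J_def by (subst (asm) integral_nonneg_eq_0_iff_AE[OF int]) (use p1 less_imp_le in auto)
    then have "AE x in (lborel::real measure). False"
      by eventually_elim (metis p1 less_irrefl)
    then show False by (simp add: ae_filter_eq_bot_iff)
  qed
  with J0 show J: "0 < J" by simp
  have "ennreal J \<le> ennreal (1 / (c ^ Suc n * N ^ n) * enn2real ?C)"
    using le C eq growth(1,2) by (subst ennreal_mult) auto
  then have "J \<le> 1 / (c ^ Suc n * N ^ n) * enn2real ?C"
    using growth(1,2) by (subst (asm) ennreal_le_iff) auto
  then show "J * c ^ Suc n * N ^ n \<le> enn2real ?C"
    using growth(1,2) by (simp add: field_simps del: power_Suc)
qed

text \<open>Induction on the number of variables that are integrated out. Integrating
F^(-(n+1)) over one variable and taking the power -1/n of the result gives a function G of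
the remaining variables that is strictly convex, by the Borell--Brascamp--Lieb inequality, grows
linearly again, and satisfies \<integral> G^-n = \<integral> F^(-(n+1)). Each variable lowers the exponent by one, so
an exponent larger by one than the number of variables leaves 1/R with R strictly convex.

Points are total functions of which F sees the coordinates in I only; their convex
combinations can thus be formed without restriction to I.\<close>

theorem integrate_out_strictly_convex:
  fixes F :: "('i \<Rightarrow> real) \<Rightarrow> real \<Rightarrow> real"
  assumes "finite I"
    and "\<And>s. (\<lambda>x. F x s) \<in> borel_measurable (PiM I (\<lambda>_. lborel))"
    and "\<And>s. \<exists>c>0. \<forall>x. c * (1 + (\<Sum>i\<in>I. \<bar>x i\<bar>)) \<le> F x s"
    and "\<And>x y s. (\<And>i. i \<in> I \<Longrightarrow> x i = y i) \<Longrightarrow> F x s = F y s"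
    and "\<And>x0 x1 s0 s1 t. \<lbrakk>0 < t; t < 1; (\<exists>i\<in>I. x0 i \<noteq> x1 i) \<or> s0 \<noteq> s1\<rbrakk> \<Longrightarrow>
           F (\<lambda>i. (1-t) * x0 i + t * x1 i) ((1-t) * s0 + t * s1) < (1-t) * F x0 s0 + t * F x1 s1"
  shows "\<exists>R. (\<forall>s. 0 < R s \<and> (\<integral>\<^sup>+x. ennreal (1 / F x s ^ Suc (card I)) \<partial>PiM I (\<lambda>_. lborel)) = ennreal (1 / R s))
     \<and> (\<forall>s0 s1 t. 0 < t \<longrightarrow> t < 1 \<longrightarrow> s0 \<noteq> s1 \<longrightarrow> R ((1-t) * s0 + t * s1) < (1-t) * R s0 + t * R s1)"
  using assms
proof (induction I arbitrary: F rule: finite_induct)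
  case empty
  interpret product_sigma_finite "\<lambda>_::'i. lborel :: real measure" ..
  define R where "R s = F (\<lambda>_. undefined) s" for s
  have R: "F x s = R s" for x s unfolding R_def using empty.prems(3)[of x] by simp
  have "0 < R s" for s
  proof -
    obtain c where "0 < c" "\<forall>x. c * (1 + (\<Sum>i\<in>{}. \<bar>x i\<bar>)) \<le> F x s" using empty.prems(2)[of s] by blast
    then show ?thesis using R by (metis add.right_neutral less_le_trans mult.right_neutral sum.empty)
  qed
  moreover have "R ((1-t) * s0 + t * s1) < (1-t) * R s0 + t * R s1" if "0 < t" "t < 1" "s0 \<noteq> s1" for s0 s1 t
    using empty.prems(4)[OF that(1,2), of _ _ s0 s1] that(3) R by auto
  moreover have "(\<integral>\<^sup>+x. ennreal (1 / F x s ^ Suc (card ({}::'i set))) \<partial>PiM {} (\<lambda>_. lborel)) = ennreal (1 / R s)" for s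
    unfolding R card.empty power_Suc power_0 mult_1_right by (rule nn_integral_empty) simp
  ultimately show ?case by blast
next
  case (insert i I)
  interpret product_sigma_finite "\<lambda>_::'i. lborel :: real measure" ..
  define n where "n = Suc (card I)"
  have n: "0 < n" unfolding n_def by simp
  define C where "C = enn2real (\<integral>\<^sup>+x. ennreal (1 / (1 + \<bar>x::real\<bar>) ^ Suc n) \<partial>lborel)"
  define J where "J y s = (LINT x|lborel. 1 / F (y(i:=x)) s ^ Suc n)" for y s
  define N where "N y = 1 + (\<Sum>j\<in>I. \<bar>y j :: real\<bar>)" for y
  have N: "1 \<le> N y" "0 < N y" for y unfolding N_def by (auto intro: add_pos_nonneg sum_nonneg)
  define c where "c s = (SOME c. 0 < c \<and> (\<forall>x. c * (1 + (\<Sum>j\<in>insert i I. \<bar>x j\<bar>)) \<le> F x s))" for s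
  have c: "0 < c s" "c s * (1 + (\<Sum>j\<in>insert i I. \<bar>x j\<bar>)) \<le> F x s" for s x
    using someI_ex[OF insert.prems(2)[of s, simplified Bex_def]] unfolding c_def by auto
  have sumI: "(\<Sum>j\<in>I. \<bar>(y(i:=x)) j\<bar>) = (\<Sum>j\<in>I. \<bar>y j\<bar>)" for x :: real and y
    using insert.hyps by (intro sum.cong) auto
  have growth: "c s * (N y + \<bar>x\<bar>) \<le> F (y(i:=x)) s" for y s x
  proof -
    have "(\<Sum>j\<in>insert i I. \<bar>(y(i:=x)) j\<bar>) = \<bar>x\<bar> + (\<Sum>j\<in>I. \<bar>y j\<bar>)"
      by (subst sum.insert[OF insert.hyps], subst sumI) simp
    then show ?thesis using c(2)[of s "y(i:=x)"] by (simp add: N_def add_ac)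
  qed
  have upd: "(\<lambda>j. (1-t) * (y0(i:=x0)) j + t * (y1(i:=x1)) j) = (\<lambda>j. (1-t) * y0 j + t * y1 j)(i := (1-t)*x0 + t*x1)"
    for t x0 x1 :: real and y0 y1 by auto
  have conv: "F (y(i:=(1-t)*x0 + t*x1)) s \<le> (1-t) * F (y(i:=x0)) s + t * F (y(i:=x1)) s"
    if "0 < t" "t < 1" for y s x0 x1 t
  proof (cases "x0 = x1")
    case True then show ?thesis by (simp add: algebra_simps)
  next
    case False
    have "F (\<lambda>j. (1-t) * (y(i:=x0)) j + t * (y(i:=x1)) j) ((1-t) * s + t * s) < (1-t) * F (y(i:=x0)) s + t * F (y(i:=x1)) s"
      by (rule insert.prems(4)[OF that]) (use False in auto)
    then show ?thesis unfolding upd by (simp add: algebra_simps)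
  qed
  have one: "continuous_on UNIV (\<lambda>x. F (y(i:=x)) s)" "0 < F (y(i:=x)) s"
     "integrable lborel (\<lambda>x. 1 / F (y(i:=x)) s ^ Suc n)" "0 < J y s"
     "J y s * c s ^ Suc n * N y ^ n \<le> C"
     "(\<integral>\<^sup>+x. ennreal (1 / F (y(i:=x)) s ^ Suc n) \<partial>lborel) = ennreal (J y s)" for y s x
    using integrate_out_one_variable[of n "c s" "N y" "\<lambda>x. F (y(i:=x)) s", OF n c(1) N(2) growth conv]
    unfolding J_def C_def by auto
  define G where "G y s = J y s powr (- 1 / real n)" for y s
  have G: "0 < G y s" "1 / G y s ^ n = J y s" for y s
    unfolding G_def using one(4)[of y s] powr_neg_inverse_power[OF one(4) n] by auto
  have meas: "(\<lambda>y. ennreal (1 / F y s ^ Suc n)) \<in> borel_measurable (PiM (insert i I) (\<lambda>_. lborel))" for s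
    using insert.prems(1)[of s] by measurable
  have measJ: "(\<lambda>y. ennreal (J y s)) \<in> borel_measurable (PiM I (\<lambda>_. lborel))" for s
  proof -
    have "(\<lambda>(y, x). ennreal (1 / F (y(i:=x)) s ^ Suc n)) \<in> borel_measurable (PiM I (\<lambda>_. lborel) \<Otimes>\<^sub>M lborel)"
      using measurable_compose[OF measurable_add_dim meas[of s]] by (simp add: case_prod_beta')
    then show ?thesis unfolding one(6)[symmetric] by (rule sigma_finite_measure.borel_measurable_nn_integral[OF sigma_finite_lborel])
  qed
  have IH: "\<exists>R. (\<forall>s. 0 < R s \<and> (\<integral>\<^sup>+x. ennreal (1 / G x s ^ Suc (card I)) \<partial>PiM I (\<lambda>_. lborel)) = ennreal (1 / R s))
     \<and> (\<forall>s0 s1 t. 0 < t \<longrightarrow> t < 1 \<longrightarrow> s0 \<noteq> s1 \<longrightarrow> R ((1-t) * s0 + t * s1) < (1-t) * R s0 + t * R s1)"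
  proof (rule insert.IH)
    fix s
    have "(\<lambda>y. enn2real (ennreal (J y s)) powr (- 1 / real n)) \<in> borel_measurable (PiM I (\<lambda>_. lborel))"
      using measJ[of s] by measurable
    then show "(\<lambda>y. G y s) \<in> borel_measurable (PiM I (\<lambda>_. lborel))"
      unfolding G_def using one(4)[THEN less_imp_le] by simp
    have C: "0 < C" using one(5)[of undefined s] one(4)[of undefined s] c(1)[of s] N(2)[of undefined]
      by (meson less_le_trans mult_pos_pos zero_less_power)
    \<comment> \<open>The constant of linear growth of G that the bound on J provides.\<close>
    define d where "d = root n (c s ^ Suc n / C)"
    have d: "0 < d" "d ^ n = c s ^ Suc n / C" unfolding d_def using n C c(1)[of s] by auto
    have "d * N y \<le> G y s" for y
    proof -
      have "c s ^ Suc n / C * N y ^ n \<le> 1 / J y s"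
        using one(5)[of y s] one(4)[of y s] C by (simp add: field_simps)
      also have "1 / J y s = G y s ^ n" using G(2)[of y s] G(1)[of y s] by (metis divide_divide_eq_right div_by_1 mult_1)
      finally have "(d * N y) ^ n \<le> G y s ^ n" by (simp only: power_mult_distrib d)
      then show ?thesis using n G(1)[of y s] by (simp add: power_mono_iff d less_imp_le N)
    qed
    then show "\<exists>c>0. \<forall>x. c * (1 + (\<Sum>i\<in>I. \<bar>x i\<bar>)) \<le> G x s" using d(1) unfolding N_def by blast
  next
    fix x y s assume "\<And>j. j \<in> I \<Longrightarrow> x j = (y j :: real)"
    then have "F (x(i:=z)) s = F (y(i:=z)) s" for z by (intro insert.prems(3)) auto
    then show "G x s = G y s" unfolding G_def J_def by simp
  next
    fix y0 y1 :: "'i \<Rightarrow> real" and s0 s1 t :: real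
    assume t: "0 < t" "t < 1" and ne: "(\<exists>j\<in>I. y0 j \<noteq> y1 j) \<or> s0 \<noteq> s1"
    let ?yt = "\<lambda>j. (1-t) * y0 j + t * y1 j" and ?st = "(1-t) * s0 + t * s1"
    show "G ?yt ?st < (1-t) * G y0 s0 + t * G y1 s1"
    proof (rule borell_brascamp_lieb_strict[OF t one(1) one(1) one(1) one(2) one(2) one(2) one(3) one(3) one(3)])
      fix x0 x1
      have "F (\<lambda>j. (1-t) * (y0(i:=x0)) j + t * (y1(i:=x1)) j) ?st < (1-t) * F (y0(i:=x0)) s0 + t * F (y1(i:=x1)) s1"
        by (rule insert.prems(4)[OF t]) (use ne insert.hyps in auto)
      then show "F (?yt(i := (1-t)*x0 + t*x1)) ?st < (1-t) * F (y0(i:=x0)) s0 + t * F (y1(i:=x1)) s1"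
        unfolding upd .
    qed (use G in \<open>auto simp: J_def\<close>)
  qed
  have "(\<integral>\<^sup>+x. ennreal (1 / F x s ^ Suc (card (insert i I))) \<partial>PiM (insert i I) (\<lambda>_. lborel))
      = (\<integral>\<^sup>+x. ennreal (1 / G x s ^ Suc (card I)) \<partial>PiM I (\<lambda>_. lborel))" for s
  proof -
    have "(\<integral>\<^sup>+x. ennreal (1 / F x s ^ Suc n) \<partial>PiM (insert i I) (\<lambda>_. lborel))
       = (\<integral>\<^sup>+y. \<integral>\<^sup>+x. ennreal (1 / F (y(i:=x)) s ^ Suc n) \<partial>lborel \<partial>PiM I (\<lambda>_. lborel))"
      by (rule product_nn_integral_insert[OF insert.hyps meas])
    then show ?thesis using insert.hyps one(6) G(2) by (simp add: n_def[symmetric])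
  qed
  then show ?case using IH by simp
qed

section \<open>Hausdorff measure of top dimension\<close>

definition hausdorff_cost :: "nat \<Rightarrow> 'a::metric_space set \<Rightarrow> ennreal" where
  "hausdorff_cost k C = (if C = {} then 0 else ennreal (unit_ball_vol (real k) * (diameter C / 2) ^ k))"

lemma hausdorff_premeasure_le_cover:
  assumes "A \<subseteq> (\<Union>i. C i)" "\<And>i. bounded (C i)" "\<And>i. diameter (C i) \<le> \<delta>"
  shows "hausdorff_premeasure k \<delta> A \<le> (\<Sum>i. hausdorff_cost k (C i))"
  unfolding hausdorff_premeasure_def hausdorff_cost_def
  by (rule INF_lower) (use assms in auto)

lemma hausdorff_premeasure_greatest:
  assumes "\<And>C. \<lbrakk>A \<subseteq> (\<Union>i. C i); \<And>i. bounded (C i); \<And>i. diameter (C i) \<le> \<delta>\<rbrakk>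
     \<Longrightarrow> x \<le> (\<Sum>i. hausdorff_cost k (C i))"
  shows "x \<le> hausdorff_premeasure k \<delta> A"
  unfolding hausdorff_premeasure_def
  by (rule INF_greatest) (use assms in \<open>auto simp: hausdorff_cost_def\<close>)

lemma hausdorff_premeasure_cover:
  assumes "hausdorff_premeasure k \<delta> A < x"
  obtains C where "A \<subseteq> (\<Union>i. C i)" "\<And>i. bounded (C i)" "\<And>i. diameter (C i) \<le> \<delta>"
    "(\<Sum>i. hausdorff_cost k (C i)) < x"
  using assms unfolding hausdorff_premeasure_def INF_less_iff hausdorff_cost_def[symmetric] by blast

lemma hausdorff_premeasure_le_measure: "0 < \<delta> \<Longrightarrow> hausdorff_premeasure k \<delta> A \<le> hausdorff_measure k A"
  unfolding hausdorff_measure_def by (rule SUP_upper) simp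

lemma hausdorff_measure_least:
  "(\<And>\<delta>. 0 < \<delta> \<Longrightarrow> hausdorff_premeasure k \<delta> A \<le> x) \<Longrightarrow> hausdorff_measure k A \<le> x"
  unfolding hausdorff_measure_def by (rule SUP_least) simp

lemma hausdorff_premeasure_mono: "A \<subseteq> B \<Longrightarrow> hausdorff_premeasure k \<delta> A \<le> hausdorff_premeasure k \<delta> B"
  by (rule hausdorff_premeasure_greatest, rule hausdorff_premeasure_le_cover) auto

lemma hausdorff_measure_mono: "A \<subseteq> B \<Longrightarrow> hausdorff_measure k A \<le> hausdorff_measure k B"
  by (meson hausdorff_measure_least hausdorff_premeasure_le_measure hausdorff_premeasure_mono order_trans)

text \<open>Almost optimal covers of the A i, with errors e/2^(i+1), are joined along an enumeration
of the pairs of indices.\<close>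

lemma hausdorff_premeasure_UN:
  fixes A :: "nat \<Rightarrow> 'a::metric_space set"
  shows "hausdorff_premeasure k \<delta> (\<Union>i. A i) \<le> (\<Sum>i. hausdorff_premeasure k \<delta> (A i))"
proof (rule ennreal_le_epsilon)
  fix e :: real assume fin: "(\<Sum>i. hausdorff_premeasure k \<delta> (A i)) < top" and e: "0 < e"
  have "\<exists>C. A i \<subseteq> (\<Union>j. C j) \<and> (\<forall>j. bounded (C j) \<and> diameter (C j) \<le> \<delta>) \<and>
     (\<Sum>j. hausdorff_cost k (C j)) \<le> hausdorff_premeasure k \<delta> (A i) + ennreal (e * (1/2)^Suc i)" for i
  proof -
    have "hausdorff_premeasure k \<delta> (A i) \<le> (\<Sum>i. hausdorff_premeasure k \<delta> (A i))"
      using sum_le_suminf[of "\<lambda>i. hausdorff_premeasure k \<delta> (A i)" "{i}"] by simp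
    then have "hausdorff_premeasure k \<delta> (A i) < top" using fin by (rule le_less_trans)
    then have "hausdorff_premeasure k \<delta> (A i) < hausdorff_premeasure k \<delta> (A i) + ennreal (e * (1/2)^Suc i)"
      using e ennreal_add_left_cancel_less[of "hausdorff_premeasure k \<delta> (A i)" 0 "ennreal (e * (1/2)^Suc i)"]
      by (simp add: less_top)
    from hausdorff_premeasure_cover[OF this] show ?thesis by (metis less_imp_le)
  qed
  then obtain C where C: "\<And>i. A i \<subseteq> (\<Union>j. C i j)" "\<And>i j. bounded (C i j)" "\<And>i j. diameter (C i j) \<le> \<delta>"
     "\<And>i. (\<Sum>j. hausdorff_cost k (C i j)) \<le> hausdorff_premeasure k \<delta> (A i) + ennreal (e * (1/2)^Suc i)"
    by metis
  have "hausdorff_premeasure k \<delta> (\<Union>i. A i) \<le> (\<Sum>n. hausdorff_cost k (case prod_decode n of (i, j) \<Rightarrow> C i j))"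
  proof (rule hausdorff_premeasure_le_cover)
    show "(\<Union>i. A i) \<subseteq> (\<Union>n. case prod_decode n of (i, j) \<Rightarrow> C i j)"
    proof
      fix x assume "x \<in> (\<Union>i. A i)"
      then obtain i j where "x \<in> C i j" using C(1) by blast
      then have "x \<in> (case prod_decode (prod_encode (i, j)) of (i, j) \<Rightarrow> C i j)" by simp
      then show "x \<in> (\<Union>n. case prod_decode n of (i, j) \<Rightarrow> C i j)" by (rule UN_I[OF UNIV_I])
    qed
  qed (use C in \<open>auto split: prod.split\<close>)
  also have "\<dots> = (\<Sum>n. (\<lambda>(i, j). hausdorff_cost k (C i j)) (prod_decode n))"
    by (simp add: case_prod_beta')
  also have "\<dots> = (\<Sum>i. \<Sum>j. hausdorff_cost k (C i j))"
    by (rule suminf_ennreal_2dimen) simp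
  also have "\<dots> \<le> (\<Sum>i. hausdorff_premeasure k \<delta> (A i) + ennreal (e * (1/2)^Suc i))"
    by (intro suminf_le C) auto
  also have "\<dots> = (\<Sum>i. hausdorff_premeasure k \<delta> (A i)) + (\<Sum>i. ennreal (e * (1/2)^Suc i))"
    by (rule suminf_add[symmetric]) auto
  also have "(\<Sum>i. ennreal (e * (1/2)^Suc i)) = ennreal e"
    by (rule suminf_ennreal_eq) (use e sums_mult[OF power_half_series, of e] in auto)
  finally show "hausdorff_premeasure k \<delta> (\<Union>i. A i) \<le> (\<Sum>i. hausdorff_premeasure k \<delta> (A i)) + ennreal e" .
qed

lemma hausdorff_measure_UN:
  fixes A :: "nat \<Rightarrow> 'a::metric_space set"
  shows "hausdorff_measure k (\<Union>i. A i) \<le> (\<Sum>i. hausdorff_measure k (A i))"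
  by (rule hausdorff_measure_least, rule order_trans[OF hausdorff_premeasure_UN])
     (intro suminf_le hausdorff_premeasure_le_measure, auto)

lemma hausdorff_premeasure_empty [simp]: "0 < \<delta> \<Longrightarrow> hausdorff_premeasure k \<delta> ({}::'a::metric_space set) = 0"
  using hausdorff_premeasure_le_cover[of "{}" "\<lambda>_. {}::'a set" \<delta> k] by (simp add: hausdorff_cost_def)

lemma hausdorff_measure_empty [simp]: "hausdorff_measure k ({}::'a::metric_space set) = 0"
  using hausdorff_measure_least[of k "{}::'a set" 0] by simp

lemma hausdorff_premeasure_Un:
  assumes "0 < \<delta>"
  shows "hausdorff_premeasure k \<delta> (A \<union> B) \<le> hausdorff_premeasure k \<delta> A + hausdorff_premeasure k \<delta> (B :: 'a::metric_space set)"
proof -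
  define C where "C n = (if n = 0 then A else if n = Suc 0 then B else {})" for n :: nat
  have "(\<Union>i. C i) = A \<union> B" unfolding C_def by (auto split: if_splits)
  moreover have "(\<Sum>i. hausdorff_premeasure k \<delta> (C i)) = (\<Sum>i\<in>{0, Suc 0}. hausdorff_premeasure k \<delta> (C i))"
    by (rule suminf_finite) (auto simp: C_def assms)
  ultimately show ?thesis using hausdorff_premeasure_UN[of k \<delta> C] by (simp add: C_def)
qed

lemma hausdorff_measure_Un:
  "hausdorff_measure k (A \<union> B) \<le> hausdorff_measure k A + hausdorff_measure k (B :: 'a::metric_space set)"
  by (rule hausdorff_measure_least)
     (meson add_mono hausdorff_premeasure_Un hausdorff_premeasure_le_measure order_trans)

lemma hausdorff_premeasure_finite_UN:
  assumes "0 < \<delta>" "finite I"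
  shows "hausdorff_premeasure k \<delta> (\<Union>i\<in>I. A i) \<le> (\<Sum>i\<in>I. hausdorff_premeasure k \<delta> (A i :: 'a::metric_space set))"
  using assms(2)
proof induction
  case empty then show ?case using assms(1) by simp
next
  case (insert i I)
  then have "hausdorff_premeasure k \<delta> (A i \<union> (\<Union>i\<in>I. A i)) \<le> hausdorff_premeasure k \<delta> (A i) + (\<Sum>i\<in>I. hausdorff_premeasure k \<delta> (A i))"
    by (meson add_left_mono assms(1) hausdorff_premeasure_Un order_trans)
  with insert show ?case by simp
qed

lemma hausdorff_premeasure_single:
  assumes "bounded C" "diameter C \<le> \<delta>" "0 < \<delta>"
  shows "hausdorff_premeasure k \<delta> C \<le> hausdorff_cost k C"
proof -
  define D where "D n = (if n = 0 then C else {})" for n :: nat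
  have "hausdorff_premeasure k \<delta> C \<le> (\<Sum>n. hausdorff_cost k (D n))"
    by (rule hausdorff_premeasure_le_cover) (use assms in \<open>auto simp: D_def split: if_splits\<close>)
  also have "\<dots> = (\<Sum>n\<in>{0}. hausdorff_cost k (D n))"
    by (rule suminf_finite) (auto simp: D_def hausdorff_cost_def)
  finally show ?thesis by (simp add: D_def)
qed

text \<open>The image of a cover is a cover with diameters multiplied by s. The reverse inequality is
the same statement for the inverse map.\<close>

lemma hausdorff_measure_affine_le:
  fixes A :: "'a::euclidean_space set"
  assumes "0 < s"
  shows "hausdorff_measure k ((\<lambda>x. a + s *\<^sub>R x) ` A) \<le> ennreal (s ^ k) * hausdorff_measure k A"
proof (rule hausdorff_measure_least)
  fix \<delta> :: real assume "0 < \<delta>"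
  let ?T = "\<lambda>x. a + s *\<^sub>R x"
  have cost: "hausdorff_cost k (?T ` C) \<le> ennreal (s ^ k) * hausdorff_cost k C"
    and diam: "diameter (?T ` C) \<le> s * diameter C" if "bounded C" for C
  proof -
    show d: "diameter (?T ` C) \<le> s * diameter C"
    proof (rule diameter_le)
      show "?T ` C \<noteq> {} \<or> 0 \<le> s * diameter C" using assms diameter_ge_0[OF that] by simp
      fix x y assume "x \<in> ?T ` C" "y \<in> ?T ` C"
      then obtain u v where "u \<in> C" "v \<in> C" "x = ?T u" "y = ?T v" by blast
      then show "norm (x - y) \<le> s * diameter C"
        using diameter_bounded_bound[OF that, of u v] assms
        by (simp add: dist_norm scaleR_diff_right[symmetric])
    qed
    have "unit_ball_vol (real k) * (diameter (?T ` C) / 2) ^ k \<le> unit_ball_vol (real k) * (s * diameter C / 2) ^ k"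
      using d diameter_ge_0[of "?T ` C"] that
      by (intro mult_left_mono power_mono divide_right_mono) (auto intro: bounded_scaling bounded_translation simp: image_image[of "\<lambda>x. a + x" "\<lambda>x. s *\<^sub>R x", symmetric])
    also have "\<dots> = s ^ k * (unit_ball_vol (real k) * (diameter C / 2) ^ k)"
      by (simp add: power_mult_distrib power_divide)
    finally show "hausdorff_cost k (?T ` C) \<le> ennreal (s ^ k) * hausdorff_cost k C"
      using assms by (auto simp: hausdorff_cost_def ennreal_mult'[symmetric] intro: ennreal_leI)
  qed
  have "ennreal (1 / s ^ k) * hausdorff_premeasure k \<delta> (?T ` A) \<le> hausdorff_premeasure k (\<delta>/s) A"
  proof (rule hausdorff_premeasure_greatest)
    fix C :: "nat \<Rightarrow> 'a set"
    assume C: "A \<subseteq> (\<Union>i. C i)" "\<And>i. bounded (C i)" "\<And>i. diameter (C i) \<le> \<delta> / s"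
    have "hausdorff_premeasure k \<delta> (?T ` A) \<le> (\<Sum>i. hausdorff_cost k (?T ` C i))"
    proof (rule hausdorff_premeasure_le_cover)
      show "bounded (?T ` C i)" for i
        using bounded_translation[OF bounded_scaling[OF C(2)], of a s] by (simp add: image_image)
      show "diameter (?T ` C i) \<le> \<delta>" for i
        using diam[OF C(2), of i] C(3)[of i] assms by (simp add: field_simps)
    qed (use C(1) in blast)
    also have "\<dots> \<le> (\<Sum>i. ennreal (s ^ k) * hausdorff_cost k (C i))"
      by (intro suminf_le cost C) auto
    finally have "hausdorff_premeasure k \<delta> (?T ` A) \<le> ennreal (s ^ k) * (\<Sum>i. hausdorff_cost k (C i))" by simp
    then have "ennreal (1 / s ^ k) * hausdorff_premeasure k \<delta> (?T ` A) \<le> ennreal (1 / s ^ k) * (ennreal (s ^ k) * (\<Sum>i. hausdorff_cost k (C i)))"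
      by (rule mult_left_mono) simp
    also have "\<dots> = (\<Sum>i. hausdorff_cost k (C i))"
      using assms by (simp add: mult.assoc[symmetric] ennreal_mult[symmetric])
    finally show "ennreal (1 / s ^ k) * hausdorff_premeasure k \<delta> (?T ` A) \<le> (\<Sum>i. hausdorff_cost k (C i))" .
  qed
  also have "\<dots> \<le> hausdorff_measure k A" by (rule hausdorff_premeasure_le_measure) (use \<open>0 < \<delta>\<close> assms in simp)
  finally have "ennreal (s ^ k) * (ennreal (1 / s ^ k) * hausdorff_premeasure k \<delta> (?T ` A)) \<le> ennreal (s ^ k) * hausdorff_measure k A"
    by (rule mult_left_mono) simp
  then show "hausdorff_premeasure k \<delta> (?T ` A) \<le> ennreal (s ^ k) * hausdorff_measure k A"
    using assms by (simp add: mult.assoc[symmetric] ennreal_mult[symmetric])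
qed

definition cube :: "'a::euclidean_space \<Rightarrow> real \<Rightarrow> 'a set" where
  "cube a s = cbox a (a + s *\<^sub>R One)"

lemma mem_cube: "x \<in> cube a s \<longleftrightarrow> (\<forall>b\<in>Basis. a \<bullet> b \<le> x \<bullet> b \<and> x \<bullet> b \<le> a \<bullet> b + s)"
  by (simp add: cube_def mem_box inner_simps)

lemma emeasure_cube: "0 \<le> s \<Longrightarrow> emeasure lborel (cube (a::'a::euclidean_space) s) = ennreal (s ^ DIM('a))"
  unfolding cube_def by (subst emeasure_lborel_cbox) (auto simp: inner_simps)

lemma cube_affine: "0 < s \<Longrightarrow> cube (a::'a::euclidean_space) s = (\<lambda>x. a + s *\<^sub>R x) ` cube 0 1"
proof (intro set_eqI iffI)
  fix x assume s: "0 < s" and x: "x \<in> cube a s"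
  have "x = a + s *\<^sub>R ((1/s) *\<^sub>R (x - a))" using s by simp
  moreover have "(1/s) *\<^sub>R (x - a) \<in> cube 0 1" using x s by (auto simp: mem_cube inner_simps field_simps)
  ultimately show "x \<in> (\<lambda>x. a + s *\<^sub>R x) ` cube 0 1" by blast
qed (auto simp: mem_cube inner_simps mult_left_le)

lemma diameter_cube: "0 \<le> s \<Longrightarrow> diameter (cube (a::'a::euclidean_space) s) = s * norm (One::'a)"
  unfolding cube_def by (subst diameter_cbox) (auto simp: inner_simps dist_norm)

text \<open>Subdivision into N^m cubes of side 1/N gives covers of arbitrarily small mesh whose total
cost does not depend on N.\<close>

lemma hausdorff_measure_unit_cube_finite:
  "hausdorff_measure DIM('a) (cube (0::'a::euclidean_space) 1) < \<infinity>"
proof -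
  let ?m = "DIM('a)"
  define B where "B = ennreal (unit_ball_vol (real ?m) * (norm (One::'a) / 2) ^ ?m)"
  have "hausdorff_premeasure ?m \<delta> (cube (0::'a) 1) \<le> B" if \<delta>: "0 < \<delta>" for \<delta>
  proof -
    obtain N :: nat where N: "0 < N" "norm (One::'a) / \<delta> < real N"
      using reals_Archimedean2[of "norm (One::'a) / \<delta>"] \<delta> by (metis divide_nonneg_pos gr0I less_le_not_le norm_ge_zero of_nat_0)
    define I where "I = (PiE Basis (\<lambda>_::'a. {..<N}))"
    define g where "g f = (\<Sum>b\<in>Basis. (real (f b) / real N) *\<^sub>R (b::'a))" for f
    have gb: "g f \<bullet> b = real (f b) / real N" if "b \<in> Basis" for f b using that by (simp add: g_def)
    have fin: "finite I" unfolding I_def by (intro finite_PiE) auto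
    have cov: "cube (0::'a) 1 \<subseteq> (\<Union>f\<in>I. cube (g f) (1 / N))"
    proof
      fix x :: 'a assume x: "x \<in> cube 0 1"
      define f where "f = (\<lambda>b\<in>Basis. min (N - 1) (nat \<lfloor>real N * (x \<bullet> b)\<rfloor>))"
      have "f \<in> I" unfolding I_def f_def using N by auto
      moreover have "x \<in> cube (g f) (1 / N)"
        unfolding mem_cube
      proof
        fix b :: 'a assume b: "b \<in> Basis"
        let ?y = "real N * (x \<bullet> b)"
        have y: "0 \<le> ?y" "?y \<le> real N" using x b N by (auto simp: mem_cube mult_left_le)
        have fb: "f b = min (N - 1) (nat \<lfloor>?y\<rfloor>)" using b by (simp add: f_def)
        have lo: "real (f b) \<le> ?y"
        proof -
          have "real (f b) \<le> real (nat \<lfloor>?y\<rfloor>)" unfolding fb by simp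
          also have "\<dots> \<le> ?y" using y by simp
          finally show ?thesis .
        qed
        have hi: "?y \<le> real (f b) + 1"
        proof (cases "nat \<lfloor>?y\<rfloor> \<le> N - 1")
          case True then have "f b = nat \<lfloor>?y\<rfloor>" using fb by simp
          then show ?thesis using y by (simp add: of_nat_nat less_imp_le)
        next
          case False then have "f b = N - 1" using fb by simp
          then show ?thesis using y N by (simp add: of_nat_diff)
        qed
        show "g f \<bullet> b \<le> x \<bullet> b \<and> x \<bullet> b \<le> g f \<bullet> b + 1 / real N"
          unfolding gb[OF b] add_divide_distrib[symmetric] using lo hi N
          by (simp add: pos_divide_le_eq pos_le_divide_eq mult.commute)
      qed
      ultimately show "x \<in> (\<Union>f\<in>I. cube (g f) (1 / N))" by blast
    qed
    have "hausdorff_premeasure ?m \<delta> (cube (0::'a) 1) \<le> (\<Sum>f\<in>I. hausdorff_premeasure ?m \<delta> (cube (g f) (1 / N)))"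
      using hausdorff_premeasure_mono[OF cov] hausdorff_premeasure_finite_UN[OF \<delta> fin] order_trans by blast
    also have "\<dots> \<le> (\<Sum>f\<in>I. ennreal (unit_ball_vol (real ?m) * (norm (One::'a) / 2) ^ ?m / real N ^ ?m))"
    proof (rule sum_mono)
      fix f
      have d: "diameter (cube (g f) (1 / N)) = norm (One::'a) / N" by (subst diameter_cube) auto
      have "hausdorff_premeasure ?m \<delta> (cube (g f) (1 / N)) \<le> hausdorff_cost ?m (cube (g f) (1 / N))"
      proof (rule hausdorff_premeasure_single[OF _ _ \<delta>])
        show "bounded (cube (g f) (1 / N))" by (simp add: cube_def bounded_cbox)
        show "diameter (cube (g f) (1 / N)) \<le> \<delta>" unfolding d using N \<delta> by (simp add: field_simps)
      qed
      also have "\<dots> \<le> ennreal (unit_ball_vol (real ?m) * (norm (One::'a) / 2) ^ ?m / real N ^ ?m)"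
        unfolding hausdorff_cost_def d by (auto simp: power_divide field_simps)
      finally show "hausdorff_premeasure ?m \<delta> (cube (g f) (1 / N)) \<le> ennreal (unit_ball_vol (real ?m) * (norm (One::'a) / 2) ^ ?m / real N ^ ?m)" .
    qed
    also have "\<dots> = B"
    proof -
      have c: "real (card I) = real N ^ ?m" unfolding I_def by (simp add: card_PiE)
      have "(\<Sum>f\<in>I. ennreal (unit_ball_vol (real ?m) * (norm (One::'a) / 2) ^ ?m / real N ^ ?m))
        = ennreal (\<Sum>f\<in>I. unit_ball_vol (real ?m) * (norm (One::'a) / 2) ^ ?m / real N ^ ?m)"
        by (rule sum_ennreal) simp
      also have "(\<Sum>f\<in>I. unit_ball_vol (real ?m) * (norm (One::'a) / 2) ^ ?m / real N ^ ?m) = unit_ball_vol (real ?m) * (norm (One::'a) / 2) ^ ?m"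
        using N by (simp add: c)
      finally show ?thesis unfolding B_def .
    qed
    finally show ?thesis .
  qed
  then have "hausdorff_measure ?m (cube (0::'a) 1) \<le> B" by (rule hausdorff_measure_least)
  then show ?thesis unfolding B_def by (metis ennreal_less_top infinity_ennreal_def le_less_trans)
qed

text \<open>A set of diameter d lies in a ball of radius d, whose volume is 2^m times the cost of the
set. This makes the Hausdorff measure of a cube positive.\<close>

lemma emeasure_le_hausdorff_measure:
  fixes A :: "'a::euclidean_space set"
  assumes "A \<in> sets borel"
  shows "emeasure lborel A \<le> ennreal (2 ^ DIM('a)) * hausdorff_measure DIM('a) A"
proof -
  let ?m = "DIM('a)"
  have "ennreal (1 / 2 ^ ?m) * emeasure lborel A \<le> hausdorff_premeasure ?m 1 A"
  proof (rule hausdorff_premeasure_greatest)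
    fix C :: "nat \<Rightarrow> 'a set"
    assume C: "A \<subseteq> (\<Union>i. C i)" "\<And>i. bounded (C i)" "\<And>i. diameter (C i) \<le> 1"
    define D where "D i = (if C i = {} then {} else cball (SOME x. x \<in> C i) (diameter (C i)))" for i
    have CD: "C i \<subseteq> D i" for i
    proof (cases "C i = {}")
      case False
      then have "(SOME x. x \<in> C i) \<in> C i" by (simp add: some_in_eq)
      then show ?thesis unfolding D_def using False diameter_bounded_bound[OF C(2)] by auto
    qed simp
    have "emeasure lborel A \<le> emeasure lborel (\<Union>i. D i)"
    proof (rule emeasure_mono)
      show "A \<subseteq> (\<Union>i. D i)" by (rule order_trans[OF C(1)]) (intro UN_mono CD subset_refl)
      have "D i \<in> sets borel" for i by (simp add: D_def)
      then show "(\<Union>i. D i) \<in> sets lborel" by auto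
    qed
    also have "\<dots> \<le> (\<Sum>i. emeasure lborel (D i))"
      by (rule emeasure_subadditive_countably) (auto simp: D_def)
    also have "\<dots> \<le> (\<Sum>i. ennreal (2 ^ ?m) * hausdorff_cost ?m (C i))"
    proof (intro suminf_le)
      fix i
      show "emeasure lborel (D i) \<le> ennreal (2 ^ ?m) * hausdorff_cost ?m (C i)"
        using diameter_ge_0[OF C(2), of i]
        by (auto simp: D_def hausdorff_cost_def emeasure_cball ennreal_mult'[symmetric] power_divide)
    qed auto
    finally have "emeasure lborel A \<le> ennreal (2 ^ ?m) * (\<Sum>i. hausdorff_cost ?m (C i))" by simp
    then have "ennreal (1 / 2 ^ ?m) * emeasure lborel A \<le> ennreal (1 / 2 ^ ?m) * (ennreal (2 ^ ?m) * (\<Sum>i. hausdorff_cost ?m (C i)))"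
      by (rule mult_left_mono) simp
    then show "ennreal (1 / 2 ^ ?m) * emeasure lborel A \<le> (\<Sum>i. hausdorff_cost ?m (C i))"
      by (simp add: mult.assoc[symmetric] ennreal_mult[symmetric])
  qed
  also have "\<dots> \<le> hausdorff_measure ?m A" by (rule hausdorff_premeasure_le_measure) simp
  finally have "ennreal (2 ^ ?m) * (ennreal (1 / 2 ^ ?m) * emeasure lborel A) \<le> ennreal (2 ^ ?m) * hausdorff_measure ?m A"
    by (rule mult_left_mono) simp
  then show ?thesis by (simp add: mult.assoc[symmetric] ennreal_mult[symmetric])
qed

text \<open>Dyadic cubes with disjoint interiors have a total volume equal to that of their union. They
are listed without repetition, by putting the empty set in place of a cube that occurred before.\<close>

lemma cube_cover:
  fixes S :: "'a::euclidean_space set"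
  assumes S: "S \<in> sets borel" "S \<subseteq> cube a l" and l: "0 < l" and e: "0 < e"
  obtains A :: "nat \<Rightarrow> 'a set" where "S \<subseteq> (\<Union>n. A n)"
    "\<And>n. A n = {} \<or> (\<exists>u s. 0 < s \<and> A n = cube u s)"
    "(\<Sum>n. emeasure lborel (A n)) \<le> emeasure lborel S + ennreal e"
proof -
  have lm: "S \<in> lmeasurable"
    by (rule bounded_set_imp_lmeasurable[OF bounded_subset[OF bounded_cbox S(2)[unfolded cube_def]]])
       (use S(1) in simp)
  obtain D where D: "countable D" "\<And>K. K \<in> D \<Longrightarrow> K \<subseteq> cube a l \<and> K \<noteq> {} \<and> (\<exists>c d. K = cbox c d)"
     "pairwise (\<lambda>A B. interior A \<inter> interior B = {}) D"
     "\<And>u v. cbox u v \<in> D \<Longrightarrow> \<exists>n. \<forall>i\<in>Basis. v \<bullet> i - u \<bullet> i = ((a + l *\<^sub>R One) \<bullet> i - a \<bullet> i) / 2 ^ n"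
     "S \<subseteq> \<Union> D" "\<Union> D \<in> lmeasurable" "measure lebesgue (\<Union> D) \<le> measure lebesgue S + e"
    using measurable_outer_intervals_bounded[OF lm S(2)[unfolded cube_def] e] unfolding cube_def by metis
  have cub: "\<exists>u s. 0 < s \<and> K = cube u s" if K: "K \<in> D" for K
  proof -
    obtain c d where cd: "K = cbox c d" using D(2)[OF K] by blast
    then obtain n where n: "\<forall>i\<in>Basis. d \<bullet> i - c \<bullet> i = l / 2 ^ n"
      using D(4)[of c d] K by (auto simp: inner_simps)
    have "d = c + (l / 2 ^ n) *\<^sub>R One"
  proof (rule euclidean_eqI)
    fix i :: 'a assume i: "i \<in> Basis"
    then have "(c + (l / 2 ^ n) *\<^sub>R One) \<bullet> i = c \<bullet> i + l / 2 ^ n" by (simp add: inner_add_left del: sum_constant)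
    then show "d \<bullet> i = (c + (l / 2 ^ n) *\<^sub>R One) \<bullet> i" using bspec[OF n i] by linarith
  qed
    then show ?thesis using cd l by (intro exI[of _ c] exI[of _ "l / 2 ^ n"]) (auto simp: cube_def)
  qed
  \<comment> \<open>The enumeration of a finite family repeats itself, hence the test for earlier occurrences.\<close>
  define A where "A n = (if D = {} \<or> from_nat_into D n \<in> from_nat_into D ` {..<n} then {} else from_nat_into D n)" for n
  have AD: "A n = {} \<or> A n \<in> D" for n unfolding A_def by (auto simp: from_nat_into)
  have UA: "(\<Union>n. A n) = \<Union> D"
  proof
    show "(\<Union>n. A n) \<subseteq> \<Union> D" using AD by blast
    show "\<Union> D \<subseteq> (\<Union>n. A n)"
    proof
      fix x assume "x \<in> \<Union> D"
      then obtain K where K: "x \<in> K" "K \<in> D" by blast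
      then obtain n0 where "from_nat_into D n0 = K" using from_nat_into_surj[OF D(1)] by blast
      then have ex: "\<exists>n. from_nat_into D n = K" by blast
      define n where "n = (LEAST n. from_nat_into D n = K)"
      have n: "from_nat_into D n = K" unfolding n_def using ex by (rule LeastI_ex)
      have "from_nat_into D m \<noteq> K" if "m < n" for m using not_less_Least that unfolding n_def by blast
      then have "A n = K" unfolding A_def using n K by auto
      then show "x \<in> (\<Union>n. A n)" using K by blast
    qed
  qed
  have disj: "disjoint_family (\<lambda>n. interior (A n))"
    unfolding disjoint_family_on_def
  proof (intro ballI impI)
    fix m n :: nat assume "m \<noteq> n"
    have *: "interior (A m) \<inter> interior (A n) = {}" if "m < n" for m n
    proof (cases "A m = {} \<or> A n = {}")
      case False
      then have "A m = from_nat_into D m" "A n = from_nat_into D n" "from_nat_into D n \<notin> from_nat_into D ` {..<n}"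
        unfolding A_def by (auto split: if_splits)
      then have "A m \<noteq> A n" using that by auto
      then show ?thesis using AD False D(3) unfolding pairwise_def by blast
    qed auto
    show "interior (A m) \<inter> interior (A n) = {}" using *[of m n] *[of n m] \<open>m \<noteq> n\<close> by (cases "m < n") auto
  qed
  have Acub: "A n = {} \<or> (\<exists>u s. 0 < s \<and> A n = cube u s)" for n using AD cub by blast
  have int: "emeasure lborel (A n) = emeasure lborel (interior (A n))" for n
  proof (cases "A n = {}")
    case False
    then obtain u s where "0 < s" "A n = cube u s" using Acub by blast
    then show ?thesis unfolding cube_def
      by (simp add: interior_cbox emeasure_lborel_cbox_eq emeasure_lborel_box_eq)
  qed simp
  have "(\<Sum>n. emeasure lborel (A n)) = emeasure lborel (\<Union>n. interior (A n))"
    unfolding int by (rule suminf_emeasure) (use disj in auto)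
  also have "\<dots> \<le> emeasure lborel (\<Union>n. A n)"
  proof (rule emeasure_mono)
    show "(\<Union>n. interior (A n)) \<subseteq> (\<Union>n. A n)" using interior_subset by blast
    have "A n \<in> sets borel" for n using Acub[of n] by (auto simp: cube_def)
    then show "(\<Union>n. A n) \<in> sets lborel" by auto
  qed
  also have "\<dots> = emeasure lebesgue (\<Union> D)"
  proof -
    have "A n \<in> sets borel" for n using Acub[of n] by (auto simp: cube_def)
    then have "(\<Union>n. A n) \<in> sets lborel" by auto
    then show ?thesis unfolding UA by (simp add: emeasure_completion)
  qed
  also have "\<dots> = ennreal (measure lebesgue (\<Union> D))" using D(6) by (simp add: emeasure_eq_measure2 fmeasurableD2)
  also have "\<dots> \<le> ennreal (measure lebesgue S + e)" using D(7) by (rule ennreal_leI)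
  also have "\<dots> = emeasure lborel S + ennreal e"
  proof -
    have "bounded S" using bounded_subset[OF bounded_cbox S(2)[unfolded cube_def]] .
    then have "ennreal (measure lebesgue S) = emeasure lborel S"
      using S(1) emeasure_bounded_finite[of S] by (simp add: emeasure_eq_ennreal_measure less_top)
    then show ?thesis using e by (simp add: ennreal_plus)
  qed
  finally show ?thesis using that[of A] D(5) UA Acub by auto
qed

text \<open>With c the Hausdorff measure of the unit cube, covers by cubes give the bound
c |E| from above. The bound from below is the one from above for the complement of E in a
large cube Q, because the Hausdorff measure of Q is c |Q| and is subadditive. The area density is a ratio of
Hausdorff measures, from which the constant cancels.\<close>

theorem hausdorff_measure_eq_const_lborel:
  fixes dummy :: "'a::euclidean_space itself"
  obtains c where "0 < c" "\<And>E::'a set. E \<in> sets borel \<Longrightarrow> bounded E \<Longrightarrow>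
     hausdorff_measure DIM('a) E = ennreal c * emeasure lborel E"
proof -
  let ?m = "DIM('a)"
  let ?H = "hausdorff_measure ?m :: 'a set \<Rightarrow> ennreal"
  define C where "C = ?H (cube 0 1)"
  have Cfin: "C < \<infinity>" unfolding C_def by (rule hausdorff_measure_unit_cube_finite)
  have "1 \<le> ennreal (2 ^ ?m) * C"
    using emeasure_le_hausdorff_measure[of "cube (0::'a) 1"] emeasure_cube[of 1 "0::'a"] by (simp add: C_def cube_def)
  then have Cpos: "C \<noteq> 0" by auto
  define c where "c = enn2real C"
  have c: "C = ennreal c" "0 < c" using Cfin Cpos unfolding c_def by (auto simp: enn2real_positive_iff zero_less_iff_neq_zero)
  have cube_le: "?H (cube u s) \<le> ennreal c * emeasure lborel (cube u s)" if "0 < s" for u s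
  proof -
    have "?H (cube u s) \<le> ennreal (s ^ ?m) * C" unfolding cube_affine[OF that, of u] C_def by (rule hausdorff_measure_affine_le[OF that])
    then show ?thesis using that by (simp add: emeasure_cube c mult.commute)
  qed
  have cube_ge: "ennreal c * emeasure lborel (cube u s) \<le> ?H (cube u s)" if s: "0 < s" for u s
  proof -
    have "cube (0::'a) 1 = (\<lambda>x. (- (1/s) *\<^sub>R u) + (1/s) *\<^sub>R x) ` cube u s"
      unfolding cube_affine[OF s, of u] image_image using s by (simp add: algebra_simps)
    then have "C \<le> ennreal ((1/s) ^ ?m) * ?H (cube u s)"
      unfolding C_def using hausdorff_measure_affine_le[of "1/s" ?m "- (1/s) *\<^sub>R u" "cube u s"] s by simp
    then have "ennreal (s ^ ?m) * C \<le> ennreal (s ^ ?m) * (ennreal ((1/s) ^ ?m) * ?H (cube u s))"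
      by (rule mult_left_mono) simp
    also have "\<dots> = ?H (cube u s)" using s by (simp add: mult.assoc[symmetric] ennreal_mult[symmetric] power_divide)
    finally show ?thesis using s by (simp add: emeasure_cube c mult.commute)
  qed
  have le: "?H E \<le> ennreal c * emeasure lborel E" if E: "E \<in> sets borel" "E \<subseteq> cube a l" and l: "0 < l" for E a l
  proof (rule ennreal_le_epsilon)
    fix e :: real assume "0 < e"
    then have e: "0 < e / c" using c by simp
    obtain A :: "nat \<Rightarrow> 'a set" where A: "E \<subseteq> (\<Union>n. A n)"
      "\<And>n. A n = {} \<or> (\<exists>u s. 0 < s \<and> A n = cube u s)"
      "(\<Sum>n. emeasure lborel (A n)) \<le> emeasure lborel E + ennreal (e / c)"
      using cube_cover[OF E l e] by metis
    have "?H E \<le> ?H (\<Union>n. A n)" by (rule hausdorff_measure_mono[OF A(1)])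
    also have "\<dots> \<le> (\<Sum>n. ?H (A n))" by (rule hausdorff_measure_UN)
    also have "\<dots> \<le> (\<Sum>n. ennreal c * emeasure lborel (A n))"
    proof (intro suminf_le)
      show "?H (A n) \<le> ennreal c * emeasure lborel (A n)" for n using A(2)[of n] cube_le by auto
    qed auto
    also have "\<dots> = ennreal c * (\<Sum>n. emeasure lborel (A n))" by simp
    also have "\<dots> \<le> ennreal c * (emeasure lborel E + ennreal (e / c))" by (intro mult_left_mono A) simp
    also have "\<dots> = ennreal c * emeasure lborel E + ennreal e"
      using c \<open>0 < e\<close> by (simp add: distrib_left ennreal_mult[symmetric])
    finally show "?H E \<le> ennreal c * emeasure lborel E + ennreal e" .
  qed
  have "?H E = ennreal c * emeasure lborel E" if E: "E \<in> sets borel" "bounded E" for E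
  proof (rule antisym)
    obtain r where r: "0 < r" "\<And>x. x \<in> E \<Longrightarrow> norm x \<le> r" using \<open>bounded E\<close> bounded_normE by (metis less_le_trans linorder_le_less_linear order_less_imp_le zero_less_one bounded_pos)
    define Q where "Q = cube (- r *\<^sub>R One :: 'a) (2 * r)"
    have EQ: "E \<subseteq> Q"
    proof
      fix x assume "x \<in> E"
      then have "\<bar>x \<bullet> b\<bar> \<le> r" if "b \<in> Basis" for b using r(2)[of x] Basis_le_norm[OF that, of x] by linarith
      then show "x \<in> Q" unfolding Q_def mem_cube by (auto simp: inner_simps abs_le_iff) (smt (verit))+
    qed
    have l: "0 < 2 * r" using r by simp
    show "?H E \<le> ennreal c * emeasure lborel E" using le[OF E(1) EQ[unfolded Q_def] l] .
    have QE: "?H (Q - E) \<le> ennreal c * emeasure lborel (Q - E)"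
      by (rule le[OF _ _ l, of _ "- r *\<^sub>R One"]) (use E in \<open>auto simp: Q_def cube_def\<close>)
    have Qb: "Q \<in> sets borel" unfolding Q_def cube_def by simp
    have fin: "ennreal c * emeasure lborel (Q - E) < top"
    proof -
      have "emeasure lborel (Q - E) \<le> emeasure lborel Q" by (rule emeasure_mono) (use Qb in auto)
      also have "\<dots> < top" unfolding Q_def using r by (simp add: emeasure_cube)
      finally show ?thesis by (simp add: ennreal_mult_less_top)
    qed
    have "emeasure lborel Q = emeasure lborel E + emeasure lborel (Q - E)"
      using EQ E(1) Qb by (subst plus_emeasure) (auto simp: Un_absorb1)
    then have "ennreal c * emeasure lborel E + ennreal c * emeasure lborel (Q - E) = ennreal c * emeasure lborel Q"
      by (simp add: distrib_left)
    also have "\<dots> \<le> ?H Q" unfolding Q_def by (rule cube_ge[OF l])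
    also have "\<dots> \<le> ?H E + ?H (Q - E)"
      using hausdorff_measure_Un[of ?m E "Q - E"] EQ by (simp add: Un_absorb1)
    also have "\<dots> \<le> ?H E + ennreal c * emeasure lborel (Q - E)" by (intro add_left_mono QE)
    finally show "ennreal c * emeasure lborel E \<le> ?H E"
      using fin by (auto simp: add.commute ennreal_add_left_cancel_le)
  qed
  then show ?thesis using that c by blast
qed

section \<open>Finsler norms\<close>

lemma frechet_derivative_eq_sum_partial_deriv:
  fixes f :: "'a::euclidean_space \<Rightarrow> 'b::real_normed_vector"
  assumes "f differentiable (at x)"
  shows "frechet_derivative f (at x) h = (\<Sum>i\<in>Basis. (h \<bullet> i) *\<^sub>R partial_deriv i f x)"
proof -
  have lin: "linear (frechet_derivative f (at x))" by (rule linear_frechet_derivative[OF assms])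
  have "frechet_derivative f (at x) h = frechet_derivative f (at x) (\<Sum>i\<in>Basis. (h \<bullet> i) *\<^sub>R i)"
    by (simp add: euclidean_representation)
  also have "\<dots> = (\<Sum>i\<in>Basis. (h \<bullet> i) *\<^sub>R partial_deriv i f x)"
    by (simp add: linear_sum[OF lin] linear_scale[OF lin] partial_deriv_def)
  finally show ?thesis .
qed

lemma has_derivative_partial_deriv:
  fixes f :: "'a::euclidean_space \<Rightarrow> 'b::real_normed_vector"
  assumes "f differentiable (at x)"
  shows "(f has_derivative (\<lambda>h. \<Sum>i\<in>Basis. (h \<bullet> i) *\<^sub>R partial_deriv i f x)) (at x)"
  using frechet_derivative_works[THEN iffD1, OF assms] unfolding frechet_derivative_eq_sum_partial_deriv[OF assms, abs_def] .

lemma partial_deriv_eq: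
  "(f has_derivative f') (at x) \<Longrightarrow> partial_deriv i f x = f' i"
  unfolding partial_deriv_def by (metis frechet_derivative_at)

lemma strictly_convex_of_second_derivative_pos:
  fixes h :: "real \<Rightarrow> real"
  assumes d1: "\<And>t. 0 \<le> t \<Longrightarrow> t \<le> 1 \<Longrightarrow> (h has_real_derivative h' t) (at t)"
    and d2: "\<And>t. 0 \<le> t \<Longrightarrow> t \<le> 1 \<Longrightarrow> (h' has_real_derivative h'' t) (at t)"
    and pos: "\<And>t. 0 \<le> t \<Longrightarrow> t \<le> 1 \<Longrightarrow> 0 < h'' t"
    and t: "0 < t" "t < 1"
  shows "h t < (1-t) * h 0 + t * h 1"
proof -
  obtain a where a: "0 < a" "a < t" "h t - h 0 = (t - 0) * h' a"
    using MVT2[of 0 t h h'] d1 t by auto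
  obtain b where b: "t < b" "b < 1" "h 1 - h t = (1 - t) * h' b"
    using MVT2[of t 1 h h'] d1 t by auto
  have "h' a < h' b"
  proof (rule DERIV_pos_imp_increasing[of a b h'])
    show "a < b" using a b by simp
    fix x assume "a \<le> x" "x \<le> b"
    then have "0 \<le> x" "x \<le> 1" using a b by auto
    then show "\<exists>y. (h' has_real_derivative y) (at x) \<and> 0 < y" using d2 pos by blast
  qed
  then have "t * ((1-t) * h' a) < t * ((1-t) * h' b)" using t by simp
  moreover have "h 0 = h t - t * h' a" "h 1 = h t + (1-t) * h' b" using a(3) b(3) by simp_all
  then have "(1-t) * h 0 + t * h 1 = h t + t * ((1-t) * h' b) - t * ((1-t) * h' a)"
    by (simp only:) (simp add: algebra_simps)
  ultimately show ?thesis by linarith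
qed

text \<open>The properties of a Finsler metric at a fixed base point, as a function of the direction
alone: smoothness off the origin is retained up to second order.\<close>

locale finsler_norm =
  fixes g :: "'n::euclidean_space \<Rightarrow> real"
  assumes nonneg: "0 \<le> g y"
    and homogeneous: "0 < t \<Longrightarrow> g (t *\<^sub>R y) = t * g y"
    and hessian: "y \<noteq> 0 \<Longrightarrow> \<xi> \<noteq> 0 \<Longrightarrow>
        0 < (\<Sum>i\<in>Basis. \<Sum>j\<in>Basis.
               partial_deriv j (partial_deriv i (\<lambda>z. (g z)\<^sup>2 / 2)) y * (\<xi> \<bullet> i) * (\<xi> \<bullet> j))"
    and diff1: "y \<noteq> 0 \<Longrightarrow> g differentiable (at y)"
    and diff2: "y \<noteq> 0 \<Longrightarrow> i \<in> Basis \<Longrightarrow> partial_deriv i g differentiable (at y)"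

text \<open>Derivatives in y are derivatives of the joint function along the embedding
y \<mapsto> (x0, y).\<close>

lemma finsler_norm_of_metric:
  fixes G :: "'n::euclidean_space \<Rightarrow> 'n \<Rightarrow> real"
  assumes G: "finsler_metric G"
  shows "finsler_norm (G x0)"
proof
  let ?S = "{(x, y). y \<noteq> 0} :: ('n \<times> 'n) set"
  let ?G = "\<lambda>(x, y). G x y"
  have "Ck_on 2 ?S ?G" using G unfolding finsler_metric_def smooth_on_def by blast
  then have D1: "?G differentiable_on ?S" and D2: "\<And>k. k \<in> Basis \<Longrightarrow> partial_deriv k ?G differentiable_on ?S"
    by (auto simp: numeral_2_eq_2)
  have "open (UNIV \<times> (- {0 :: 'n}) :: ('n \<times> 'n) set)" by (intro open_Times) auto
  moreover have "(UNIV \<times> (- {0 :: 'n}) :: ('n \<times> 'n) set) = ?S" by auto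
  ultimately have oS: "open ?S" by metis
  have at1: "?G differentiable (at (x0, y))" if "y \<noteq> 0" for y
    using D1 that oS by (meson differentiable_on_eq_differentiable_at case_prodI mem_Collect_eq)
  have at2: "partial_deriv k ?G differentiable (at (x0, y))" if "y \<noteq> 0" "k \<in> Basis" for y k
    using D2[OF that(2)] that(1) oS by (meson differentiable_on_eq_differentiable_at case_prodI mem_Collect_eq)
  have emb: "((\<lambda>y. (x0, y)) has_derivative (\<lambda>h. (0, h))) (at y)" for y :: 'n
    by (auto intro!: derivative_eq_intros)
  have der: "(G x0 has_derivative (\<lambda>h. frechet_derivative ?G (at (x0, y)) (0, h))) (at y)" if "y \<noteq> 0" for y
    using diff_chain_at[OF emb, of ?G "frechet_derivative ?G (at (x0, y))" y] frechet_derivative_works[THEN iffD1, OF at1[OF that]]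
    by (simp add: o_def)
  show "G x0 differentiable (at y)" if "y \<noteq> 0" for y using der[OF that] by (rule differentiableI)
  show "partial_deriv i (G x0) differentiable (at y)" if y: "y \<noteq> 0" and i: "i \<in> Basis" for y i
  proof -
    have k: "(0, i) \<in> (Basis :: ('n \<times> 'n) set)" using i by (simp add: Basis_prod_def)
    have "((\<lambda>y. partial_deriv (0, i) ?G (x0, y)) has_derivative (\<lambda>h. frechet_derivative (partial_deriv (0, i) ?G) (at (x0, y)) (0, h))) (at y)"
      using diff_chain_at[OF emb, of "partial_deriv (0, i) ?G" "frechet_derivative (partial_deriv (0, i) ?G) (at (x0, y))" y]
        frechet_derivative_works[THEN iffD1, OF at2[OF y k]] by (simp add: o_def)
    then have "(partial_deriv i (G x0) has_derivative (\<lambda>h. frechet_derivative (partial_deriv (0, i) ?G) (at (x0, y)) (0, h))) (at y)"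
    proof (rule has_derivative_transform_within_open[where s="- {0}"])
      fix z :: 'n assume "z \<in> - {0}"
      then show "partial_deriv (0, i) ?G (x0, z) = partial_deriv i (G x0) z"
        using partial_deriv_eq[OF der, of z i] by (simp add: partial_deriv_def)
    qed (use y in auto)
    then show ?thesis by (rule differentiableI)
  qed
qed (use G in \<open>auto simp: finsler_metric_def\<close>)

context finsler_norm
begin

lemma zero [simp]: "g 0 = 0"
  using homogeneous[of 2 0] by simp

lemma isCont_off_zero: "y \<noteq> 0 \<Longrightarrow> isCont g y"
  using diff1 differentiable_imp_continuous_within by blast

lemma energy_derivatives:
  defines "\<phi> \<equiv> \<lambda>z. (g z)\<^sup>2 / 2"
  assumes "y \<noteq> 0"
  shows "((\<lambda>z. (g z)\<^sup>2 / 2) has_derivative (\<lambda>h. \<Sum>i\<in>Basis. (h \<bullet> i) *\<^sub>R partial_deriv i \<phi> y)) (at y)"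
    and "i \<in> Basis \<Longrightarrow> (partial_deriv i \<phi> has_derivative (\<lambda>h. \<Sum>j\<in>Basis. (h \<bullet> j) *\<^sub>R partial_deriv j (partial_deriv i \<phi>) y)) (at y)"
proof -
  have d: "(\<phi> has_derivative (\<lambda>h. g z * frechet_derivative g (at z) h)) (at z)" if "z \<noteq> 0" for z
    unfolding \<phi>_def
    using frechet_derivative_works[THEN iffD1, OF diff1[OF that]]
    by (auto intro!: derivative_eq_intros)
  then have "\<phi> differentiable (at y)" using \<open>y \<noteq> 0\<close> differentiableI by blast
  then show "((\<lambda>z. (g z)\<^sup>2 / 2) has_derivative (\<lambda>h. \<Sum>i\<in>Basis. (h \<bullet> i) *\<^sub>R partial_deriv i \<phi> y)) (at y)"
    using has_derivative_partial_deriv[of \<phi> y] unfolding \<phi>_def by blast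
  show "(partial_deriv i \<phi> has_derivative (\<lambda>h. \<Sum>j\<in>Basis. (h \<bullet> j) *\<^sub>R partial_deriv j (partial_deriv i \<phi>) y)) (at y)" if i: "i \<in> Basis"
  proof (rule has_derivative_partial_deriv)
    have "((\<lambda>z. g z * partial_deriv i g z) has_derivative
       (\<lambda>h. g y * frechet_derivative (partial_deriv i g) (at y) h + frechet_derivative g (at y) h * partial_deriv i g y)) (at y)"
      using frechet_derivative_works[THEN iffD1, OF diff1[OF \<open>y \<noteq> 0\<close>]] frechet_derivative_works[THEN iffD1, OF diff2[OF \<open>y \<noteq> 0\<close> i]]
      by (rule has_derivative_mult)
    then have "(partial_deriv i \<phi> has_derivative
       (\<lambda>h. g y * frechet_derivative (partial_deriv i g) (at y) h + frechet_derivative g (at y) h * partial_deriv i g y)) (at y)"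
    proof (rule has_derivative_transform_within_open[where s="- {0}"])
      fix z :: 'n assume "z \<in> - {0}"
      then show "g z * partial_deriv i g z = partial_deriv i \<phi> z"
        using partial_deriv_eq[OF d, of z i] by (simp add: partial_deriv_def)
    qed (use \<open>y \<noteq> 0\<close> in auto)
    then show "partial_deriv i \<phi> differentiable (at y)" by (rule differentiableI)
  qed
qed

lemma energy_along_line:
  fixes y \<xi> :: 'n
  defines "\<phi> \<equiv> \<lambda>z. (g z)\<^sup>2 / 2"
  defines "h' \<equiv> \<lambda>t. \<Sum>i\<in>Basis. (\<xi> \<bullet> i) * partial_deriv i \<phi> (y + t *\<^sub>R \<xi>)"
  defines "h'' \<equiv> \<lambda>t. \<Sum>i\<in>Basis. \<Sum>j\<in>Basis. partial_deriv j (partial_deriv i \<phi>) (y + t *\<^sub>R \<xi>) * (\<xi> \<bullet> i) * (\<xi> \<bullet> j)"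
  assumes "y + t *\<^sub>R \<xi> \<noteq> 0"
  shows "((\<lambda>t. (g (y + t *\<^sub>R \<xi>))\<^sup>2 / 2) has_real_derivative h' t) (at t)"
    and "(h' has_real_derivative h'' t) (at t)"
    and "\<xi> \<noteq> 0 \<Longrightarrow> 0 < h'' t"
proof -
  have line: "((\<lambda>t. y + t *\<^sub>R \<xi>) has_derivative (\<lambda>s. s *\<^sub>R \<xi>)) (at t)"
    by (auto intro!: derivative_eq_intros)
  have "((\<lambda>t. (g (y + t *\<^sub>R \<xi>))\<^sup>2 / 2) has_derivative (\<lambda>s. \<Sum>i\<in>Basis. ((s *\<^sub>R \<xi>) \<bullet> i) *\<^sub>R partial_deriv i \<phi> (y + t *\<^sub>R \<xi>))) (at t)"
    using has_derivative_compose[OF line energy_derivatives(1)[OF assms(4)]] unfolding \<phi>_def .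
  then show "((\<lambda>t. (g (y + t *\<^sub>R \<xi>))\<^sup>2 / 2) has_real_derivative h' t) (at t)"
    by (rule has_derivative_imp_has_field_derivative) (simp add: h'_def sum_distrib_left mult_ac)
  have "((\<lambda>t. partial_deriv i \<phi> (y + t *\<^sub>R \<xi>)) has_real_derivative (\<Sum>j\<in>Basis. partial_deriv j (partial_deriv i \<phi>) (y + t *\<^sub>R \<xi>) * (\<xi> \<bullet> j))) (at t)"
    if "i \<in> Basis" for i
    using has_derivative_compose[OF line energy_derivatives(2)[OF assms(4) that]] unfolding \<phi>_def
    by (rule has_derivative_imp_has_field_derivative) (simp add: sum_distrib_left mult_ac)
  then have "(h' has_real_derivative (\<Sum>i\<in>Basis. (\<xi> \<bullet> i) * (\<Sum>j\<in>Basis. partial_deriv j (partial_deriv i \<phi>) (y + t *\<^sub>R \<xi>) * (\<xi> \<bullet> j)))) (at t)"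
    unfolding h'_def by (intro DERIV_sum DERIV_cmult) auto
  then show "(h' has_real_derivative h'' t) (at t)" unfolding h''_def by (simp add: sum_distrib_left mult_ac)
  show "0 < h'' t" if "\<xi> \<noteq> 0" unfolding h''_def \<phi>_def by (rule hessian[OF assms(4) that])
qed

text \<open>Along the ray through y the energy g^2/2 is (1+t)^2 g(y)^2/2. If g(y) = 0 it
vanishes identically, whereas its second derivative, the Hessian in direction y, is positive.\<close>

lemma positive:
  assumes "y \<noteq> 0" shows "0 < g y"
proof (rule ccontr)
  assume "\<not> 0 < g y"
  then have "g y = 0" using nonneg[of y] by simp
  have ne: "y + t *\<^sub>R y \<noteq> 0" if "t \<in> {-1<..<1}" for t :: real
  proof -
    have "y + t *\<^sub>R y = (1 + t) *\<^sub>R y" by (simp add: scaleR_add_left)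
    then show ?thesis using that assms by simp
  qed
  have z: "(g (y + t *\<^sub>R y))\<^sup>2 / 2 = 0" if "t \<in> {-1<..<1}" for t :: real
  proof -
    have "y + t *\<^sub>R y = (1 + t) *\<^sub>R y" by (simp add: scaleR_add_left)
    then show ?thesis using homogeneous[of "1+t" y] that \<open>g y = 0\<close> by simp
  qed
  define h' where "h' t = (\<Sum>i\<in>Basis. (y \<bullet> i) * partial_deriv i (\<lambda>z. (g z)\<^sup>2 / 2) (y + t *\<^sub>R y))" for t
  have h'0: "h' t = 0" if "t \<in> {-1<..<1}" for t
  proof -
    have "((\<lambda>t. (g (y + t *\<^sub>R y))\<^sup>2 / 2) has_real_derivative h' t) (at t)"
      using energy_along_line(1)[OF ne[OF that]] unfolding h'_def .
    then have "((\<lambda>t. 0) has_real_derivative h' t) (at t)"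
      by (rule has_field_derivative_transform_within_open[where S="{-1<..<1}"]) (use that z in auto)
    then show ?thesis using DERIV_const DERIV_unique by blast
  qed
  have "0 \<in> {-1<..<1::real}" by simp
  from ne[OF this] have ne0: "y + 0 *\<^sub>R y \<noteq> 0" .
  have "(h' has_real_derivative (\<Sum>i\<in>Basis. \<Sum>j\<in>Basis. partial_deriv j (partial_deriv i (\<lambda>z. (g z)\<^sup>2 / 2)) (y + 0 *\<^sub>R y) * (y \<bullet> i) * (y \<bullet> j))) (at 0)"
    using energy_along_line(2)[OF ne0] unfolding h'_def .
  then have "((\<lambda>t. 0) has_real_derivative (\<Sum>i\<in>Basis. \<Sum>j\<in>Basis. partial_deriv j (partial_deriv i (\<lambda>z. (g z)\<^sup>2 / 2)) (y + 0 *\<^sub>R y) * (y \<bullet> i) * (y \<bullet> j))) (at 0)"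
    by (rule has_field_derivative_transform_within_open[where S="{-1<..<1}"]) (use h'0 in auto)
  then have "(\<Sum>i\<in>Basis. \<Sum>j\<in>Basis. partial_deriv j (partial_deriv i (\<lambda>z. (g z)\<^sup>2 / 2)) (y + 0 *\<^sub>R y) * (y \<bullet> i) * (y \<bullet> j)) = 0"
    using DERIV_const DERIV_unique by blast
  with energy_along_line(3)[OF ne0 assms] show False by simp
qed

text \<open>The energy is strictly convex on segments that avoid the origin. Rescaling the end points
to g = 1 turns convexity of the sublevel set {g \<le> 1} into convexity of g. A hyperplane at
positive height keeps the segments away from the origin and contains no two proportional points,
between which g would be affine.\<close>

lemma strictly_convex_on_affine_hyperplane:
  assumes e: "0 < e \<bullet> y0" "e \<bullet> y1 = e \<bullet> y0" and ne: "y0 \<noteq> y1" and t: "0 < t" "t < 1"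
  shows "g ((1-t) *\<^sub>R y0 + t *\<^sub>R y1) < (1-t) * g y0 + t * g y1"
proof -
  have nz: "y0 \<noteq> 0" "y1 \<noteq> 0" using e by auto
  define a0 a1 where "a0 = g y0" and "a1 = g y1"
  have a: "0 < a0" "0 < a1" unfolding a0_def a1_def using positive nz by auto
  define D where "D = (1-t) * a0 + t * a1"
  have D: "0 < D" unfolding D_def using a t by (simp add: add_pos_pos)
  define u0 u1 where "u0 = (1/a0) *\<^sub>R y0" and "u1 = (1/a1) *\<^sub>R y1"
  \<comment> \<open>The weight for which the combination of the rescaled end points is a multiple of the given one.\<close>
  define l where "l = t * a1 / D"
  have l: "0 < l" "l < 1" "1 - l = (1-t) * a0 / D"
    using a t D unfolding l_def by (auto simp: field_simps) (auto simp: D_def algebra_simps)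
  have gu: "g u0 = 1" "g u1 = 1" unfolding u0_def u1_def using a homogeneous[of "1/a0" y0] homogeneous[of "1/a1" y1]
    by (auto simp: a0_def a1_def)
  have eu: "0 < e \<bullet> u0" "0 < e \<bullet> u1" unfolding u0_def u1_def using e a by auto
  have une: "u1 - u0 \<noteq> 0"
  proof
    assume "u1 - u0 = 0"
    then have eq: "u1 = u0" by simp
    then have "e \<bullet> u1 = e \<bullet> u0" by simp
    then have "a0 = a1" unfolding u0_def u1_def using e a by (simp add: field_simps)
    then show False using eq ne a unfolding u0_def u1_def by simp
  qed
  have seg: "u0 + s *\<^sub>R (u1 - u0) \<noteq> 0" if "0 \<le> s" "s \<le> 1" for s
  proof
    assume "u0 + s *\<^sub>R (u1 - u0) = 0"
    then have "e \<bullet> (u0 + s *\<^sub>R (u1 - u0)) = 0" by simp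
    then have "(1-s) * (e \<bullet> u0) + s * (e \<bullet> u1) = 0" by (simp add: inner_simps algebra_simps)
    moreover have "0 < (1-s) * (e \<bullet> u0) + s * (e \<bullet> u1)"
      using that eu by (cases "s = 0") (auto intro: add_nonneg_pos)
    ultimately show False by simp
  qed
  have "(g (u0 + l *\<^sub>R (u1 - u0)))\<^sup>2 / 2 < (1-l) * ((g (u0 + 0 *\<^sub>R (u1 - u0)))\<^sup>2 / 2) + l * ((g (u0 + 1 *\<^sub>R (u1 - u0)))\<^sup>2 / 2)"
    by (rule strictly_convex_of_second_derivative_pos[OF energy_along_line(1)[OF seg] energy_along_line(2)[OF seg] energy_along_line(3)[OF seg une] l(1,2)])
  also have "\<dots> = 1/2" using gu by (simp add: field_simps)
  finally have "(g (u0 + l *\<^sub>R (u1 - u0)))\<^sup>2 < 1\<^sup>2" by simp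
  then have lt: "g (u0 + l *\<^sub>R (u1 - u0)) < 1" by (rule power_less_imp_less_base) simp
  have "u0 + l *\<^sub>R (u1 - u0) = (1 - l) *\<^sub>R u0 + l *\<^sub>R u1" by (simp add: algebra_simps)
  also have "\<dots> = (1/D) *\<^sub>R ((1-t) *\<^sub>R y0 + t *\<^sub>R y1)"
    unfolding l(3) unfolding l_def u0_def u1_def using a by (simp add: scaleR_add_right)
  finally have "g (u0 + l *\<^sub>R (u1 - u0)) = (1/D) * g ((1-t) *\<^sub>R y0 + t *\<^sub>R y1)"
    using homogeneous[of "1/D"] D by simp
  with lt have "g ((1-t) *\<^sub>R y0 + t *\<^sub>R y1) < D" using D by (simp add: divide_less_eq)
  then show ?thesis unfolding D_def a0_def a1_def .
qed

lemma norm_bounds: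
  obtains c C where "0 < c" "0 < C" "\<And>y. c * norm y \<le> g y" "\<And>y. g y \<le> C * norm y"
proof -
  obtain b :: 'n where "b \<in> Basis" by (meson ex_in_conv nonempty_Basis)
  then have ne: "sphere (0::'n) 1 \<noteq> {}" by (metis mem_sphere_0 norm_Basis empty_iff)
  have cont: "continuous_on (sphere 0 1) g"
    by (intro continuous_at_imp_continuous_on ballI isCont_off_zero) auto
  obtain u where u: "u \<in> sphere 0 1" "\<And>z. z \<in> sphere 0 1 \<Longrightarrow> g u \<le> g z"
    using continuous_attains_inf[OF compact_sphere ne cont] by blast
  obtain v where v: "v \<in> sphere 0 1" "\<And>z. z \<in> sphere 0 1 \<Longrightarrow> g z \<le> g v"
    using continuous_attains_sup[OF compact_sphere ne cont] by blast
  have pos: "0 < g u" "0 < g v" using u(1) v(1) by (auto intro!: positive)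
  have "g u * norm y \<le> g y \<and> g y \<le> g v * norm y" for y
  proof (cases "y = 0")
    case False
    then have s: "(1 / norm y) *\<^sub>R y \<in> sphere 0 1" by simp
    have "g y = norm y * g ((1 / norm y) *\<^sub>R y)" using homogeneous[of "1 / norm y" y] False by simp
    then show ?thesis using u(2)[OF s] v(2)[OF s] False by (simp add: mult.commute mult_left_mono)
  qed simp
  then show ?thesis using that pos by blast
qed

end

section \<open>Volumes of central sections\<close>

lemma nn_integral_lborel_split:
  fixes f :: "'a::euclidean_space \<Rightarrow> ennreal"
  assumes [measurable]: "f \<in> borel_measurable borel" and b0: "b0 \<in> Basis"
  shows "(\<integral>\<^sup>+w. f w \<partial>lborel) = (\<integral>\<^sup>+x. \<integral>\<^sup>+a. f ((\<Sum>b\<in>Basis - {b0}. x b *\<^sub>R b) + a *\<^sub>R b0) \<partial>lborel \<partial>PiM (Basis - {b0}) (\<lambda>_. lborel))"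
    and "(\<integral>\<^sup>+w. f w \<partial>lborel) = (\<integral>\<^sup>+a. \<integral>\<^sup>+x. f ((\<Sum>b\<in>Basis - {b0}. x b *\<^sub>R b) + a *\<^sub>R b0) \<partial>PiM (Basis - {b0}) (\<lambda>_. lborel) \<partial>lborel)"
proof -
  interpret product_sigma_finite "\<lambda>_::'a. lborel :: real measure" ..
  let ?I = "Basis - {b0}" and ?h = "\<lambda>x. \<Sum>b\<in>Basis. x b *\<^sub>R (b::'a)"
  have ins: "insert b0 ?I = Basis" using b0 by auto
  have [measurable]: "?h \<in> borel_measurable (PiM Basis (\<lambda>_. lborel))" by measurable
  have fh: "(\<lambda>x. f (?h x)) \<in> borel_measurable (PiM (insert b0 ?I) (\<lambda>_. lborel))" unfolding ins by measurable
  have eq: "?h (x(b0 := a)) = (\<Sum>b\<in>?I. x b *\<^sub>R b) + a *\<^sub>R b0" for x a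
  proof -
    have "?h (x(b0 := a)) = (\<Sum>b\<in>insert b0 ?I. (x(b0 := a)) b *\<^sub>R b)" unfolding ins ..
    also have "\<dots> = a *\<^sub>R b0 + (\<Sum>b\<in>?I. (x(b0 := a)) b *\<^sub>R b)" by (subst sum.insert) auto
    also have "(\<Sum>b\<in>?I. (x(b0 := a)) b *\<^sub>R b) = (\<Sum>b\<in>?I. x b *\<^sub>R b)" by (rule sum.cong) auto
    finally show ?thesis by (simp add: add.commute)
  qed
  have "(\<integral>\<^sup>+w. f w \<partial>lborel) = (\<integral>\<^sup>+x. f (?h x) \<partial>PiM Basis (\<lambda>_. lborel))"
    by (subst lborel_eq) (rule nn_integral_distr, measurable)
  then have *: "(\<integral>\<^sup>+w. f w \<partial>lborel) = (\<integral>\<^sup>+x. f (?h x) \<partial>PiM (insert b0 ?I) (\<lambda>_. lborel))" unfolding ins .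
  show "(\<integral>\<^sup>+w. f w \<partial>lborel) = (\<integral>\<^sup>+x. \<integral>\<^sup>+a. f ((\<Sum>b\<in>Basis - {b0}. x b *\<^sub>R b) + a *\<^sub>R b0) \<partial>lborel \<partial>PiM (Basis - {b0}) (\<lambda>_. lborel))"
    unfolding * by (subst product_nn_integral_insert[OF _ _ fh]) (simp_all only: eq finite_Diff finite_Basis, simp_all)
  show "(\<integral>\<^sup>+w. f w \<partial>lborel) = (\<integral>\<^sup>+a. \<integral>\<^sup>+x. f ((\<Sum>b\<in>Basis - {b0}. x b *\<^sub>R b) + a *\<^sub>R b0) \<partial>PiM (Basis - {b0}) (\<lambda>_. lborel) \<partial>lborel)"
    unfolding * by (subst product_nn_integral_insert_rev[OF _ _ fh]) (simp_all only: eq finite_Diff finite_Basis, simp_all)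
qed

lemma nn_integral_PiM_scale:
  fixes f :: "'a::euclidean_space \<Rightarrow> ennreal"
  assumes "finite I" "f \<in> borel_measurable borel" and c: "c \<noteq> 0"
  shows "(\<integral>\<^sup>+x. f (\<Sum>b\<in>I. x b *\<^sub>R b) \<partial>PiM I (\<lambda>_. lborel))
    = ennreal (\<bar>c\<bar> ^ card I) * (\<integral>\<^sup>+x. f (c *\<^sub>R (\<Sum>b\<in>I. x b *\<^sub>R b)) \<partial>PiM I (\<lambda>_. lborel))"
  using assms(1,2)
proof (induction I arbitrary: f rule: finite_induct)
  case empty then show ?case by simp
next
  case (insert i I)
  interpret product_sigma_finite "\<lambda>_::'a. lborel :: real measure" ..
  note [measurable] = insert.prems
  let ?h = "\<lambda>x. \<Sum>b\<in>I. x b *\<^sub>R (b::'a)"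
  have eq: "(\<Sum>b\<in>insert i I. (x(i := y)) b *\<^sub>R b) = y *\<^sub>R i + ?h x" for x y
  proof -
    have "(\<Sum>b\<in>I. (x(i := y)) b *\<^sub>R b) = ?h x" using insert.hyps by (intro sum.cong) auto
    then show ?thesis using insert.hyps by (subst sum.insert) auto
  qed
  have m1: "(\<lambda>x. g (\<Sum>b\<in>insert i I. x b *\<^sub>R b)) \<in> borel_measurable (PiM (insert i I) (\<lambda>_. lborel))"
    if [measurable]: "g \<in> borel_measurable borel" for g :: "'a \<Rightarrow> ennreal" by measurable
  define g where "g z = (\<integral>\<^sup>+y. f ((c * y) *\<^sub>R i + z) \<partial>lborel)" for z
  have [measurable]: "g \<in> borel_measurable borel" unfolding g_def
    by (rule sigma_finite_measure.borel_measurable_nn_integral[OF sigma_finite_lborel]) measurable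
  have "(\<integral>\<^sup>+x. f (\<Sum>b\<in>insert i I. x b *\<^sub>R b) \<partial>PiM (insert i I) (\<lambda>_. lborel))
      = (\<integral>\<^sup>+x. \<integral>\<^sup>+y. f (y *\<^sub>R i + ?h x) \<partial>lborel \<partial>PiM I (\<lambda>_. lborel))"
    by (subst product_nn_integral_insert[OF insert.hyps m1[OF insert.prems]]) (simp only: eq)
  also have "\<dots> = (\<integral>\<^sup>+x. ennreal \<bar>c\<bar> * g (?h x) \<partial>PiM I (\<lambda>_. lborel))"
  proof (rule nn_integral_cong)
    fix x
    show "(\<integral>\<^sup>+y. f (y *\<^sub>R i + ?h x) \<partial>lborel) = ennreal \<bar>c\<bar> * g (?h x)"
      unfolding g_def by (subst nn_integral_real_affine[OF _ c, where t=0]) auto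
  qed
  also have "\<dots> = ennreal \<bar>c\<bar> * (\<integral>\<^sup>+x. g (?h x) \<partial>PiM I (\<lambda>_. lborel))"
    by (rule nn_integral_cmult) measurable
  also have "(\<integral>\<^sup>+x. g (?h x) \<partial>PiM I (\<lambda>_. lborel)) = ennreal (\<bar>c\<bar> ^ card I) * (\<integral>\<^sup>+x. g (c *\<^sub>R ?h x) \<partial>PiM I (\<lambda>_. lborel))"
    by (rule insert.IH) measurable
  also have "(\<integral>\<^sup>+x. g (c *\<^sub>R ?h x) \<partial>PiM I (\<lambda>_. lborel))
     = (\<integral>\<^sup>+x. \<integral>\<^sup>+y. f (c *\<^sub>R (\<Sum>b\<in>insert i I. (x(i := y)) b *\<^sub>R b)) \<partial>lborel \<partial>PiM I (\<lambda>_. lborel))"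
    unfolding g_def eq by (simp add: scaleR_add_right)
  also have "\<dots> = (\<integral>\<^sup>+x. f (c *\<^sub>R (\<Sum>b\<in>insert i I. x b *\<^sub>R b)) \<partial>PiM (insert i I) (\<lambda>_. lborel))"
    by (rule product_nn_integral_insert[OF insert.hyps m1, symmetric]) measurable
  finally show ?case using insert.hyps by (simp add: ennreal_mult mult.assoc)
qed

text \<open>The linear map L is chosen such that q \<bullet> L w = w \<bullet> b0: it makes the functional q a
coordinate. Only the coordinate along b0 is changed, so that its Jacobian comes from an affine
substitution in one variable.\<close>

lemma nn_integral_shear:
  fixes f :: "'a::euclidean_space \<Rightarrow> ennreal"
  assumes [measurable]: "f \<in> borel_measurable borel" and b0: "b0 \<in> Basis" and q: "q \<bullet> b0 \<noteq> 0"
  defines "L \<equiv> \<lambda>w. w + ((w \<bullet> b0 - q \<bullet> w) / (q \<bullet> b0)) *\<^sub>R b0"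
  shows "(\<integral>\<^sup>+w. f w \<partial>lborel) = ennreal \<bar>1 / (q \<bullet> b0)\<bar> * (\<integral>\<^sup>+w. f (L w) \<partial>lborel)"
proof -
  let ?I = "Basis - {b0}" and ?q0 = "q \<bullet> b0"
  let ?h = "\<lambda>x. \<Sum>b\<in>Basis - {b0}. x b *\<^sub>R (b::'a)"
  have hb0: "?h x \<bullet> b0 = 0" for x using b0 by (simp add: inner_sum_left inner_Basis if_distrib cong: if_cong)
  have [measurable]: "L \<in> borel_measurable borel" unfolding L_def by measurable
  have Lx: "L (?h x + a *\<^sub>R b0) = ?h x + (- (q \<bullet> ?h x) / ?q0 + 1 / ?q0 * a) *\<^sub>R b0" for x a
  proof -
    have "(?h x + a *\<^sub>R b0) \<bullet> b0 = a" using b0 by (simp add: inner_add_left hb0)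
    moreover have "q \<bullet> (?h x + a *\<^sub>R b0) = q \<bullet> ?h x + a * ?q0" by (simp add: inner_add_right)
    ultimately have "L (?h x + a *\<^sub>R b0) = ?h x + (a + (a - (q \<bullet> ?h x + a * ?q0)) / ?q0) *\<^sub>R b0"
      unfolding L_def by (simp only: add.assoc scaleR_add_left)
    also have "a + (a - (q \<bullet> ?h x + a * ?q0)) / ?q0 = - (q \<bullet> ?h x) / ?q0 + 1 / ?q0 * a" using q by (simp add: field_simps)
    finally show ?thesis .
  qed
  have "(\<integral>\<^sup>+w. f w \<partial>lborel) = (\<integral>\<^sup>+x. \<integral>\<^sup>+a. f (?h x + a *\<^sub>R b0) \<partial>lborel \<partial>PiM ?I (\<lambda>_. lborel))"
    by (rule nn_integral_lborel_split(1)[OF assms(1) b0])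
  also have "\<dots> = (\<integral>\<^sup>+x. ennreal \<bar>1 / ?q0\<bar> * (\<integral>\<^sup>+a. f (L (?h x + a *\<^sub>R b0)) \<partial>lborel) \<partial>PiM ?I (\<lambda>_. lborel))"
  proof (rule nn_integral_cong)
    fix x
    show "(\<integral>\<^sup>+a. f (?h x + a *\<^sub>R b0) \<partial>lborel) = ennreal \<bar>1 / ?q0\<bar> * (\<integral>\<^sup>+a. f (L (?h x + a *\<^sub>R b0)) \<partial>lborel)"
      unfolding Lx by (rule nn_integral_real_affine) (use q in auto)
  qed
  also have "\<dots> = ennreal \<bar>1 / ?q0\<bar> * (\<integral>\<^sup>+x. \<integral>\<^sup>+a. f (L (?h x + a *\<^sub>R b0)) \<partial>lborel \<partial>PiM ?I (\<lambda>_. lborel))"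
  proof (rule nn_integral_cmult)
    show "(\<lambda>x. \<integral>\<^sup>+a. f (L (?h x + a *\<^sub>R b0)) \<partial>lborel) \<in> borel_measurable (PiM ?I (\<lambda>_. lborel))"
      by (rule sigma_finite_measure.borel_measurable_nn_integral[OF sigma_finite_lborel]) measurable
  qed
  also have "(\<integral>\<^sup>+x. \<integral>\<^sup>+a. f (L (?h x + a *\<^sub>R b0)) \<partial>lborel \<partial>PiM ?I (\<lambda>_. lborel)) = (\<integral>\<^sup>+w. f (L w) \<partial>lborel)"
    by (rule nn_integral_lborel_split(1)[OF _ b0, symmetric]) measurable
  finally show ?thesis .
qed

text \<open>The two opposite rays of the line through u are seen by K at u and at -u.\<close>

lemma nn_integral_ray:
  fixes K :: "'a::real_vector \<Rightarrow> real"
  assumes hom: "\<And>t w. 0 < t \<Longrightarrow> K (t *\<^sub>R w) = t * K w" and pos: "0 < K u" "0 < K (- u)" and m: "0 < m"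
  shows "(\<integral>\<^sup>+a. ennreal (\<bar>a\<bar> ^ (m - 1)) * indicator {a. K (a *\<^sub>R u) \<le> 1} a \<partial>lborel)
     = ennreal (1 / m * (1 / K u ^ m + 1 / K (- u) ^ m))"
proof -
  have int: "(\<integral>\<^sup>+a. ennreal (\<bar>a\<bar> ^ (m - 1)) * indicator {0..r} a \<partial>lborel) = ennreal (r ^ m / m)" if r: "0 \<le> r" for r
  proof -
    have "(\<integral>\<^sup>+a. ennreal (\<bar>a\<bar> ^ (m - 1)) * indicator {0..r} a \<partial>lborel) = ennreal (r ^ m / m - 0 ^ m / m)"
    proof (rule nn_integral_FTC_Icc)
      show "((\<lambda>a. a ^ m / real m) has_real_derivative \<bar>x\<bar> ^ (m - 1)) (at x)" if "x \<in> {0..r}" for x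
        using that m by (auto intro!: derivative_eq_intros)
    qed (use r in auto)
    then show ?thesis using m by (simp add: zero_power)
  qed
  have split: "AE a in lborel. ennreal (\<bar>a\<bar> ^ (m - 1)) * indicator {a. K (a *\<^sub>R u) \<le> 1} a
      = ennreal (\<bar>a\<bar> ^ (m - 1)) * indicator {0..1 / K u} a + ennreal (\<bar>- a\<bar> ^ (m - 1)) * indicator {0..1 / K (- u)} (- a)"
    using AE_lborel_singleton[of 0]
  proof eventually_elim
    case (elim a)
    show ?case
    proof (cases "0 < a")
      case True
      then have "K (a *\<^sub>R u) \<le> 1 \<longleftrightarrow> a \<le> 1 / K u" using hom[of a u] pos by (simp add: field_simps)
      then show ?thesis using True by (auto simp: indicator_def)
    next
      case False
      then have "0 < - a" using elim by simp
      then have "K (a *\<^sub>R u) \<le> 1 \<longleftrightarrow> - a \<le> 1 / K (- u)" using hom[of "- a" "- u"] pos by (simp add: field_simps)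
      then show ?thesis using \<open>0 < - a\<close> by (auto simp: indicator_def)
    qed
  qed
  have refl: "(\<integral>\<^sup>+a. ennreal (\<bar>- a\<bar> ^ (m - 1)) * indicator {0..r} (- a) \<partial>lborel) = (\<integral>\<^sup>+a. ennreal (\<bar>a\<bar> ^ (m - 1)) * indicator {0..r::real} a \<partial>lborel)" for r
    by (subst nn_integral_real_affine[where c="-1" and t=0, of "\<lambda>a. ennreal (\<bar>a\<bar> ^ (m - 1)) * indicator {0..r} a"]) auto
  have "(\<integral>\<^sup>+a. ennreal (\<bar>a\<bar> ^ (m - 1)) * indicator {a. K (a *\<^sub>R u) \<le> 1} a \<partial>lborel)
     = (\<integral>\<^sup>+a. ennreal (\<bar>a\<bar> ^ (m - 1)) * indicator {0..1 / K u} a + ennreal (\<bar>- a\<bar> ^ (m - 1)) * indicator {0..1 / K (- u)} (- a) \<partial>lborel)"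
    by (rule nn_integral_cong_AE[OF split])
  also have "\<dots> = (\<integral>\<^sup>+a. ennreal (\<bar>a\<bar> ^ (m - 1)) * indicator {0..1 / K u} a \<partial>lborel) + (\<integral>\<^sup>+a. ennreal (\<bar>- a\<bar> ^ (m - 1)) * indicator {0..1 / K (- u)} (- a) \<partial>lborel)"
  proof (rule nn_integral_add)
    show "(\<lambda>a. ennreal (\<bar>- a\<bar> ^ (m - 1)) * indicator {0..1 / K (- u)} (- a)) \<in> borel_measurable lborel"
    proof -
      have f: "(\<lambda>a::real. ennreal (\<bar>a\<bar> ^ (m - 1)) * indicator {0..1 / K (- u)} a) \<in> borel_measurable borel"
        by measurable
      have "(\<lambda>a::real. - a) \<in> borel_measurable lborel" by measurable
      from measurable_compose[OF this f] show ?thesis .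
    qed
  qed auto
  also have "\<dots> = ennreal ((1 / K u) ^ m / m) + ennreal ((1 / K (- u)) ^ m / m)"
    unfolding refl using pos by (subst (1 2) int) (auto simp: less_imp_le)
  also have "\<dots> = ennreal (1 / m * (1 / K u ^ m + 1 / K (- u) ^ m))"
    using pos by (subst ennreal_plus[symmetric]) (auto simp: power_divide add_divide_distrib)
  finally show ?thesis .
qed

text \<open>Projective coordinates w = a(h + b0) with h orthogonal to b0: at height a the
remaining m-1 coordinates are scaled by a, which produces the weight |a|^(m-1) along each line
through the origin.\<close>

lemma emeasure_unit_ball_projective:
  fixes K :: "'a::euclidean_space \<Rightarrow> real"
  assumes hom: "\<And>t w. 0 < t \<Longrightarrow> K (t *\<^sub>R w) = t * K w" and pos: "\<And>w. w \<noteq> 0 \<Longrightarrow> 0 < K w"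
    and [measurable]: "K \<in> borel_measurable borel" and b0: "b0 \<in> Basis"
  defines "u \<equiv> \<lambda>x. (\<Sum>b\<in>Basis - {b0}. x b *\<^sub>R b) + b0"
  shows "emeasure lborel {w. K w \<le> 1} = (\<integral>\<^sup>+x. ennreal (1 / DIM('a) * (1 / K (u x) ^ DIM('a) + 1 / K (- u x) ^ DIM('a)))
      \<partial>PiM (Basis - {b0}) (\<lambda>_. lborel))"
proof -
  let ?I = "Basis - {b0}" and ?m = "DIM('a)"
  let ?h = "\<lambda>x. \<Sum>b\<in>Basis - {b0}. x b *\<^sub>R (b::'a)"
  let ?M = "PiM ?I (\<lambda>_. lborel :: real measure)"
  have card: "card ?I = ?m - 1" using b0 by simp
  have hb0: "?h x \<bullet> b0 = 0" for x using b0 by (simp add: inner_sum_left inner_Basis if_distrib cong: if_cong)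
  have une: "u x \<noteq> 0" for x
  proof
    assume "u x = 0"
    then have "u x \<bullet> b0 = 0" by simp
    then show False using b0 by (simp add: u_def inner_add_left hb0)
  qed
  have S[measurable]: "{w. K w \<le> 1} \<in> sets borel" by measurable
  \<comment> \<open>The transformed integrand, written as a function on the whole space in order to exchange the order of integration.\<close>
  define g where "g w = ennreal (\<bar>w \<bullet> b0\<bar> ^ (?m - 1)) * indicator {w. K w \<le> 1} ((w \<bullet> b0) *\<^sub>R (w - (w \<bullet> b0) *\<^sub>R b0 + b0))" for w
  have g: "g (?h x + a *\<^sub>R b0) = ennreal (\<bar>a\<bar> ^ (?m - 1)) * indicator {w. K w \<le> 1} (a *\<^sub>R u x)" for x a
  proof -
    have "(?h x + a *\<^sub>R b0) \<bullet> b0 = a" using b0 by (simp add: inner_add_left hb0)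
    then show ?thesis unfolding g_def u_def by simp
  qed
  have [measurable]: "g \<in> borel_measurable borel" unfolding g_def by measurable
  have "emeasure lborel {w. K w \<le> 1} = (\<integral>\<^sup>+w. indicator {w. K w \<le> 1} w \<partial>lborel)"
    by (rule nn_integral_indicator[symmetric]) simp
  also have "\<dots> = (\<integral>\<^sup>+a. \<integral>\<^sup>+x. indicator {w. K w \<le> 1} (?h x + a *\<^sub>R b0) \<partial>?M \<partial>lborel)"
    by (rule nn_integral_lborel_split(2)[OF _ b0]) measurable
  also have "\<dots> = (\<integral>\<^sup>+a. \<integral>\<^sup>+x. g (?h x + a *\<^sub>R b0) \<partial>?M \<partial>lborel)"
  proof (rule nn_integral_cong_AE)
    show "AE a in lborel. (\<integral>\<^sup>+x. indicator {w. K w \<le> 1} (?h x + a *\<^sub>R b0) \<partial>?M) = (\<integral>\<^sup>+x. g (?h x + a *\<^sub>R b0) \<partial>?M)"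
      using AE_lborel_singleton[of 0]
    proof eventually_elim
      case (elim a)
      have "(\<integral>\<^sup>+x. indicator {w. K w \<le> 1} (?h x + a *\<^sub>R b0) \<partial>?M)
         = ennreal (\<bar>a\<bar> ^ card ?I) * (\<integral>\<^sup>+x. indicator {w. K w \<le> 1} (a *\<^sub>R ?h x + a *\<^sub>R b0) \<partial>?M)"
        by (rule nn_integral_PiM_scale[where f="\<lambda>z. indicator {w. K w \<le> 1} (z + a *\<^sub>R b0)"]) (use elim in \<open>auto\<close>)
      also have "\<dots> = (\<integral>\<^sup>+x. ennreal (\<bar>a\<bar> ^ card ?I) * indicator {w. K w \<le> 1} (a *\<^sub>R ?h x + a *\<^sub>R b0) \<partial>?M)"
        by (rule nn_integral_cmult[symmetric]) measurable
      finally show ?case unfolding g card u_def by (simp add: scaleR_add_right)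
    qed
  qed
  also have "\<dots> = (\<integral>\<^sup>+x. \<integral>\<^sup>+a. g (?h x + a *\<^sub>R b0) \<partial>lborel \<partial>?M)"
    using nn_integral_lborel_split[OF \<open>g \<in> borel_measurable borel\<close> b0] by simp
  also have "\<dots> = (\<integral>\<^sup>+x. ennreal (1 / ?m * (1 / K (u x) ^ ?m + 1 / K (- u x) ^ ?m)) \<partial>?M)"
  proof (rule nn_integral_cong)
    fix x
    have "(\<integral>\<^sup>+a. g (?h x + a *\<^sub>R b0) \<partial>lborel) = (\<integral>\<^sup>+a. ennreal (\<bar>a\<bar> ^ (?m - 1)) * indicator {a. K (a *\<^sub>R u x) \<le> 1} a \<partial>lborel)"
      unfolding g by (intro nn_integral_cong) (auto simp: indicator_def)
    also have "\<dots> = ennreal (1 / ?m * (1 / K (u x) ^ ?m + 1 / K (- u x) ^ ?m))"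
      by (rule nn_integral_ray[OF hom]) (use pos une in auto)
    finally show "(\<integral>\<^sup>+a. g (?h x + a *\<^sub>R b0) \<partial>lborel) = ennreal (1 / ?m * (1 / K (u x) ^ ?m + 1 / K (- u x) ^ ?m))" .
  qed
  finally show ?thesis .
qed

lemma (in finsler_norm) measurable_norm [measurable]: "g \<in> borel_measurable borel"
proof (rule borel_measurable_continuous_countable_exceptions)
  show "countable {0::'n}" by simp
  show "continuous_on (- {0}) g" by (intro continuous_at_imp_continuous_on ballI isCont_off_zero) auto
qed

text \<open>A strict form of Busemann's theorem. The slopes run along a line p0 + s q. In projective
coordinates v = a lx(x), where q \<bullet> lx(x) = 1, the volume of the section is a multiple of
\<integral> \<Phi>(x,s)^-m dx over m-1 variables, where \<Phi>(x,s) = G(lx(x), p0 \<bullet> lx(x) + s). The contributions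
F(y)^-m + F(-y)^-m of opposite rays combine to 2 G(y)^-m, which is where the
m-harmonic symmetrization G replaces F. Since the argument of G is affine and injective in (x,s)
and stays in an affine hyperplane off the origin, \<Phi> is strictly convex, and the theorem on
marginals applies with m-1 variables and exponent m.\<close>

theorem reciprocal_section_volume_strictly_convex:
  fixes F G :: "'a::euclidean_space \<times> real \<Rightarrow> real"
  assumes F: "finsler_norm F" and G: "finsler_norm G"
    and sym: "\<And>y. y \<noteq> 0 \<Longrightarrow> 1 / F y ^ DIM('a) + 1 / F (- y) ^ DIM('a) = 2 / G y ^ DIM('a)"
    and q: "q \<noteq> 0"
  obtains \<kappa> R where "0 < \<kappa>" "\<And>s::real. 0 < R s"
    "\<And>s. emeasure lborel {v. F (v, (p0 + s *\<^sub>R q) \<bullet> v) \<le> 1} = ennreal (\<kappa> / R s)"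
    "\<And>s0 s1 t. \<lbrakk>0 < t; t < 1; s0 \<noteq> s1\<rbrakk> \<Longrightarrow> R ((1-t) * s0 + t * s1) < (1-t) * R s0 + t * R s1"
proof -
  interpret F: finsler_norm F by (rule F)
  interpret G: finsler_norm G by (rule G)
  let ?m = "DIM('a)"
  obtain b0 where b0: "b0 \<in> Basis" "q \<bullet> b0 \<noteq> 0" using q by (metis euclidean_all_zero_iff)
  let ?I = "Basis - {b0}" and ?q0 = "q \<bullet> b0"
  let ?M = "PiM ?I (\<lambda>_. lborel :: real measure)"
  let ?h = "\<lambda>x. \<Sum>b\<in>Basis - {b0}. x b *\<^sub>R (b::'a)"
  have card: "Suc (card ?I) = ?m" using b0 by simp
  have hb0: "?h x \<bullet> b0 = 0" for x using b0 by (simp add: inner_sum_left inner_Basis if_distrib cong: if_cong)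
  have hb: "?h x \<bullet> b = x b" if "b \<in> ?I" for x b
  proof -
    have "?h x \<bullet> b = (\<Sum>c\<in>?I. if c = b then x c else 0)"
      unfolding inner_sum_left by (rule sum.cong) (use that in \<open>auto simp: inner_Basis\<close>)
    then show ?thesis using that by simp
  qed
  define L where "L w = w + ((w \<bullet> b0 - q \<bullet> w) / ?q0) *\<^sub>R b0" for w
  have [measurable]: "L \<in> borel_measurable borel" unfolding L_def by measurable
  have qL: "q \<bullet> L w = w \<bullet> b0" for w unfolding L_def using b0 by (simp add: inner_add_right)
  have Llin: "L (w + z) = L w + L z" "L (t *\<^sub>R w) = t *\<^sub>R L w" for w z t
    unfolding L_def by (auto simp: inner_add_left inner_add_right algebra_simps add_divide_distrib diff_divide_distrib)
  have Lm: "L (- w) = - L w" for w using Llin(2)[of "-1" w] by simp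
  have Lb: "L w \<bullet> b = w \<bullet> b" if "b \<in> ?I" for w b
    unfolding L_def using that b0 by (auto simp: inner_add_left inner_Basis)
  have Lne: "L w \<noteq> 0" if "w \<noteq> 0" for w
  proof
    assume 0: "L w = 0"
    have "w \<bullet> b = 0" if "b \<in> Basis" for b
      using qL[of w] Lb[of b w] 0 that by (cases "b = b0") auto
    then show False using \<open>w \<noteq> 0\<close> by (metis euclidean_all_zero_iff)
  qed
  define u where "u x = ?h x + b0" for x
  have ub0: "u x \<bullet> b0 = 1" for x unfolding u_def using b0 by (simp add: inner_add_left hb0)
  have une: "u x \<noteq> 0" for x using ub0[of x] by auto
  define lx where "lx x = L (u x)" for x
  have qlx: "q \<bullet> lx x = 1" for x unfolding lx_def qL ub0 ..
  have lxb: "lx x \<bullet> b = x b" if "b \<in> ?I" for x b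
    unfolding lx_def Lb[OF that] u_def using that b0 hb[OF that] by (auto simp: inner_add_left inner_Basis)
  define \<Phi> where "\<Phi> x s = G (lx x, p0 \<bullet> lx x + s)" for x s
  have [measurable]: "u \<in> borel_measurable ?M" unfolding u_def by measurable
  then have [measurable]: "lx \<in> borel_measurable ?M" unfolding lx_def by measurable
  have meas: "(\<lambda>x. \<Phi> x s) \<in> borel_measurable ?M" for s
    unfolding \<Phi>_def by measurable
  obtain c where c: "0 < c" "\<And>y. c * norm y \<le> G y" using G.norm_bounds by metis
  have growth: "\<exists>c>0. \<forall>x. c * (1 + (\<Sum>i\<in>?I. \<bar>x i\<bar>)) \<le> \<Phi> x s" for s
  proof -
    \<comment> \<open>The norm of lx(x) is at least 1/|q|, because q \<bullet> lx(x) = 1, and at least each of its coordinates.\<close>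
    define D where "D = norm q + real (card ?I)"
    have D: "0 < D" unfolding D_def using q by (simp add: add_pos_nonneg)
    have "c / D * (1 + (\<Sum>i\<in>?I. \<bar>x i\<bar>)) \<le> \<Phi> x s" for x
    proof -
      have "1 \<le> norm q * norm (lx x)" using qlx[of x] norm_cauchy_schwarz[of q "lx x"] by simp
      moreover have "(\<Sum>i\<in>?I. \<bar>x i\<bar>) \<le> (\<Sum>i\<in>?I. norm (lx x))"
        by (intro sum_mono) (metis Basis_le_norm DiffD1 lxb)
      ultimately have "1 + (\<Sum>i\<in>?I. \<bar>x i\<bar>) \<le> D * norm (lx x)" unfolding D_def by (simp add: distrib_right)
      then have "c / D * (1 + (\<Sum>i\<in>?I. \<bar>x i\<bar>)) \<le> c / D * (D * norm (lx x))"
        using c D by (intro mult_left_mono) auto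
      also have "\<dots> = c * norm (lx x)" using D by simp
      also have "\<dots> \<le> c * norm (lx x, p0 \<bullet> lx x + s)" using c norm_fst_le[of "lx x" "p0 \<bullet> lx x + s"] by simp
      also have "\<dots> \<le> \<Phi> x s" unfolding \<Phi>_def by (rule c)
      finally show ?thesis .
    qed
    then show ?thesis using c D by (meson divide_pos_pos)
  qed
  have dep: "\<Phi> x s = \<Phi> y s" if "\<And>i. i \<in> ?I \<Longrightarrow> x i = y i" for x y s
  proof -
    have "?h x = ?h y" using that by (intro sum.cong) auto
    then show ?thesis unfolding \<Phi>_def lx_def u_def by simp
  qed
  have conv: "\<Phi> (\<lambda>i. (1-t) * x0 i + t * x1 i) ((1-t) * s0 + t * s1) < (1-t) * \<Phi> x0 s0 + t * \<Phi> x1 s1"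
    if t: "0 < t" "t < 1" and ne: "(\<exists>i\<in>?I. x0 i \<noteq> x1 i) \<or> s0 \<noteq> s1" for x0 x1 s0 s1 t
  proof -
    let ?xt = "\<lambda>i. (1-t) * x0 i + t * x1 i"
    have "?h ?xt = (1-t) *\<^sub>R ?h x0 + t *\<^sub>R ?h x1"
      by (simp add: scaleR_sum_right sum.distrib scaleR_add_left)
    then have "u ?xt = (1-t) *\<^sub>R u x0 + t *\<^sub>R u x1" unfolding u_def by (simp add: algebra_simps)
    then have l: "lx ?xt = (1-t) *\<^sub>R lx x0 + t *\<^sub>R lx x1" unfolding lx_def by (simp add: Llin)
    have neq: "(lx x0, p0 \<bullet> lx x0 + s0) \<noteq> (lx x1, p0 \<bullet> lx x1 + s1)"
    proof
      assume eq: "(lx x0, p0 \<bullet> lx x0 + s0) = (lx x1, p0 \<bullet> lx x1 + s1)"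
      then have "lx x0 = lx x1" by simp
      then have "x0 i = x1 i" if "i \<in> ?I" for i using lxb[OF that] by metis
      then show False using eq ne by auto
    qed
    have "G ((1-t) *\<^sub>R (lx x0, p0 \<bullet> lx x0 + s0) + t *\<^sub>R (lx x1, p0 \<bullet> lx x1 + s1)) < (1-t) * \<Phi> x0 s0 + t * \<Phi> x1 s1"
      unfolding \<Phi>_def
      by (rule G.strictly_convex_on_affine_hyperplane[where e="(q, 0)", OF _ _ neq t]) (auto simp: qlx)
    moreover have "(1-t) *\<^sub>R (lx x0, p0 \<bullet> lx x0 + s0) + t *\<^sub>R (lx x1, p0 \<bullet> lx x1 + s1) = (lx ?xt, p0 \<bullet> lx ?xt + ((1-t) * s0 + t * s1))"
      unfolding l by (auto simp: inner_add_right algebra_simps)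
    ultimately show ?thesis unfolding \<Phi>_def by simp
  qed
  obtain R where R: "\<And>s. 0 < R s"
      "\<And>s. (\<integral>\<^sup>+x. ennreal (1 / \<Phi> x s ^ Suc (card ?I)) \<partial>?M) = ennreal (1 / R s)"
      "\<And>s0 s1 t. \<lbrakk>0 < t; t < 1; s0 \<noteq> s1\<rbrakk> \<Longrightarrow> R ((1-t) * s0 + t * s1) < (1-t) * R s0 + t * R s1"
    using integrate_out_strictly_convex[of ?I \<Phi>, OF _ meas growth dep conv] by auto
  define \<kappa> where "\<kappa> = \<bar>1 / ?q0\<bar> * (2 / ?m)"
  have \<kappa>: "0 < \<kappa>" unfolding \<kappa>_def using b0 by simp
  have "emeasure lborel {v. F (v, (p0 + s *\<^sub>R q) \<bullet> v) \<le> 1} = ennreal (\<kappa> / R s)" for s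
  proof -
    let ?p = "p0 + s *\<^sub>R q"
    define K where "K w = F (L w, ?p \<bullet> L w)" for w
    have Kpos: "0 < K w" if "w \<noteq> 0" for w unfolding K_def by (rule F.positive) (use Lne[OF that] in \<open>simp add: zero_prod_def\<close>)
    have Khom: "K (t *\<^sub>R w) = t * K w" if "0 < t" for t w
      unfolding K_def using F.homogeneous[OF that, of "(L w, ?p \<bullet> L w)"] by (simp add: Llin)
    have [measurable]: "K \<in> borel_measurable borel" unfolding K_def by measurable
    have S[measurable]: "{v. F (v, ?p \<bullet> v) \<le> 1} \<in> sets borel" by measurable
    have arg: "(L (u x), ?p \<bullet> L (u x)) = (lx x, p0 \<bullet> lx x + s)" for x
      using qlx[of x] unfolding lx_def by (simp add: inner_add_left)
    have Ku: "1 / K (u x) ^ ?m + 1 / K (- u x) ^ ?m = 2 / \<Phi> x s ^ ?m" for x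
    proof -
      have "(L (- u x), ?p \<bullet> L (- u x)) = - (lx x, p0 \<bullet> lx x + s)" unfolding arg[symmetric] Lm by simp
      then have k: "K (- u x) = F (- (lx x, p0 \<bullet> lx x + s))" "K (u x) = F (lx x, p0 \<bullet> lx x + s)"
        unfolding K_def arg by (simp_all only:)
      have "(lx x, p0 \<bullet> lx x + s) \<noteq> 0" using qlx[of x] by (auto simp: zero_prod_def)
      from sym[OF this] show ?thesis unfolding k \<Phi>_def .
    qed
    have "emeasure lborel {v. F (v, ?p \<bullet> v) \<le> 1} = (\<integral>\<^sup>+v. indicator {v. F (v, ?p \<bullet> v) \<le> 1} v \<partial>lborel)"
      by (rule nn_integral_indicator[symmetric]) simp
    also have "\<dots> = ennreal \<bar>1 / ?q0\<bar> * (\<integral>\<^sup>+w. indicator {v. F (v, ?p \<bullet> v) \<le> 1} (L w) \<partial>lborel)"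
      unfolding L_def by (rule nn_integral_shear[OF _ b0]) measurable
    also have "(\<integral>\<^sup>+w. indicator {v. F (v, ?p \<bullet> v) \<le> 1} (L w) \<partial>lborel) = (\<integral>\<^sup>+w. indicator {w. K w \<le> 1} w \<partial>lborel)"
      unfolding K_def by (intro nn_integral_cong) (auto simp: indicator_def)
    also have "\<dots> = emeasure lborel {w. K w \<le> 1}" by (rule nn_integral_indicator) simp
    also have "\<dots> = (\<integral>\<^sup>+x. ennreal (1 / ?m * (1 / K (u x) ^ ?m + 1 / K (- u x) ^ ?m)) \<partial>?M)"
      unfolding u_def by (rule emeasure_unit_ball_projective[OF Khom Kpos _ b0(1)]) auto
    also have "\<dots> = (\<integral>\<^sup>+x. ennreal (2 / ?m) * ennreal (1 / \<Phi> x s ^ Suc (card ?I)) \<partial>?M)"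
      unfolding Ku card by (intro nn_integral_cong) (simp add: ennreal_mult'[symmetric])
    also have "\<dots> = ennreal (2 / ?m) * (\<integral>\<^sup>+x. ennreal (1 / \<Phi> x s ^ Suc (card ?I)) \<partial>?M)"
      by (rule nn_integral_cmult) (use meas[of s] in measurable)
    also have "\<dots> = ennreal (2 / ?m) * ennreal (1 / R s)" unfolding R(2) ..
    also have "ennreal \<bar>1 / ?q0\<bar> * \<dots> = ennreal (\<kappa> / R s)"
      unfolding \<kappa>_def using R(1)[of s] by (simp add: ennreal_mult'[symmetric] mult.assoc)
    finally show ?thesis .
  qed
  then show ?thesis using that[of \<kappa> R] \<kappa> R by blast
qed

section \<open>Convexity and growth of the area integrand\<close>

text \<open>A pigeonhole argument: the slabs k\<delta> \<le> p \<bullet> v < (k+1)\<delta> cut the ball of radius \<delta>/2 into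
at most 2(|p|+2) pieces, and the difference of two points of one piece lies in the set on the
right, so that no piece has a larger volume than that set.\<close>

lemma slab_volume_lower_bound:
  fixes p :: "'a::euclidean_space"
  assumes "0 < \<delta>"
  shows "emeasure lborel (ball (0::'a) (\<delta>/2)) \<le> ennreal (2 * (norm p + 2)) * emeasure lborel {v. norm v \<le> \<delta> \<and> \<bar>p \<bullet> v\<bar> \<le> \<delta>}"
proof -
  define D where "D = {v. norm v \<le> \<delta> \<and> \<bar>p \<bullet> v\<bar> \<le> \<delta>}"
  have D[measurable]: "D \<in> sets borel" unfolding D_def by measurable
  define S where "S k = {v \<in> ball 0 (\<delta>/2). of_int k * \<delta> \<le> p \<bullet> v \<and> p \<bullet> v < (of_int k + 1) * \<delta>}" for k :: int
  have S[measurable]: "S k \<in> sets borel" for k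
  proof -
    have "S k = ball 0 (\<delta>/2) \<inter> {v. of_int k * \<delta> \<le> p \<bullet> v \<and> p \<bullet> v < (of_int k + 1) * \<delta>}" unfolding S_def by auto
    moreover have "{v. of_int k * \<delta> \<le> p \<bullet> v \<and> p \<bullet> v < (of_int k + 1) * \<delta>} \<in> sets borel" by measurable
    ultimately show ?thesis by simp
  qed
  define N where "N = \<lceil>norm p\<rceil> + 1"
  have N: "norm p \<le> of_int N - 1" "of_int N \<le> norm p + 2" "0 \<le> N"
  proof -
    show 1: "norm p \<le> of_int N - 1" and "of_int N \<le> norm p + 2" unfolding N_def by linarith+
    have "0 \<le> real_of_int N" using 1 norm_ge_zero[of p] by linarith
    then show "0 \<le> N" by simp
  qed
  have cover: "ball 0 (\<delta>/2) \<subseteq> (\<Union>k\<in>{-N..N - 1}. S k)"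
  proof
    fix v :: 'a assume v: "v \<in> ball 0 (\<delta>/2)"
    define k where "k = \<lfloor>p \<bullet> v / \<delta>\<rfloor>"
    have "\<bar>p \<bullet> v\<bar> \<le> norm p * norm v" by (rule Cauchy_Schwarz_ineq2)
    also have "\<dots> \<le> norm p * (\<delta>/2)" using v by (intro mult_left_mono) auto
    also have "\<dots> \<le> norm p * \<delta>" using assms by (intro mult_left_mono) auto
    finally have "\<bar>p \<bullet> v / \<delta>\<bar> \<le> norm p" using assms by (simp add: field_simps abs_le_iff)
    then have "- of_int N \<le> p \<bullet> v / \<delta>" "p \<bullet> v / \<delta> < of_int N" using N by linarith+
    then have "k \<in> {-N..N - 1}" unfolding k_def by (auto simp: le_floor_iff floor_less_iff)
    moreover have "v \<in> S k"
    proof -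
      have "of_int k \<le> p \<bullet> v / \<delta>" "p \<bullet> v / \<delta> < of_int k + 1" unfolding k_def by linarith+
      then have "of_int k * \<delta> \<le> p \<bullet> v" "p \<bullet> v < (of_int k + 1) * \<delta>"
        using assms by (simp_all only: pos_le_divide_eq pos_divide_less_eq)
      then show ?thesis unfolding S_def using v by simp
    qed
    ultimately show "v \<in> (\<Union>k\<in>{-N..N - 1}. S k)" by blast
  qed
  have one: "emeasure lborel (S k) \<le> emeasure lborel D" for k
  proof (cases "S k = {}")
    case False
    then obtain v' where v': "v' \<in> S k" by blast
    have sub: "S k \<subseteq> (+) (- v') -` D"
    proof
      fix v assume v: "v \<in> S k"
      have "norm (- v' + v) \<le> norm v' + norm v" by (metis norm_minus_cancel norm_triangle_ineq)
      also have "\<dots> \<le> \<delta>" using v v' unfolding S_def by auto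
      finally have 1: "norm (- v' + v) \<le> \<delta>" .
      have "p \<bullet> (- v' + v) = p \<bullet> v - p \<bullet> v'" by (simp add: inner_diff_right)
      moreover have "of_int k * \<delta> \<le> p \<bullet> v" "p \<bullet> v < of_int k * \<delta> + \<delta>" "of_int k * \<delta> \<le> p \<bullet> v'" "p \<bullet> v' < of_int k * \<delta> + \<delta>"
        using v v' unfolding S_def by (auto simp: distrib_right)
      ultimately have "\<bar>p \<bullet> (- v' + v)\<bar> \<le> \<delta>" by linarith
      with 1 show "v \<in> (+) (- v') -` D" unfolding D_def by simp
    qed
    have "emeasure lborel (S k) \<le> emeasure lborel ((+) (- v') -` D \<inter> space lborel)"
    proof (rule emeasure_mono)
      have "(+) (- v') \<in> measurable lborel borel" by measurable
      from measurable_sets[OF this D] show "(+) (- v') -` D \<inter> space lborel \<in> sets lborel" .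
    qed (use sub in auto)
    also have "\<dots> = emeasure (distr lborel borel ((+) (- v'))) D"
      by (rule emeasure_distr[symmetric]) auto
    also have "\<dots> = emeasure lborel D" by (simp add: lborel_distr_plus)
    finally show ?thesis .
  qed simp
  have "emeasure lborel (ball (0::'a) (\<delta>/2)) \<le> emeasure lborel (\<Union>k\<in>{-N..N - 1}. S k)"
    by (rule emeasure_mono[OF cover]) auto
  also have "\<dots> \<le> (\<Sum>k\<in>{-N..N - 1}. emeasure lborel (S k))"
    by (rule emeasure_subadditive_finite) auto
  also have "\<dots> \<le> (\<Sum>k\<in>{-N..N - 1}. emeasure lborel D)" by (intro sum_mono one)
  also have "\<dots> = of_nat (nat (2 * N)) * emeasure lborel D" by simp
  also have "\<dots> \<le> ennreal (2 * (norm p + 2)) * emeasure lborel D"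
  proof (rule mult_right_mono)
    have "real (nat (2 * N)) \<le> 2 * (norm p + 2)" using N by simp
    then show "of_nat (nat (2 * N)) \<le> ennreal (2 * (norm p + 2))"
      unfolding ennreal_of_nat_eq_real_of_nat by (rule ennreal_leI)
  qed simp
  finally show ?thesis unfolding D_def .
qed

text \<open>By convexity, the increment from p to q is at most the average increment from p to the
point p + n(q-p), which linear growth controls as n \<rightarrow> \<infinity>.\<close>

lemma convex_linear_growth_imp_Lipschitz:
  fixes f :: "'a::real_normed_vector \<Rightarrow> real"
  assumes conv: "\<And>p q t. 0 < t \<Longrightarrow> t < 1 \<Longrightarrow> f ((1-t) *\<^sub>R p + t *\<^sub>R q) \<le> (1-t) * f p + t * f q"
    and growth: "\<And>p. f p \<le> K * (1 + norm p)" and "0 \<le> K"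
  shows "\<bar>f p - f q\<bar> \<le> K * norm (p - q)"
proof -
  have *: "f q - f p \<le> K * norm (q - p)" for p q
  proof (rule LIMSEQ_le_const)
    show "(\<lambda>n. (K * (1 + norm p) - f p) / real n + K * norm (q - p)) \<longlonglongrightarrow> K * norm (q - p)"
      by (rule tendsto_eq_intros lim_const_over_n tendsto_const refl)+ simp
    have "f q - f p \<le> (K * (1 + norm p) - f p) / real n + K * norm (q - p)" if n: "2 \<le> n" for n
    proof -
      define t where "t = 1 / real n"
      have t: "0 < t" "t < 1" using n unfolding t_def by auto
      let ?r = "p + real n *\<^sub>R (q - p)"
      have "(1-t) *\<^sub>R p + t *\<^sub>R ?r = q" unfolding t_def using n by (simp add: algebra_simps)
      then have "f q \<le> (1-t) * f p + t * f ?r" using conv[OF t, of p ?r] by simp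
      also have "\<dots> \<le> (1-t) * f p + t * (K * (1 + (norm p + real n * norm (q - p))))"
      proof -
        have "norm ?r \<le> norm p + real n * norm (q - p)" by (metis norm_triangle_ineq norm_scaleR abs_of_nat)
        then have "f ?r \<le> K * (1 + (norm p + real n * norm (q - p)))"
          using growth[of ?r] \<open>0 \<le> K\<close> by (meson add_left_mono mult_left_mono order_trans)
        then show ?thesis using t by simp
      qed
      also have "\<dots> = f p + ((K * (1 + norm p) - f p) / real n + K * norm (q - p))"
        unfolding t_def using n by (simp add: field_simps)
      finally show ?thesis by simp
    qed
    then show "\<exists>N. \<forall>n\<ge>N. f q - f p \<le> (K * (1 + norm p) - f p) / real n + K * norm (q - p)" by blast
  qed
  show ?thesis using *[of p q] *[of q p] by (simp add: abs_le_iff norm_minus_commute)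
qed

lemma harmonic_symmetrization_power:
  fixes F :: "'n::euclidean_space \<Rightarrow> 'n \<Rightarrow> real"
  assumes "0 < m" "y \<noteq> 0" "0 < F x y" "0 < F x (- y)"
  shows "1 / F x y ^ m + 1 / F x (- y) ^ m = 2 / harmonic_symmetrization m F x y ^ m"
proof -
  define S where "S = F x y powi (- int m) + F x (- y) powi (- int m)"
  have S: "S = 1 / F x y ^ m + 1 / F x (- y) ^ m" unfolding S_def by (simp add: power_int_minus divide_inverse)
  have Spos: "0 < 2 / S" unfolding S using assms by (simp add: add_pos_pos)
  have "harmonic_symmetrization m F x y ^ m = ((2 / S) powr (1 / real m)) ^ m"
    unfolding harmonic_symmetrization_def S_def using assms(2) by simp
  also have "\<dots> = (2 / S) powr (real m * (1 / real m))" by (rule powr_power) (use Spos in auto)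
  also have "\<dots> = 2 / S" using Spos assms(1) by simp
  finally show ?thesis using Spos unfolding S[symmetric] by simp
qed

text \<open>Strict convexity is Busemann's theorem on each line of slopes. Since F(v,z) \<le> C(|v|+|z|),
the section contains a set as in the slab estimate, which bounds A linearly; a convex function
of linear growth is Lipschitz.\<close>

theorem area_integrand_strictly_convex_Lipschitz:
  fixes F :: "'a::euclidean_space \<times> real \<Rightarrow> 'a \<times> real \<Rightarrow> real"
  assumes mink: "minkowski_metric F" and symF: "finsler_metric (harmonic_symmetrization DIM('a) F)"
  obtains A :: "'a \<Rightarrow> real" and K where
    "\<And>x p. enn2real (hausdorff_measure DIM('a) (ball (0::'a) 1) / hausdorff_measure DIM('a) {v. F x (v, p \<bullet> v) \<le> 1}) = A p"
    "0 \<le> K" "\<And>p q. \<bar>A p - A q\<bar> \<le> K * norm (p - q)"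
    "\<And>p q t. \<lbrakk>0 < t; t < 1; p \<noteq> q\<rbrakk> \<Longrightarrow> A ((1-t) *\<^sub>R p + t *\<^sub>R q) < (1-t) * A p + t * A q"
proof -
  let ?m = "DIM('a)"
  define N where "N = F 0"
  have FN: "F x = N" for x using mink unfolding minkowski_metric_def N_def by blast
  have FN': "finsler_norm N" unfolding N_def using mink finsler_norm_of_metric unfolding minkowski_metric_def by blast
  define G where "G = harmonic_symmetrization ?m F 0"
  have GN: "finsler_norm G" unfolding G_def by (rule finsler_norm_of_metric[OF symF])
  interpret N: finsler_norm N by (rule FN')
  have sym: "1 / N y ^ ?m + 1 / N (- y) ^ ?m = 2 / G y ^ ?m" if "y \<noteq> 0" for y
    using harmonic_symmetrization_power[of ?m y F 0] that N.positive[of y] N.positive[of "- y"] unfolding FN G_def by simp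
  define E where "E p = {v. N (v, p \<bullet> v) \<le> 1}" for p :: 'a
  define V where "V p = emeasure lborel (E p)" for p
  have E[measurable]: "E p \<in> sets borel" for p unfolding E_def by measurable
  obtain c C where c: "0 < c" "0 < C" "\<And>y. c * norm y \<le> N y" "\<And>y. N y \<le> C * norm y"
    using N.norm_bounds by metis
  have bE: "bounded (E p)" for p
  proof (rule boundedI[of _ "1 / c"])
    fix v assume "v \<in> E p"
    then have "c * norm (v, p \<bullet> v) \<le> 1" using c(3)[of "(v, p \<bullet> v)"] unfolding E_def by simp
    then have "c * norm v \<le> 1" using norm_fst_le[of v "p \<bullet> v"] c(1)
      by (meson mult_le_cancel_left_pos order_trans)
    then show "norm v \<le> 1 / c" using c(1) by (simp add: field_simps)
  qed
  define B where "B p = 1 / enn2real (V p)" for p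
  have line: "\<exists>\<kappa> R. 0 < \<kappa> \<and> (\<forall>s. 0 < R s \<and> V (p + s *\<^sub>R q) = ennreal (\<kappa> / R s) \<and> B (p + s *\<^sub>R q) = R s / \<kappa>) \<and>
      (\<forall>s0 s1 t. 0 < t \<longrightarrow> t < 1 \<longrightarrow> s0 \<noteq> s1 \<longrightarrow> R ((1-t) * s0 + t * s1) < (1-t) * R s0 + t * R s1)"
    if q: "q \<noteq> 0" for p q
  proof (rule reciprocal_section_volume_strictly_convex[where ?p0.0 = p, OF FN' GN sym q])
    fix \<kappa> and R :: "real \<Rightarrow> real"
    assume R: "0 < \<kappa>" "\<And>s. 0 < R s"
      "\<And>s. emeasure lborel {v. N (v, (p + s *\<^sub>R q) \<bullet> v) \<le> 1} = ennreal (\<kappa> / R s)"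
      "\<And>s0 s1 t. \<lbrakk>0 < t; t < 1; s0 \<noteq> s1\<rbrakk> \<Longrightarrow> R ((1-t) * s0 + t * s1) < (1-t) * R s0 + t * R s1"
    have "V (p + s *\<^sub>R q) = ennreal (\<kappa> / R s)" for s unfolding V_def E_def by (rule R(3))
    moreover have "B (p + s *\<^sub>R q) = R s / \<kappa>" for s
      unfolding B_def \<open>V (p + s *\<^sub>R q) = ennreal (\<kappa> / R s)\<close> using R(1) R(2)[of s] by simp
    ultimately show ?thesis using R by blast
  qed
  obtain b :: 'a where "b \<in> Basis" by (meson ex_in_conv nonempty_Basis)
  then have b: "b \<noteq> 0" by auto
  have VB: "V p = ennreal (1 / B p)" "0 < B p" for p
  proof -
    obtain \<kappa> R where "0 < \<kappa>" "0 < R 0" "V (p + 0 *\<^sub>R b) = ennreal (\<kappa> / R 0)" "B (p + 0 *\<^sub>R b) = R (0::real) / \<kappa>"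
      using line[OF b, of p] by blast
    then show "V p = ennreal (1 / B p)" "0 < B p" by auto
  qed
  have Bconv: "B ((1-t) *\<^sub>R p + t *\<^sub>R q) < (1-t) * B p + t * B q" if t: "0 < t" "t < 1" and "p \<noteq> q" for p q t
  proof -
    have "q - p \<noteq> 0" using \<open>p \<noteq> q\<close> by simp
    from line[OF this, of p] obtain \<kappa> R where R: "0 < \<kappa>" "\<And>s. B (p + s *\<^sub>R (q - p)) = R s / \<kappa>"
      "\<And>s0 s1 t. \<lbrakk>0 < t; t < 1; s0 \<noteq> s1\<rbrakk> \<Longrightarrow> R ((1-t) * s0 + t * s1) < (1-t) * R s0 + t * R s1" by blast
    have "R t < (1-t) * R 0 + t * R 1" using R(3)[OF t, of 0 1] by simp
    then have "R t / \<kappa> < ((1-t) * R 0 + t * R 1) / \<kappa>" using R(1) by (rule divide_strict_right_mono)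
    then have "R t / \<kappa> < (1-t) * (R 0 / \<kappa>) + t * (R 1 / \<kappa>)" by (simp add: add_divide_distrib)
    moreover have "p + t *\<^sub>R (q - p) = (1-t) *\<^sub>R p + t *\<^sub>R q" by (simp add: algebra_simps)
    ultimately show ?thesis using R(2)[of 0] R(2)[of 1] R(2)[of t] by simp
  qed
  obtain K where K: "0 \<le> K" "\<And>p. B p \<le> K * (1 + norm p)"
  proof -
    \<comment> \<open>With this choice |v| \<le> \<delta> and |p \<bullet> v| \<le> \<delta> imply F(v, p \<bullet> v) \<le> 1.\<close>
    define \<delta> where "\<delta> = 1 / (2 * C)"
    have \<delta>: "0 < \<delta>" unfolding \<delta>_def using c by simp
    define \<beta> where "\<beta> = measure lborel (ball (0::'a) (\<delta>/2))"
    have \<beta>: "0 < \<beta>" unfolding \<beta>_def using \<delta> content_ball_pos[of "\<delta>/2" "0::'a"] by simp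
    have \<beta>e: "emeasure lborel (ball (0::'a) (\<delta>/2)) = ennreal \<beta>" unfolding \<beta>_def
      using emeasure_bounded_finite[OF bounded_ball, of "0::'a" "\<delta>/2"] by (intro emeasure_eq_ennreal_measure) (simp add: less_top)
    have "B p \<le> 4 / \<beta> * (1 + norm p)" for p
    proof -
      have sub: "{v. norm v \<le> \<delta> \<and> \<bar>p \<bullet> v\<bar> \<le> \<delta>} \<subseteq> E p"
      proof
        fix v assume "v \<in> {v. norm v \<le> \<delta> \<and> \<bar>p \<bullet> v\<bar> \<le> \<delta>}"
        then have v: "norm v \<le> \<delta>" "\<bar>p \<bullet> v\<bar> \<le> \<delta>" by auto
        have "N (v, p \<bullet> v) \<le> C * norm (v, p \<bullet> v)" by (rule c)
        also have "\<dots> \<le> C * (norm v + norm (p \<bullet> v))" using c(2) by (intro mult_left_mono norm_Pair_le) auto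
        also have "\<dots> \<le> C * (\<delta> + \<delta>)" using c(2) v by (intro mult_left_mono add_mono) auto
        also have "\<dots> = 1" unfolding \<delta>_def using c(2) by simp
        finally show "v \<in> E p" unfolding E_def by simp
      qed
      have "ennreal \<beta> \<le> ennreal (2 * (norm p + 2)) * emeasure lborel {v. norm v \<le> \<delta> \<and> \<bar>p \<bullet> v\<bar> \<le> \<delta>}"
        using slab_volume_lower_bound[OF \<delta>, of p] unfolding \<beta>e .
      also have "\<dots> \<le> ennreal (2 * (norm p + 2)) * V p"
        unfolding V_def by (intro mult_left_mono emeasure_mono[OF sub]) auto
      also have "\<dots> = ennreal (2 * (norm p + 2) / B p)" unfolding VB(1)[of p] using VB(2)[of p] by (subst ennreal_mult[symmetric]) auto
      finally have "\<beta> \<le> 2 * (norm p + 2) / B p" using VB(2)[of p] by (simp add: ennreal_le_iff)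
      then have "\<beta> * B p \<le> 2 * (norm p + 2)" using VB(2)[of p] by (simp add: pos_le_divide_eq)
      also have "\<dots> \<le> 4 * (1 + norm p)" by simp
      finally show ?thesis using \<beta> by (simp add: field_simps)
    qed
    moreover have "0 \<le> 4 / \<beta>" using \<beta> by simp
    ultimately show ?thesis using that by blast
  qed
  define \<omega> where "\<omega> = measure lborel (ball (0::'a) 1)"
  have \<omega>: "0 < \<omega>" unfolding \<omega>_def using content_ball_pos[of 1 "0::'a"] by simp
  have \<omega>e: "emeasure lborel (ball (0::'a) 1) = ennreal \<omega>" unfolding \<omega>_def
    using emeasure_bounded_finite[OF bounded_ball, of "0::'a" 1] by (intro emeasure_eq_ennreal_measure) (simp add: less_top)
  obtain d where d: "0 < d" "\<And>E::'a set. E \<in> sets borel \<Longrightarrow> bounded E \<Longrightarrow> hausdorff_measure ?m E = ennreal d * emeasure lborel E"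
    using hausdorff_measure_eq_const_lborel[where 'a='a] by metis
  define A where "A p = \<omega> * B p" for p
  show ?thesis
  proof (rule that[of A "\<omega> * K"])
    fix x p
    have Ep: "{v. F x (v, p \<bullet> v) \<le> 1} = E p" unfolding FN E_def ..
    have "hausdorff_measure ?m (ball (0::'a) 1) = ennreal (d * \<omega>)"
      using d(1) \<omega> by (subst d(2)) (auto simp: \<omega>e ennreal_mult)
    moreover have "hausdorff_measure ?m (E p) = ennreal (d * (1 / B p))"
    proof -
      have "hausdorff_measure ?m (E p) = ennreal d * V p" unfolding V_def by (rule d(2)[OF E bE])
      also have "\<dots> = ennreal (d * (1 / B p))"
        unfolding VB(1)[of p] by (rule ennreal_mult[symmetric]) (use d(1) VB(2)[of p] in auto)
      finally show ?thesis .
    qed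
    ultimately show "enn2real (hausdorff_measure ?m (ball (0::'a) 1) / hausdorff_measure ?m {v. F x (v, p \<bullet> v) \<le> 1}) = A p"
      unfolding Ep A_def using d(1) VB(2)[of p] \<omega> by (simp add: divide_ennreal)
  next
    show "0 \<le> \<omega> * K" using \<omega> K by simp
  next
    fix p q
    have "\<bar>B p - B q\<bar> \<le> K * norm (p - q)"
    proof (rule convex_linear_growth_imp_Lipschitz[OF _ K(2) K(1)])
      fix p q :: 'a and t :: real assume "0 < t" "t < 1"
      then show "B ((1-t) *\<^sub>R p + t *\<^sub>R q) \<le> (1-t) * B p + t * B q"
        using Bconv[of t p q] by (cases "p = q") (auto simp: algebra_simps intro: less_imp_le)
    qed
    then have "\<omega> * \<bar>B p - B q\<bar> \<le> \<omega> * (K * norm (p - q))" using \<omega> by (intro mult_left_mono) auto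
    then show "\<bar>A p - A q\<bar> \<le> \<omega> * K * norm (p - q)"
      unfolding A_def using \<omega> by (simp add: right_diff_distrib[symmetric] abs_mult mult.assoc)
  next
    fix p q :: 'a and t :: real assume "0 < t" "t < 1" "p \<noteq> q"
    from mult_strict_left_mono[OF Bconv[OF this] \<omega>]
    show "A ((1-t) *\<^sub>R p + t *\<^sub>R q) < (1-t) * A p + t * A q" unfolding A_def by (simp add: algebra_simps)
  qed
qed

section \<open>Smooth approximation of compactly supported functions\<close>

lemma Ck_on_cong:
  assumes "open S" "\<And>x. x \<in> S \<Longrightarrow> f x = g x" "Ck_on k S f"
  shows "Ck_on k S g"
  using assms(2,3)
proof (induction k arbitrary: f g)
  case 0 then show ?case using continuous_on_cong[of S S f g] by simp
next
  case (Suc k)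
  have der: "frechet_derivative f (at x) = frechet_derivative g (at x)" and dg: "g differentiable (at x)" if x: "x \<in> S" for x
  proof -
    have "f differentiable (at x)" using Suc.prems(2) x assms(1) by (simp add: differentiable_on_eq_differentiable_at)
    then have "(f has_derivative frechet_derivative f (at x)) (at x)" by (rule frechet_derivative_works[THEN iffD1])
    then have "(g has_derivative frechet_derivative f (at x)) (at x)"
      by (rule has_derivative_transform_within_open[OF _ assms(1) x Suc.prems(1)])
    then show "frechet_derivative f (at x) = frechet_derivative g (at x)" "g differentiable (at x)"
      using frechet_derivative_at by (blast, blast intro: differentiableI)
  qed
  have "Ck_on k S (partial_deriv i g)" if "i \<in> Basis" for i
  proof (rule Suc.IH[of "partial_deriv i f"])
    show "partial_deriv i f x = partial_deriv i g x" if "x \<in> S" for x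
      unfolding partial_deriv_def der[OF that] ..
    show "Ck_on k S (partial_deriv i f)" using Suc.prems(2) that by simp
  qed
  moreover have "g differentiable_on S" using dg assms(1) by (simp add: differentiable_on_eq_differentiable_at)
  ultimately show ?case by simp
qed

lemma Ck_on_SucI:
  assumes "open S" "\<And>x. x \<in> S \<Longrightarrow> (f has_derivative f' x) (at x)"
    and "\<And>i. i \<in> Basis \<Longrightarrow> Ck_on k S (\<lambda>x. f' x i)"
  shows "Ck_on (Suc k) S f"
proof -
  have "Ck_on k S (partial_deriv i f)" if "i \<in> Basis" for i
    by (rule Ck_on_cong[OF assms(1) _ assms(3)[OF that]]) (simp add: partial_deriv_eq[OF assms(2)])
  moreover have "f differentiable_on S"
    using assms(1,2) by (auto simp: differentiable_on_eq_differentiable_at intro: differentiableI)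
  ultimately show ?thesis by simp
qed

lemma Ck_on_Suc_imp_Ck_on: "Ck_on (Suc k) S f \<Longrightarrow> Ck_on k S f"
  by (induction k arbitrary: f) (auto simp: differentiable_imp_continuous_on)

lemma Ck_on_has_derivative:
  fixes f :: "'a::euclidean_space \<Rightarrow> 'b::real_normed_vector"
  assumes "open S" "Ck_on (Suc k) S f" "x \<in> S"
  shows "(f has_derivative (\<lambda>h. \<Sum>i\<in>Basis. (h \<bullet> i) *\<^sub>R partial_deriv i f x)) (at x)"
  using assms by (intro has_derivative_partial_deriv) (auto simp: differentiable_on_eq_differentiable_at)

lemma Ck_on_const: "open S \<Longrightarrow> Ck_on k S (\<lambda>x. c)"
proof (induction k arbitrary: c)
  case (Suc k)
  show ?case by (rule Ck_on_SucI[OF Suc.prems, where f'="\<lambda>x h. 0"]) (use Suc in auto)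
qed simp

lemma Ck_on_add: "open S \<Longrightarrow> Ck_on k S f \<Longrightarrow> Ck_on k S g \<Longrightarrow> Ck_on k S (\<lambda>x. f x + g x)"
proof (induction k arbitrary: f g)
  case (Suc k)
  show ?case
  proof (rule Ck_on_SucI[OF Suc.prems(1)])
    fix x assume x: "x \<in> S"
    show "((\<lambda>x. f x + g x) has_derivative (\<lambda>h. (\<Sum>i\<in>Basis. (h \<bullet> i) *\<^sub>R partial_deriv i f x) + (\<Sum>i\<in>Basis. (h \<bullet> i) *\<^sub>R partial_deriv i g x))) (at x)"
      by (rule has_derivative_add[OF Ck_on_has_derivative[OF Suc.prems(1,2) x] Ck_on_has_derivative[OF Suc.prems(1,3) x]])
  next
    fix i :: 'a assume i: "i \<in> Basis"
    have "Ck_on k S (\<lambda>x. partial_deriv i f x + partial_deriv i g x)" using Suc i by simp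
    then show "Ck_on k S (\<lambda>x. (\<Sum>j\<in>Basis. (i \<bullet> j) *\<^sub>R partial_deriv j f x) + (\<Sum>j\<in>Basis. (i \<bullet> j) *\<^sub>R partial_deriv j g x))"
      using i by (simp add: inner_Basis if_distrib[of "\<lambda>c. c *\<^sub>R _"] cong: if_cong)
  qed
qed (simp add: continuous_on_add)

lemma Ck_on_mult:
  fixes f g :: "'a::euclidean_space \<Rightarrow> real"
  shows "open S \<Longrightarrow> Ck_on k S f \<Longrightarrow> Ck_on k S g \<Longrightarrow> Ck_on k S (\<lambda>x. f x * g x)"
proof (induction k arbitrary: f g)
  case (Suc k)
  show ?case
  proof (rule Ck_on_SucI[OF Suc.prems(1)])
    fix x assume x: "x \<in> S"
    show "((\<lambda>x. f x * g x) has_derivative (\<lambda>h. f x * (\<Sum>i\<in>Basis. (h \<bullet> i) *\<^sub>R partial_deriv i g x) + (\<Sum>i\<in>Basis. (h \<bullet> i) *\<^sub>R partial_deriv i f x) * g x)) (at x)"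
      by (rule has_derivative_mult[OF Ck_on_has_derivative[OF Suc.prems(1,2) x] Ck_on_has_derivative[OF Suc.prems(1,3) x]])
  next
    fix i :: 'a assume i: "i \<in> Basis"
    have "Ck_on k S (\<lambda>x. f x * partial_deriv i g x + partial_deriv i f x * g x)"
      using Suc.prems i Ck_on_Suc_imp_Ck_on[OF Suc.prems(2)] Ck_on_Suc_imp_Ck_on[OF Suc.prems(3)]
      by (intro Ck_on_add Suc.IH) auto
    then show "Ck_on k S (\<lambda>x. f x * (\<Sum>j\<in>Basis. (i \<bullet> j) *\<^sub>R partial_deriv j g x) + (\<Sum>j\<in>Basis. (i \<bullet> j) *\<^sub>R partial_deriv j f x) * g x)"
      using i by (simp add: inner_Basis if_distrib[of "\<lambda>c. c *\<^sub>R _"] if_distrib[of "\<lambda>c. c * _"] cong: if_cong)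
  qed
qed (simp add: continuous_on_mult)

lemma Ck_on_inner_left: "open S \<Longrightarrow> Ck_on k S (\<lambda>x. x \<bullet> a)"
proof (cases k)
  case (Suc n)
  assume S: "open S"
  show ?thesis unfolding Suc
    by (rule Ck_on_SucI[OF S, where f'="\<lambda>x h. h \<bullet> a"]) (auto intro!: derivative_eq_intros Ck_on_const S)
qed (auto intro: continuous_intros)

text \<open>The powers s^-n make the family closed under differentiation, so that smoothness of the
first member is an induction on the order of differentiability for all n simultaneously.\<close>

definition exp_bump :: "nat \<Rightarrow> real \<Rightarrow> real" where
  "exp_bump n s = (if s \<le> 0 then 0 else exp (- 1 / s) / s ^ n)"

lemma exp_bump_tendsto_0: "(exp_bump n \<longlongrightarrow> 0) (at 0)"
proof -
  have "((\<lambda>s. (inverse s) ^ n / exp (inverse s)) \<longlongrightarrow> 0) (at_right (0::real))"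
    by (rule filterlim_compose[OF tendsto_power_div_exp_0 filterlim_inverse_at_top_right])
  moreover have "eventually (\<lambda>s. (inverse s) ^ n / exp (inverse s) = exp_bump n s) (at_right 0)"
    unfolding eventually_at_right_field
    by (intro exI[of _ 1]) (auto simp: exp_bump_def exp_minus field_simps)
  ultimately have "(exp_bump n \<longlongrightarrow> 0) (at_right 0)" by (rule Lim_transform_eventually)
  moreover have "(exp_bump n \<longlongrightarrow> 0) (at_left 0)"
  proof (rule Lim_transform_eventually[OF tendsto_const])
    show "eventually (\<lambda>s. 0 = exp_bump n s) (at_left 0)"
      unfolding eventually_at_left_field by (intro exI[of _ "-1"]) (auto simp: exp_bump_def)
  qed
  ultimately show ?thesis by (simp add: filterlim_split_at)
qed

lemma exp_bump_has_derivative: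
  "(exp_bump n has_real_derivative exp_bump (n + 2) s - real n * exp_bump (n + 1) s) (at s)"
proof -
  consider "s < 0" | "s = 0" | "0 < s" by linarith
  then show ?thesis
  proof cases
    case 1
    have "((\<lambda>_. 0) has_real_derivative 0) (at s)" by simp
    then have "(exp_bump n has_real_derivative 0) (at s)"
      by (rule has_field_derivative_transform_within_open[where S="{..<0}"]) (use 1 in \<open>auto simp: exp_bump_def\<close>)
    then show ?thesis using 1 by (simp add: exp_bump_def)
  next
    case 2
    have "((\<lambda>h. exp_bump (n + 1) h) \<longlongrightarrow> 0) (at 0)" by (rule exp_bump_tendsto_0)
    moreover have "exp_bump (n + 1) h = (exp_bump n (0 + h) - exp_bump n 0) / h" for h
      by (auto simp: exp_bump_def)
    ultimately have "(exp_bump n has_real_derivative 0) (at 0)" unfolding DERIV_def by simp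
    then show ?thesis using 2 by (simp add: exp_bump_def)
  next
    case 3
    have "((\<lambda>s. exp (- 1 / s) / s ^ n) has_real_derivative
        ((exp (- 1 / s) * (1 / s\<^sup>2)) * s ^ n - exp (- 1 / s) * (real n * s ^ (n - 1))) / (s ^ n * s ^ n)) (at s)"
      using 3 by (auto intro!: derivative_eq_intros simp: power2_eq_square)
    also have "((exp (- 1 / s) * (1 / s\<^sup>2)) * s ^ n - exp (- 1 / s) * (real n * s ^ (n - 1))) / (s ^ n * s ^ n)
       = exp_bump (n + 2) s - real n * exp_bump (n + 1) s"
      using 3 by (cases n) (auto simp: exp_bump_def field_simps power2_eq_square)
    finally show ?thesis
      by (rule has_field_derivative_transform_within_open[where S="{0<..}"]) (use 3 in \<open>auto simp: exp_bump_def\<close>)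
  qed
qed

lemma smooth_on_exp_bump: "smooth_on UNIV (\<lambda>x::'a::euclidean_space. exp_bump 0 (c - x \<bullet> x))"
proof -
  have "Ck_on k UNIV (\<lambda>x::'a. exp_bump n (c - x \<bullet> x))" for k n
  proof (induction k arbitrary: n)
    case 0
    have "continuous_on UNIV (exp_bump n)"
      using exp_bump_has_derivative by (meson DERIV_isCont continuous_at_imp_continuous_on)
    then show ?case by (simp, rule continuous_on_compose2) (auto intro!: continuous_intros)
  next
    case (Suc k)
    show ?case
    proof (rule Ck_on_SucI)
      fix x :: 'a
      have "((\<lambda>x::'a. c - x \<bullet> x) has_derivative (\<lambda>h. - 2 * (h \<bullet> x))) (at x)"
        by (auto intro!: derivative_eq_intros simp: inner_commute)
      from has_derivative_compose[OF this exp_bump_has_derivative[unfolded has_field_derivative_def]]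
      show "((\<lambda>x. exp_bump n (c - x \<bullet> x)) has_derivative
          (\<lambda>h. (exp_bump (n + 2) (c - x \<bullet> x) + (- real n) * exp_bump (n + 1) (c - x \<bullet> x)) * (- 2 * (h \<bullet> x)))) (at x)"
        by simp
    next
      fix i :: 'a
      have "Ck_on k UNIV (\<lambda>x. (exp_bump (n + 2) (c - x \<bullet> x) + (- real n) * exp_bump (n + 1) (c - x \<bullet> x)) * (- 2 * (x \<bullet> i)))"
        by (intro Ck_on_mult Ck_on_add Ck_on_const Ck_on_inner_left Suc.IH open_UNIV)
      then show "Ck_on k UNIV (\<lambda>x. (exp_bump (n + 2) (c - x \<bullet> x) + (- real n) * exp_bump (n + 1) (c - x \<bullet> x)) * (- 2 * (i \<bullet> x)))"
        by (simp add: inner_commute)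
    qed simp
  qed
  then show ?thesis unfolding smooth_on_def by blast
qed

lemma smooth_bump:
  assumes "0 < r"
  obtains \<rho> :: "'a::euclidean_space \<Rightarrow> real" where "smooth_on UNIV \<rho>" "\<And>x. 0 \<le> \<rho> x"
    "\<And>x. r \<le> norm x \<Longrightarrow> \<rho> x = 0" "(\<rho> has_integral 1) (cbox (- r *\<^sub>R One) (r *\<^sub>R One))"
proof -
  let ?Q = "cbox (- r *\<^sub>R One) (r *\<^sub>R One) :: 'a set"
  define b where "b x = exp_bump 0 (r\<^sup>2 - x \<bullet> x)" for x :: 'a
  have sm: "smooth_on UNIV b" unfolding b_def by (rule smooth_on_exp_bump)
  then have cont: "continuous_on UNIV b" unfolding smooth_on_def by (metis Ck_on.simps(1))
  have nonneg: "0 \<le> b x" for x unfolding b_def exp_bump_def by simp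
  have zero: "b x = 0" if "r \<le> norm x" for x
    using power_mono[OF that, of 2] assms unfolding b_def exp_bump_def by (simp add: power2_norm_eq_inner)
  have int: "b integrable_on ?Q" by (rule integrable_continuous) (rule continuous_on_subset[OF cont], simp)
  define c where "c = integral ?Q b"
  have c0: "0 \<le> c" unfolding c_def by (rule integral_nonneg[OF int]) (rule nonneg)
  have "c \<noteq> 0"
  proof
    assume "c = 0"
    then have "(b has_integral 0) ?Q" using int unfolding c_def by (simp add: has_integral_iff)
    then have "b 0 = 0"
    proof (rule has_integral_0_cbox_imp_0[rotated 2])
      show "continuous_on ?Q b" by (rule continuous_on_subset[OF cont]) simp
      show "0 \<in> ?Q" using assms by (simp add: mem_box inner_simps)
      show "box (- r *\<^sub>R One) (r *\<^sub>R One :: 'a) \<noteq> {}" using assms by (simp add: box_ne_empty inner_simps)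
    qed (rule nonneg)
    then show False using assms by (simp add: b_def exp_bump_def)
  qed
  with c0 have c: "0 < c" by simp
  have "smooth_on UNIV (\<lambda>x. (1 / c) * b x)"
    using sm unfolding smooth_on_def by (intro allI Ck_on_mult Ck_on_const open_UNIV) simp
  moreover have "((\<lambda>x. (1 / c) * b x) has_integral (1 / c) * c) ?Q"
    by (rule has_integral_mult_right) (use int in \<open>simp add: c_def has_integral_integral\<close>)
  ultimately show ?thesis using that[of "\<lambda>x. (1 / c) * b x"] c nonneg zero by simp
qed

text \<open>This serves in both directions: \<rho> is a smooth kernel, or, after an exchange of the factors, the
function that is mollified.\<close>

lemma convolution_has_derivative:
  fixes \<rho> \<phi> :: "'a::euclidean_space \<Rightarrow> real"
  assumes d: "\<And>x. (\<rho> has_derivative (\<lambda>h. D x \<bullet> h)) (at x)" and D: "continuous_on UNIV D"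
    and \<phi>: "continuous_on (cbox a b) \<phi>"
  shows "((\<lambda>x. integral (cbox a b) (\<lambda>y. \<rho> (x - y) * \<phi> y)) has_derivative
     (\<lambda>h. integral (cbox a b) (\<lambda>y. (D (x - y) \<bullet> h) * \<phi> y))) (at x)"
proof -
  define f' where "f' x y = \<phi> y *\<^sub>R blinfun_inner_right (D (x - y))" for x y
  have c\<rho>: "continuous_on UNIV \<rho>"
    by (intro continuous_at_imp_continuous_on ballI has_derivative_continuous[OF d])
  have cD: "continuous_on (cbox a b) (\<lambda>y. D (x - y))" for x
    by (rule continuous_on_compose2[OF D]) (auto intro!: continuous_intros)
  have cf': "continuous_on (cbox a b) (f' x)" for x
    unfolding f'_def by (intro continuous_intros bounded_linear.continuous_on[OF bounded_linear_blinfun_inner_right] cD \<phi>)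
  have "((\<lambda>x. integral (cbox a b) (\<lambda>y. \<rho> (x - y) * \<phi> y)) has_derivative
     blinfun_apply (integral (cbox a b) (f' x))) (at x within UNIV)"
  proof (rule leibniz_rule)
    fix x y
    have "((\<lambda>x. \<rho> (x - y)) has_derivative (\<lambda>h. D (x - y) \<bullet> h)) (at x)"
      by (rule has_derivative_compose[OF _ d, of "\<lambda>x. x - y" "\<lambda>h. h"]) (auto intro!: derivative_eq_intros)
    then show "((\<lambda>x. \<rho> (x - y) * \<phi> y) has_derivative blinfun_apply (f' x y)) (at x within UNIV)"
      unfolding f'_def by (auto intro!: derivative_eq_intros simp: blinfun.bilinear_simps mult_ac)
  next
    fix x
    show "(\<lambda>y. \<rho> (x - y) * \<phi> y) integrable_on cbox a b"
      by (intro integrable_continuous continuous_intros \<phi> continuous_on_compose2[OF c\<rho>]) auto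
  next
    have "continuous_on (UNIV \<times> cbox a b) (\<lambda>p. \<phi> (snd p) *\<^sub>R blinfun_inner_right (D (fst p - snd p)))"
    proof (intro continuous_intros bounded_linear.continuous_on[OF bounded_linear_blinfun_inner_right])
      show "continuous_on (UNIV \<times> cbox a b) (\<lambda>p. \<phi> (snd p))"
        by (rule continuous_on_compose2[OF \<phi>]) (auto intro!: continuous_intros)
      show "continuous_on (UNIV \<times> cbox a b) (\<lambda>p. D (fst p - snd p))"
        by (rule continuous_on_compose2[OF D]) (auto intro!: continuous_intros)
    qed
    then show "continuous_on (UNIV \<times> cbox a b) (\<lambda>(x, y). f' x y)"
      unfolding f'_def by (simp add: case_prod_beta')
  qed auto
  moreover have "blinfun_apply (integral (cbox a b) (f' x)) h = integral (cbox a b) (\<lambda>y. (D (x - y) \<bullet> h) * \<phi> y)" for h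
  proof -
    have "f' x integrable_on cbox a b" by (rule integrable_continuous[OF cf'])
    from integral_linear[OF this blinfun.bounded_linear_left, of h]
    show ?thesis unfolding f'_def by (simp add: o_def blinfun.bilinear_simps mult.commute)
  qed
  then have "blinfun_apply (integral (cbox a b) (f' x)) = (\<lambda>h. integral (cbox a b) (\<lambda>y. (D (x - y) \<bullet> h) * \<phi> y))"
    by (rule ext)
  ultimately show ?thesis by simp
qed

lemma smooth_on_partial_deriv: "smooth_on S f \<Longrightarrow> i \<in> Basis \<Longrightarrow> smooth_on S (partial_deriv i f)"
  unfolding smooth_on_def by (metis Ck_on.simps(2))

definition gradient :: "('a::euclidean_space \<Rightarrow> real) \<Rightarrow> 'a \<Rightarrow> 'a" where
  "gradient f x = (\<Sum>i\<in>Basis. partial_deriv i f x *\<^sub>R i)"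

lemma gradient_inner_Basis: "i \<in> Basis \<Longrightarrow> gradient f x \<bullet> i = partial_deriv i f x"
  by (simp add: gradient_def)

lemma Ck_on_has_gradient:
  fixes f :: "'a::euclidean_space \<Rightarrow> real"
  assumes "open S" "Ck_on (Suc k) S f"
  shows "x \<in> S \<Longrightarrow> (f has_derivative (\<lambda>h. gradient f x \<bullet> h)) (at x)"
    and "continuous_on S (gradient f)"
proof -
  show "(f has_derivative (\<lambda>h. gradient f x \<bullet> h)) (at x)" if "x \<in> S"
  proof -
    have "(\<lambda>h. \<Sum>i\<in>Basis. (h \<bullet> i) *\<^sub>R partial_deriv i f x) = (\<lambda>h. gradient f x \<bullet> h)"
    proof
      fix h
      have "gradient f x \<bullet> h = (\<Sum>i\<in>Basis. partial_deriv i f x * (i \<bullet> h))" unfolding gradient_def inner_sum_left by simp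
      also have "\<dots> = (\<Sum>i\<in>Basis. (h \<bullet> i) *\<^sub>R partial_deriv i f x)"
        by (rule sum.cong) (simp_all add: inner_commute)
      finally show "(\<Sum>i\<in>Basis. (h \<bullet> i) *\<^sub>R partial_deriv i f x) = gradient f x \<bullet> h" ..
    qed
    then show ?thesis using Ck_on_has_derivative[OF assms that] by simp
  qed
  have "continuous_on S (partial_deriv i f)" if i: "i \<in> Basis" for i
  proof -
    have "Ck_on k S (partial_deriv i f)" using assms(2) i by simp
    then show ?thesis by (cases k) (auto simp: differentiable_imp_continuous_on)
  qed
  then show "continuous_on S (gradient f)" unfolding gradient_def by (intro continuous_intros) auto
qed

lemma smooth_on_convolution:
  fixes \<rho> \<phi> :: "'a::euclidean_space \<Rightarrow> real"
  assumes \<rho>: "smooth_on UNIV \<rho>" and \<phi>: "continuous_on (cbox a b) \<phi>"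
  shows "smooth_on UNIV (\<lambda>x. integral (cbox a b) (\<lambda>y. \<rho> (x - y) * \<phi> y))"
proof -
  have "Ck_on k UNIV (\<lambda>x. integral (cbox a b) (\<lambda>y. \<rho> (x - y) * \<phi> y))" for k
    using \<rho>
  proof (induction k arbitrary: \<rho>)
    case (0 \<rho>)
    then have C: "Ck_on (Suc 0) UNIV \<rho>" unfolding smooth_on_def by blast
    have "isCont (\<lambda>x. integral (cbox a b) (\<lambda>y. \<rho> (x - y) * \<phi> y)) x" for x
      using convolution_has_derivative[OF Ck_on_has_gradient(1)[OF open_UNIV C] Ck_on_has_gradient(2)[OF open_UNIV C] \<phi>]
        has_derivative_continuous by blast
    then show ?case by (simp add: continuous_at_imp_continuous_on)
  next
    case (Suc k \<rho>)
    then have C: "Ck_on (Suc 0) UNIV \<rho>" unfolding smooth_on_def by blast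
    show ?case
    proof (rule Ck_on_SucI[OF open_UNIV])
      show "((\<lambda>x. integral (cbox a b) (\<lambda>y. \<rho> (x - y) * \<phi> y)) has_derivative
        (\<lambda>h. integral (cbox a b) (\<lambda>y. (gradient \<rho> (x - y) \<bullet> h) * \<phi> y))) (at x)" for x
        by (rule convolution_has_derivative[OF Ck_on_has_gradient(1)[OF open_UNIV C] Ck_on_has_gradient(2)[OF open_UNIV C] \<phi>]) simp
      show "Ck_on k UNIV (\<lambda>x. integral (cbox a b) (\<lambda>y. (gradient \<rho> (x - y) \<bullet> i) * \<phi> y))" if "i \<in> Basis" for i
        using Suc.IH[OF smooth_on_partial_deriv[OF Suc.prems that]] by (simp add: gradient_inner_Basis that)
    qed
  qed
  then show ?thesis unfolding smooth_on_def by blast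
qed

lemma convolution_commute:
  fixes \<rho> \<phi> :: "'a::euclidean_space \<Rightarrow> real"
  assumes \<rho>: "continuous_on UNIV \<rho>" "\<And>z. z \<notin> cbox c d \<Longrightarrow> \<rho> z = 0"
    and \<phi>: "continuous_on UNIV \<phi>" "\<And>z. z \<notin> cbox a b \<Longrightarrow> \<phi> z = 0"
  shows "integral (cbox a b) (\<lambda>y. \<rho> (x - y) * \<phi> y) = integral (cbox c d) (\<lambda>z. \<phi> (x - z) * \<rho> z)"
proof -
  let ?f = "\<lambda>y. \<rho> (x - y) * \<phi> y" and ?g = "\<lambda>z. \<phi> (x - z) * \<rho> z"
  have "?f integrable_on cbox a b"
    by (intro integrable_continuous continuous_intros continuous_on_compose2[OF \<rho>(1)] continuous_on_subset[OF \<phi>(1)]) auto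
  then have "(?f has_integral integral (cbox a b) ?f) (cbox a b)" by (rule integrable_integral)
  from has_integral_affinity[OF this, of "-1" x]
  have "(?g has_integral integral (cbox a b) ?f) ((\<lambda>z. x - z) ` cbox a b)"
    by (simp add: algebra_simps)
  then have 1: "(?g has_integral integral (cbox a b) ?f) UNIV"
  proof (rule has_integral_on_superset)
    fix z assume "z \<notin> (\<lambda>z. x - z) ` cbox a b"
    then have "x - z \<notin> cbox a b" by (metis diff_diff_eq2 add_diff_cancel_left' image_eqI)
    then show "?g z = 0" using \<phi>(2) by simp
  qed simp
  have "?g integrable_on cbox c d"
    by (intro integrable_continuous continuous_intros continuous_on_compose2[OF \<phi>(1)] continuous_on_subset[OF \<rho>(1)]) auto
  then have "(?g has_integral integral (cbox c d) ?g) (cbox c d)" by (rule integrable_integral)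
  then have "(?g has_integral integral (cbox c d) ?g) UNIV"
    by (rule has_integral_on_superset) (use \<rho>(2) in auto)
  with 1 show ?thesis using has_integral_unique by blast
qed

text \<open>Mollification. With the derivatives on the kernel \<rho> the convolution is seen to be smooth;
with the derivative on \<phi> its gradient is an average of D over balls of radius r and is
close to D by uniform continuity.\<close>

theorem smooth_approximation:
  fixes \<phi> :: "'a::euclidean_space \<Rightarrow> real"
  assumes d: "\<And>x. (\<phi> has_derivative (\<lambda>h. D x \<bullet> h)) (at x)" and D: "continuous_on UNIV D"
    and S: "compact S" "\<And>x. x \<notin> S \<Longrightarrow> \<phi> x = 0" and e: "0 < e" and \<epsilon>: "0 < \<epsilon>"
  obtains \<psi> D' where "smooth_on UNIV \<psi>" "\<And>x. (\<psi> has_derivative (\<lambda>h. D' x \<bullet> h)) (at x)" "continuous_on UNIV D'"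
    "\<And>x. norm (D' x - D x) \<le> \<epsilon>" "\<And>x. (\<And>y. y \<in> S \<Longrightarrow> e \<le> dist x y) \<Longrightarrow> \<psi> x = 0"
proof -
  have c\<phi>: "continuous_on UNIV \<phi>" by (intro continuous_at_imp_continuous_on ballI has_derivative_continuous[OF d])
  have D0: "D x = 0" if "x \<notin> S" for x
  proof -
    have "((\<lambda>_. 0) has_derivative (\<lambda>h. D x \<bullet> h)) (at x)"
      by (rule has_derivative_transform_within_open[OF d, where s="- S"])
        (use that S compact_imp_closed in auto)
    then have "(\<lambda>h. D x \<bullet> h) = (\<lambda>h. 0)" using has_derivative_const has_derivative_unique by blast
    then have "D x \<bullet> D x = 0" by metis
    then show ?thesis by simp
  qed
  obtain R where R: "0 < R" "\<And>x. x \<in> S \<Longrightarrow> norm x \<le> R" using compact_imp_bounded[OF S(1)] by (meson bounded_pos)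
  \<comment> \<open>Outside the ball of radius R the function and its gradient vanish, so uniform continuity on a slightly larger ball suffices.\<close>
  have "uniformly_continuous_on (cball 0 (R + 2)) D"
    by (rule compact_uniformly_continuous) (auto intro: continuous_on_subset[OF D])
  then obtain \<delta> where \<delta>: "0 < \<delta>" "\<And>x y. \<lbrakk>x \<in> cball 0 (R + 2); y \<in> cball 0 (R + 2); dist y x < \<delta>\<rbrakk> \<Longrightarrow> dist (D y) (D x) < \<epsilon>"
    unfolding uniformly_continuous_on_def using \<epsilon> by metis
  have unif: "norm (D (x - z) - D x) \<le> \<epsilon>" if z: "norm z < \<delta>" "norm z < 1" for x z
  proof (cases "norm x \<le> R + 1")
    case True
    have "norm (x - z) \<le> norm x + norm z" by (rule norm_triangle_ineq4)
    then have "norm (x - z) \<le> R + 2" using True z by simp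
    then have "x - z \<in> cball 0 (R + 2)" "x \<in> cball 0 (R + 2)" using True by (simp_all only: mem_cball_0)
    then show ?thesis using \<delta>(2)[of x "x - z"] z by (simp add: dist_norm)
  next
    case False
    have "norm x \<le> norm (x - z) + norm z" using norm_triangle_ineq[of "x - z" z] by simp
    then have "R < norm (x - z)" using False z by simp
    then have "x - z \<notin> S" "x \<notin> S" using R False by force+
    then show ?thesis using D0 \<epsilon> by simp
  qed
  define r where "r = min (min (\<delta>/2) (1/2)) e"
  have r: "0 < r" "r < \<delta>" "r < 1" "r \<le> e" unfolding r_def using \<delta> e by auto
  let ?Q = "cbox (- r *\<^sub>R One) (r *\<^sub>R One) :: 'a set"
  obtain \<rho> :: "'a \<Rightarrow> real" where \<rho>: "smooth_on UNIV \<rho>" "\<And>x. 0 \<le> \<rho> x"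
    "\<And>x. r \<le> norm x \<Longrightarrow> \<rho> x = 0" "(\<rho> has_integral 1) ?Q"
    using smooth_bump[OF r(1)] by metis
  have c\<rho>: "continuous_on UNIV \<rho>" using \<rho>(1) unfolding smooth_on_def by (metis Ck_on.simps(1))
  have \<rho>Q: "\<rho> z = 0" if "z \<notin> ?Q" for z
  proof (rule \<rho>(3), rule ccontr)
    assume "\<not> r \<le> norm z"
    then have "\<bar>z \<bullet> b\<bar> \<le> r" if "b \<in> Basis" for b using Basis_le_norm[OF that, of z] by linarith
    then have "z \<in> ?Q" by (auto simp: mem_box inner_simps abs_le_iff minus_le_iff)
    then show False using that by simp
  qed
  obtain a b where ab: "S \<subseteq> cbox a b" using bounded_subset_cbox_symmetric[OF compact_imp_bounded[OF S(1)]] by metis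
  define \<psi> where "\<psi> x = integral (cbox a b) (\<lambda>y. \<rho> (x - y) * \<phi> y)" for x
  define D' where "D' x = integral ?Q (\<lambda>z. \<rho> z *\<^sub>R D (x - z))" for x
  have int: "(\<lambda>z. \<rho> z *\<^sub>R D (x - z)) integrable_on ?Q" for x
    by (intro integrable_continuous continuous_intros continuous_on_subset[OF c\<rho>] continuous_on_compose2[OF D]) auto
  have \<psi>alt: "\<psi> x = integral ?Q (\<lambda>z. \<phi> (x - z) * \<rho> z)" for x
    unfolding \<psi>_def by (rule convolution_commute[OF c\<rho> \<rho>Q c\<phi>]) (use S(2) ab in auto)
  show ?thesis
  proof (rule that)
    show "smooth_on UNIV \<psi>" unfolding \<psi>_def
      by (rule smooth_on_convolution[OF \<rho>(1)]) (rule continuous_on_subset[OF c\<phi>], simp)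
    show "(\<psi> has_derivative (\<lambda>h. D' x \<bullet> h)) (at x)" for x
    proof -
      have "(\<psi> has_derivative (\<lambda>h. integral ?Q (\<lambda>z. (D (x - z) \<bullet> h) * \<rho> z))) (at x)"
        unfolding \<psi>alt[abs_def] by (rule convolution_has_derivative[OF d D]) (rule continuous_on_subset[OF c\<rho>], simp)
      moreover have "integral ?Q (\<lambda>z. (D (x - z) \<bullet> h) * \<rho> z) = D' x \<bullet> h" for h
        using integral_linear[OF int bounded_linear_inner_left, of h x] unfolding D'_def by (simp add: o_def mult.commute)
      ultimately show ?thesis by simp
    qed
    show "norm (D' x - D x) \<le> \<epsilon>" for x
    proof -
      have "((\<lambda>z. \<rho> z *\<^sub>R D (x - z)) has_integral D' x) ?Q" unfolding D'_def using int by (rule integrable_integral)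
      moreover have "((\<lambda>z. \<rho> z *\<^sub>R D x) has_integral 1 *\<^sub>R D x) ?Q" by (rule has_integral_scaleR_left[OF \<rho>(4)])
      ultimately have i: "((\<lambda>z. \<rho> z *\<^sub>R D (x - z) - \<rho> z *\<^sub>R D x) has_integral D' x - 1 *\<^sub>R D x) ?Q" by (rule has_integral_diff)
      have "norm (integral ?Q (\<lambda>z. \<rho> z *\<^sub>R D (x - z) - \<rho> z *\<^sub>R D x)) \<le> integral ?Q (\<lambda>z. \<epsilon> * \<rho> z)"
      proof (rule integral_norm_bound_integral)
        show "(\<lambda>z. \<rho> z *\<^sub>R D (x - z) - \<rho> z *\<^sub>R D x) integrable_on ?Q" using i by blast
        show "(\<lambda>z. \<epsilon> * \<rho> z) integrable_on ?Q" using \<rho>(4) by (intro integrable_on_mult_right) blast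
        fix z
        show "norm (\<rho> z *\<^sub>R D (x - z) - \<rho> z *\<^sub>R D x) \<le> \<epsilon> * \<rho> z"
        proof (cases "r \<le> norm z")
          case False
          then have "\<rho> z * norm (D (x - z) - D x) \<le> \<rho> z * \<epsilon>"
            using unif[of z x] r \<rho>(2) by (intro mult_left_mono) auto
          then show ?thesis using \<rho>(2)[of z] by (simp add: scaleR_diff_right[symmetric] mult.commute)
        qed (use \<rho>(3) in simp)
      qed
      also have "integral ?Q (\<lambda>z. \<epsilon> * \<rho> z) = \<epsilon>" using integral_unique[OF has_integral_mult_right[OF \<rho>(4), of \<epsilon>]] by (simp only: mult_1_right)
      finally show ?thesis using integral_unique[OF i] by simp
    qed
    show "continuous_on UNIV D'"
    proof -
      have "Ck_on (Suc 0) UNIV \<psi>" unfolding \<psi>_def using smooth_on_convolution[OF \<rho>(1), of a b \<phi>] continuous_on_subset[OF c\<phi>]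
        unfolding smooth_on_def by blast
      note g = Ck_on_has_gradient[OF open_UNIV this]
      have "gradient \<psi> x = D' x" for x
      proof -
        have "(\<lambda>h. gradient \<psi> x \<bullet> h) = (\<lambda>h. D' x \<bullet> h)"
          using has_derivative_unique[OF g(1)[OF UNIV_I] \<open>\<And>x. (\<psi> has_derivative (\<lambda>h. D' x \<bullet> h)) (at x)\<close>] .
        then show ?thesis by (metis vector_eq_rdot)
      qed
      then have "gradient \<psi> = D'" by blast
      then show ?thesis using g(2) by simp
    qed
    show "\<psi> x = 0" if "\<And>y. y \<in> S \<Longrightarrow> e \<le> dist x y" for x
    proof -
      have "\<rho> (x - y) * \<phi> y = 0" for y
        using \<rho>(3)[of "x - y"] S(2)[of y] that[of y] r by (cases "y \<in> S") (auto simp: dist_norm)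
      then have "(\<lambda>y. \<rho> (x - y) * \<phi> y) = (\<lambda>_. 0)" by (rule ext)
      then show ?thesis unfolding \<psi>_def by simp
    qed
  qed
qed

text \<open>Differentiation in t removes the factor t; the functions with and without this factor
therefore share one induction.\<close>

lemma smooth_on_scaled_graph_displacement:
  fixes \<psi> :: "'a::euclidean_space \<Rightarrow> real" and T :: "(real \<times> 'a) set"
  assumes T: "open T" and \<psi>: "smooth_on UNIV \<psi>"
  shows "smooth_on T (\<lambda>(t, u). (0 :: 'a, t * \<psi> u))"
proof -
  have "Ck_on k T (\<lambda>(t, u). (0 :: 'a, \<psi> u)) \<and> Ck_on k T (\<lambda>(t, u). (0 :: 'a, t * \<psi> u))" for k
    using \<psi>
  proof (induction k arbitrary: \<psi>)
    case (0 \<psi>)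
    then have "continuous_on UNIV \<psi>" unfolding smooth_on_def by (metis Ck_on.simps(1))
    then have "continuous_on T (\<lambda>p. \<psi> (snd p))" by (rule continuous_on_compose2) (auto intro: continuous_intros)
    then show ?case by (simp add: case_prod_beta') (intro conjI continuous_intros)
  next
    case (Suc k \<psi>)
    then have C: "Ck_on (Suc 0) UNIV \<psi>" unfolding smooth_on_def by blast
    have d: "((\<lambda>p. \<psi> (snd p)) has_derivative (\<lambda>h. gradient \<psi> (snd p) \<bullet> snd h)) (at p)" for p :: "real \<times> 'a"
      by (rule has_derivative_compose[OF _ Ck_on_has_gradient(1)[OF open_UNIV C UNIV_I]]) (auto intro!: derivative_eq_intros)
    have "Ck_on (Suc k) T (\<lambda>(t, u). (0 :: 'a, \<psi> u))"
    proof (rule Ck_on_SucI[OF T])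
      show "((\<lambda>(t, u). (0 :: 'a, \<psi> u)) has_derivative (\<lambda>h. (0 :: 'a, gradient \<psi> (snd p) \<bullet> snd h))) (at p)" for p :: "real \<times> 'a"
        unfolding case_prod_beta' by (rule has_derivative_Pair[OF has_derivative_const d])
      fix i :: "real \<times> 'a" assume "i \<in> Basis"
      then consider "i = (1, 0)" | b where "b \<in> Basis" "i = (0, b)" by (auto simp: Basis_prod_def)
      then show "Ck_on k T (\<lambda>p. (0 :: 'a, gradient \<psi> (snd p) \<bullet> snd i))"
      proof cases
        case 1 then show ?thesis by (simp add: Ck_on_const[OF T])
      next
        case 2 then show ?thesis using Suc.IH[OF smooth_on_partial_deriv[OF Suc.prems 2(1)]]
          by (simp add: gradient_inner_Basis case_prod_beta')
      qed
    qed
    moreover have "Ck_on (Suc k) T (\<lambda>(t, u). (0 :: 'a, t * \<psi> u))"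
    proof (rule Ck_on_SucI[OF T])
      show "((\<lambda>(t, u). (0 :: 'a, t * \<psi> u)) has_derivative (\<lambda>h. (0 :: 'a, fst p * (gradient \<psi> (snd p) \<bullet> snd h) + fst h * \<psi> (snd p)))) (at p)" for p
        unfolding case_prod_beta' by (rule has_derivative_Pair[OF has_derivative_const has_derivative_mult[OF has_derivative_fst[OF has_derivative_ident] d]])
      fix i :: "real \<times> 'a" assume "i \<in> Basis"
      then consider "i = (1, 0)" | b where "b \<in> Basis" "i = (0, b)" by (auto simp: Basis_prod_def)
      then show "Ck_on k T (\<lambda>p. (0 :: 'a, fst p * (gradient \<psi> (snd p) \<bullet> snd i) + fst i * \<psi> (snd p)))"
      proof cases
        case 1 then show ?thesis using Suc.IH[OF Suc.prems] by (simp add: case_prod_beta')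
      next
        case 2 then show ?thesis using Suc.IH[OF smooth_on_partial_deriv[OF Suc.prems 2(1)]]
          by (simp add: gradient_inner_Basis case_prod_beta')
      qed
    qed
    ultimately show ?case by blast
  qed
  then show ?thesis unfolding smooth_on_def by blast
qed

section \<open>Cutoff functions near Hausdorff null sets\<close>

text \<open>A quadratic spline that rises from 0 to 1 on the unit interval.\<close>

definition smoothstep :: "real \<Rightarrow> real" where
  "smoothstep x = 2 * (max 0 x)\<^sup>2 - 4 * (max 0 (x - 1/2))\<^sup>2 + 2 * (max 0 (x - 1))\<^sup>2"

definition smoothstep' :: "real \<Rightarrow> real" where
  "smoothstep' x = 4 * max 0 x - 8 * max 0 (x - 1/2) + 4 * max 0 (x - 1)"

lemma positive_part_square_has_derivative:
  "((\<lambda>x. (max 0 x)\<^sup>2) has_real_derivative 2 * max 0 x) (at (x::real))"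
proof -
  consider "x < 0" | "x = 0" | "0 < x" by linarith
  then show ?thesis
  proof cases
    case 1
    have "((\<lambda>x. 0) has_real_derivative 0) (at x)" by simp
    then have "((\<lambda>x. (max 0 x)\<^sup>2) has_real_derivative 0) (at x)"
      by (rule has_field_derivative_transform_within_open[where S="{..<0}"]) (use 1 in auto)
    then show ?thesis using 1 by simp
  next
    case 2
    have "((\<lambda>h::real. max 0 h) \<longlongrightarrow> 0) (at 0)"
      using tendsto_max[OF tendsto_const tendsto_ident_at, of 0 "0::real" UNIV] by simp
    moreover have eq: "(\<lambda>h::real. ((max 0 (0 + h))\<^sup>2 - (max 0 0)\<^sup>2) / h) = (\<lambda>h. max 0 h)"
      by (rule ext) (auto simp: power2_eq_square max_def)
    ultimately show ?thesis unfolding 2 DERIV_def eq by simp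
  next
    case 3
    have "((\<lambda>x. x\<^sup>2) has_real_derivative 2 * x) (at x)" by (auto intro!: derivative_eq_intros)
    then have "((\<lambda>x. (max 0 x)\<^sup>2) has_real_derivative 2 * x) (at x)"
      by (rule has_field_derivative_transform_within_open[where S="{0<..}"]) (use 3 in auto)
    then show ?thesis using 3 by simp
  qed
qed

lemma smoothstep_has_derivative: "(smoothstep has_real_derivative smoothstep' x) (at x)"
proof -
  have s: "((\<lambda>x. (max 0 (x - c))\<^sup>2) has_real_derivative 2 * max 0 (x - c)) (at x)" for c :: real
  proof -
    have "((\<lambda>x. x - c) has_real_derivative 1) (at x)" by (auto intro!: derivative_eq_intros)
    from DERIV_chain2[OF positive_part_square_has_derivative this] show ?thesis by simp
  qed
  have "((\<lambda>x. 2 * (max 0 x)\<^sup>2 - 4 * (max 0 (x - 1/2))\<^sup>2 + 2 * (max 0 (x - 1))\<^sup>2) has_real_derivative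
     2 * (2 * max 0 x) - 4 * (2 * max 0 (x - 1/2)) + 2 * (2 * max 0 (x - 1))) (at x)"
    by (intro DERIV_add DERIV_diff DERIV_cmult positive_part_square_has_derivative s)
  then show ?thesis unfolding smoothstep_def[abs_def] smoothstep'_def by simp
qed

lemma smoothstep_eq:
  "x \<le> 0 \<Longrightarrow> smoothstep x = 0" "1 \<le> x \<Longrightarrow> smoothstep x = 1"
  "x \<le> 0 \<Longrightarrow> smoothstep' x = 0" "1 \<le> x \<Longrightarrow> smoothstep' x = 0"
  by (auto simp: smoothstep_def smoothstep'_def max_def power2_eq_square field_simps)

lemma smoothstep_bounds: "0 \<le> smoothstep x" "smoothstep x \<le> 1" "\<bar>smoothstep' x\<bar> \<le> 2"
proof -
  consider "x \<le> 0" | "0 \<le> x" "x \<le> 1/2" | "1/2 \<le> x" "x \<le> 1" | "1 \<le> x" by linarith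
  then have "0 \<le> smoothstep x \<and> smoothstep x \<le> 1 \<and> \<bar>smoothstep' x\<bar> \<le> 2"
  proof cases
    case 2
    then have e: "smoothstep x = 2 * x\<^sup>2" "smoothstep' x = 4 * x" by (auto simp: smoothstep_def smoothstep'_def max_def)
    have "x\<^sup>2 \<le> (1/2)\<^sup>2" using 2 by (intro power_mono) auto
    then show ?thesis unfolding e using 2 by (auto simp: power2_eq_square)
  next
    case 3
    then have e: "smoothstep x = 1 - 2 * (1 - x)\<^sup>2" "smoothstep' x = 4 * (1 - x)"
      by (auto simp: smoothstep_def smoothstep'_def max_def power2_eq_square algebra_simps)
    have "(1 - x)\<^sup>2 \<le> (1/2)\<^sup>2" using 3 by (intro power_mono) auto
    then show ?thesis unfolding e using 3 by (auto simp: power2_eq_square)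
  qed (auto simp: smoothstep_eq)
  then show "0 \<le> smoothstep x" "smoothstep x \<le> 1" "\<bar>smoothstep' x\<bar> \<le> 2" by auto
qed

lemma ball_cutoff:
  fixes a :: "'a::euclidean_space"
  assumes r: "0 < r"
  obtains \<zeta> D where "\<And>x. (\<zeta> has_derivative (\<lambda>h. D x \<bullet> h)) (at x)" "continuous_on UNIV D"
    "\<And>x. 0 \<le> \<zeta> x" "\<And>x. \<zeta> x \<le> 1" "\<And>x. dist x a \<le> r \<Longrightarrow> \<zeta> x = 0" "\<And>x. 2 * r \<le> dist x a \<Longrightarrow> \<zeta> x = 1"
    "\<And>x. norm (D x) \<le> 3 / r * indicator (cball a (2 * r)) x"
proof -
  define \<tau> where "\<tau> x = ((x - a) \<bullet> (x - a) / r\<^sup>2 - 1) / 3" for x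
  define D where "D x = (smoothstep' (\<tau> x) * (2 / (3 * r\<^sup>2))) *\<^sub>R (x - a)" for x
  have nn: "(x - a) \<bullet> (x - a) = (dist x a)\<^sup>2" for x by (simp add: dist_norm power2_norm_eq_inner)
  have in0: "\<tau> x \<le> 0" if "dist x a \<le> r" for x
    using power_mono[OF that, of 2] r unfolding \<tau>_def nn by (simp add: field_simps)
  have out1: "1 \<le> \<tau> x" if "2 * r \<le> dist x a" for x
    using power_mono[OF that, of 2] r unfolding \<tau>_def nn by (simp add: field_simps)
  show ?thesis
  proof (rule that[of "\<lambda>x. smoothstep (\<tau> x)" D])
    fix x
    have "(\<tau> has_derivative (\<lambda>h. (2 / (3 * r\<^sup>2)) * ((x - a) \<bullet> h))) (at x)"
      unfolding \<tau>_def[abs_def] using r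
      by (auto intro!: derivative_eq_intros simp: inner_commute field_simps)
    from has_derivative_compose[OF this smoothstep_has_derivative[unfolded has_field_derivative_def]]
    show "((\<lambda>x. smoothstep (\<tau> x)) has_derivative (\<lambda>h. D x \<bullet> h)) (at x)"
      unfolding D_def by (simp add: mult_ac)
    show "norm (D x) \<le> 3 / r * indicator (cball a (2 * r)) x"
    proof (cases "dist x a \<le> 2 * r")
      case True
      have "norm (D x) = \<bar>smoothstep' (\<tau> x)\<bar> * (2 / (3 * r\<^sup>2)) * dist x a"
        unfolding D_def by (simp add: abs_mult dist_norm)
      also have "\<dots> \<le> 2 * (2 / (3 * r\<^sup>2)) * (2 * r)"
        by (intro mult_mono smoothstep_bounds True) (use r in auto)
      also have "\<dots> \<le> 3 / r" using r by (simp add: power2_eq_square field_simps)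
      finally show ?thesis using True by (simp add: dist_commute)
    next
      case False
      then show ?thesis using out1[of x] smoothstep_eq(4) by (auto simp: D_def indicator_def dist_commute)
    qed
  next
    have "continuous_on UNIV smoothstep'" unfolding smoothstep'_def[abs_def] by (intro continuous_intros)
    then have "continuous_on UNIV (\<lambda>x. smoothstep' (\<tau> x))"
    proof (rule continuous_on_compose2)
      show "continuous_on UNIV \<tau>" unfolding \<tau>_def[abs_def] using r by (intro continuous_intros) auto
    qed simp
    then show "continuous_on UNIV D" unfolding D_def[abs_def] by (intro continuous_intros)
  qed (use smoothstep_bounds smoothstep_eq in0 out1 in auto)
qed

text \<open>The product of the cutoffs of the single balls. As the factors lie between 0 and 1, the
gradient of the product is bounded by the sum of the gradients.\<close>

lemma finite_balls_cutoff:
  fixes a :: "'i \<Rightarrow> 'a::euclidean_space"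
  assumes "finite I" "\<And>i. i \<in> I \<Longrightarrow> 0 < r i"
  shows "\<exists>\<eta> D. (\<forall>x. (\<eta> has_derivative (\<lambda>h. D x \<bullet> h)) (at x)) \<and> continuous_on UNIV D \<and>
    (\<forall>x. 0 \<le> \<eta> x \<and> \<eta> x \<le> 1) \<and> (\<forall>x. \<forall>i\<in>I. dist x (a i) \<le> r i \<longrightarrow> \<eta> x = 0) \<and>
    (\<forall>x. (\<forall>i\<in>I. 2 * r i \<le> dist x (a i)) \<longrightarrow> \<eta> x = 1) \<and>
    (\<forall>x. norm (D x) \<le> (\<Sum>i\<in>I. 3 / r i * indicator (cball (a i) (2 * r i)) x))"
  using assms
proof (induction I rule: finite_induct)
  case empty
  show ?case by (rule exI[of _ "\<lambda>_. 1"], rule exI[of _ "\<lambda>_. 0"]) auto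
next
  case (insert i I)
  obtain \<eta> D where "(\<forall>x. (\<eta> has_derivative (\<lambda>h. D x \<bullet> h)) (at x)) \<and> continuous_on UNIV D \<and>
    (\<forall>x. 0 \<le> \<eta> x \<and> \<eta> x \<le> 1) \<and> (\<forall>x. \<forall>i\<in>I. dist x (a i) \<le> r i \<longrightarrow> \<eta> x = 0) \<and>
    (\<forall>x. (\<forall>i\<in>I. 2 * r i \<le> dist x (a i)) \<longrightarrow> \<eta> x = 1) \<and>
    (\<forall>x. norm (D x) \<le> (\<Sum>i\<in>I. 3 / r i * indicator (cball (a i) (2 * r i)) x))"
    using insert.IH insert.prems by blast
  then have \<eta>: "\<And>x. (\<eta> has_derivative (\<lambda>h. D x \<bullet> h)) (at x)" "continuous_on UNIV D"
    "\<And>x. 0 \<le> \<eta> x" "\<And>x. \<eta> x \<le> 1" "\<And>x j. j \<in> I \<Longrightarrow> dist x (a j) \<le> r j \<Longrightarrow> \<eta> x = 0"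
    "\<And>x. (\<And>j. j \<in> I \<Longrightarrow> 2 * r j \<le> dist x (a j)) \<Longrightarrow> \<eta> x = 1"
    "\<And>x. norm (D x) \<le> (\<Sum>i\<in>I. 3 / r i * indicator (cball (a i) (2 * r i)) x)"
    by blast+
  obtain \<zeta> E where \<zeta>: "\<And>x. (\<zeta> has_derivative (\<lambda>h. E x \<bullet> h)) (at x)" "continuous_on UNIV E"
    "\<And>x. 0 \<le> \<zeta> x" "\<And>x. \<zeta> x \<le> 1" "\<And>x. dist x (a i) \<le> r i \<Longrightarrow> \<zeta> x = 0" "\<And>x. 2 * r i \<le> dist x (a i) \<Longrightarrow> \<zeta> x = 1"
    "\<And>x. norm (E x) \<le> 3 / r i * indicator (cball (a i) (2 * r i)) x"
    using ball_cutoff[of "r i" "a i"] insert.prems by (metis insertI1)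
  have c: "continuous_on UNIV \<eta>" "continuous_on UNIV \<zeta>"
    by (intro continuous_at_imp_continuous_on ballI has_derivative_continuous[OF \<eta>(1)],
        intro continuous_at_imp_continuous_on ballI has_derivative_continuous[OF \<zeta>(1)])
  let ?D = "\<lambda>x. \<zeta> x *\<^sub>R D x + \<eta> x *\<^sub>R E x"
  have 1: "((\<lambda>x. \<zeta> x * \<eta> x) has_derivative (\<lambda>h. ?D x \<bullet> h)) (at x)" for x
  proof -
    have "(\<lambda>h. \<zeta> x * (D x \<bullet> h) + (E x \<bullet> h) * \<eta> x) = (\<lambda>h. ?D x \<bullet> h)"
      by (rule ext) (simp add: inner_add_left mult.commute)
    then show ?thesis using has_derivative_mult[OF \<zeta>(1) \<eta>(1), of x] by simp
  qed
  have 2: "continuous_on UNIV ?D" by (intro continuous_intros c \<eta> \<zeta>)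
  have 3: "norm (?D x) \<le> (\<Sum>i\<in>insert i I. 3 / r i * indicator (cball (a i) (2 * r i)) x)" for x
  proof -
    have "norm (?D x) \<le> \<zeta> x * norm (D x) + \<eta> x * norm (E x)"
      using norm_triangle_ineq[of "\<zeta> x *\<^sub>R D x" "\<eta> x *\<^sub>R E x"] \<eta>(3) \<zeta>(3) by simp
    also have "\<dots> \<le> 1 * norm (D x) + 1 * norm (E x)"
      by (intro add_mono mult_right_mono \<eta> \<zeta>) auto
    also have "\<dots> \<le> (\<Sum>i\<in>I. 3 / r i * indicator (cball (a i) (2 * r i)) x) + 3 / r i * indicator (cball (a i) (2 * r i)) x"
      using \<eta>(7)[of x] \<zeta>(7)[of x] by simp
    also have "\<dots> = (\<Sum>i\<in>insert i I. 3 / r i * indicator (cball (a i) (2 * r i)) x)"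
      using insert.hyps by (simp add: add.commute)
    finally show ?thesis .
  qed
  have 4: "0 \<le> \<zeta> x * \<eta> x \<and> \<zeta> x * \<eta> x \<le> 1" for x
    using \<eta>(3,4)[of x] \<zeta>(3,4)[of x] by (simp add: mult_le_one)
  show ?case
    by (rule exI[of _ "\<lambda>x. \<zeta> x * \<eta> x"], rule exI[of _ ?D], intro conjI allI)
       (use 1 2 3 4 \<eta>(5,6) \<zeta>(5,6) in auto)
qed

text \<open>Each covering set that meets K is replaced by a ball with centre in K and radius slightly
larger than the diameter, the excess being chosen such that the k-th powers grow by a
summable amount. Compactness leaves finitely many balls.\<close>

lemma hausdorff_null_ball_cover:
  fixes K :: "'a::euclidean_space set"
  assumes K: "compact K" "hausdorff_measure k K = 0" and e: "0 < e" and \<rho>: "0 < \<rho>"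
  obtains I :: "nat set" and a r where "finite I" "K \<subseteq> (\<Union>i\<in>I. ball (a i) (r i))"
    "\<And>i. i \<in> I \<Longrightarrow> 0 < r i \<and> r i < \<rho> \<and> a i \<in> K" "(\<Sum>i\<in>I. r i ^ k) \<le> e"
proof -
  define \<omega> where "\<omega> = unit_ball_vol (real k)"
  have \<omega>: "0 < \<omega>" unfolding \<omega>_def by (rule unit_ball_vol_pos) simp
  define e' where "e' = e / 2 * (\<omega> / 2 ^ k)"
  have e': "0 < e'" unfolding e'_def using e \<omega> by simp
  have "hausdorff_premeasure k (\<rho>/2) K \<le> 0"
    using hausdorff_premeasure_le_measure[of "\<rho>/2" k K] K(2) \<rho> by simp
  also have "0 < ennreal e'" using e' by simp
  finally obtain C :: "nat \<Rightarrow> 'a set" where C: "K \<subseteq> (\<Union>i. C i)" "\<And>i. bounded (C i)" "\<And>i. diameter (C i) \<le> \<rho>/2"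
    "(\<Sum>i. hausdorff_cost k (C i)) < ennreal e'"
    by (rule hausdorff_premeasure_cover) blast
  define J where "J = {i. C i \<inter> K \<noteq> {}}"
  define a where "a i = (SOME x. x \<in> C i \<inter> K)" for i
  have a: "a i \<in> C i" "a i \<in> K" if "i \<in> J" for i
    using that unfolding J_def a_def by (metis (mono_tags, lifting) IntE ex_in_conv mem_Collect_eq someI_ex)+
  have "\<exists>r. diameter (C i) < r \<and> r < \<rho> \<and> r ^ k < diameter (C i) ^ k + e / 2 * (1/2) ^ Suc i" for i
  proof -
    let ?d = "diameter (C i)"
    have "((\<lambda>r. r ^ k) \<longlongrightarrow> ?d ^ k) (at_right ?d)" by (intro tendsto_intros)
    then have "eventually (\<lambda>r. r ^ k < ?d ^ k + e / 2 * (1/2) ^ Suc i) (at_right ?d)"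
      by (rule order_tendstoD) (use e in simp)
    moreover have "eventually (\<lambda>r. r < \<rho>) (at_right ?d)"
      using C(3)[of i] \<rho> by (auto simp: eventually_at_right_field intro!: exI[of _ \<rho>])
    moreover have "eventually (\<lambda>r. ?d < r) (at_right ?d)" by (rule eventually_at_right_less)
    ultimately have "eventually (\<lambda>r. ?d < r \<and> r < \<rho> \<and> r ^ k < ?d ^ k + e / 2 * (1/2) ^ Suc i) (at_right ?d)"
      by eventually_elim auto
    then show ?thesis using eventually_happens'[OF trivial_limit_at_right_real] by blast
  qed
  then obtain r where r: "\<And>i. diameter (C i) < r i" "\<And>i. r i < \<rho>" "\<And>i. r i ^ k < diameter (C i) ^ k + e / 2 * (1/2) ^ Suc i"
    by metis
  have rpos: "0 < r i" for i using r(1)[of i] diameter_ge_0[OF C(2), of i] by simp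
  have cov: "K \<subseteq> (\<Union>i\<in>J. ball (a i) (r i))"
  proof
    fix x assume x: "x \<in> K"
    then obtain i where i: "x \<in> C i" using C(1) by blast
    then have J: "i \<in> J" using x unfolding J_def by blast
    have "dist (a i) x \<le> diameter (C i)" by (rule diameter_bounded_bound[OF C(2) a(1)[OF J] i])
    then have "x \<in> ball (a i) (r i)" using r(1)[of i] by simp
    then show "x \<in> (\<Union>i\<in>J. ball (a i) (r i))" using J by blast
  qed
  obtain I where I: "I \<subseteq> J" "finite I" "K \<subseteq> (\<Union>i\<in>I. ball (a i) (r i))"
    using compactE_image[OF K(1) _ cov] by (metis open_ball)
  have "(\<Sum>i\<in>I. ennreal (\<omega> * (diameter (C i) / 2) ^ k)) \<le> (\<Sum>i\<in>I. hausdorff_cost k (C i))"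
  proof (rule sum_mono)
    fix i assume "i \<in> I"
    then have "C i \<noteq> {}" using a(1) I(1) by blast
    then show "ennreal (\<omega> * (diameter (C i) / 2) ^ k) \<le> hausdorff_cost k (C i)" unfolding hausdorff_cost_def \<omega>_def by simp
  qed
  also have "\<dots> \<le> (\<Sum>i. hausdorff_cost k (C i))" by (rule sum_le_suminf) (use I in auto)
  also have "\<dots> \<le> ennreal e'" using C(4) by simp
  also have "(\<Sum>i\<in>I. ennreal (\<omega> * (diameter (C i) / 2) ^ k)) = ennreal (\<Sum>i\<in>I. \<omega> * (diameter (C i) / 2) ^ k)"
    by (rule sum_ennreal) (use \<omega> diameter_ge_0[OF C(2)] in simp)
  finally have "(\<Sum>i\<in>I. \<omega> * (diameter (C i) / 2) ^ k) \<le> e'" using e' by (simp add: ennreal_le_iff)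
  moreover have "(\<Sum>i\<in>I. \<omega> * (diameter (C i) / 2) ^ k) = (\<omega> / 2 ^ k) * (\<Sum>i\<in>I. diameter (C i) ^ k)"
    by (simp add: sum_distrib_left power_divide)
  ultimately have "(\<omega> / 2 ^ k) * (\<Sum>i\<in>I. diameter (C i) ^ k) \<le> (\<omega> / 2 ^ k) * (e / 2)"
    unfolding e'_def by (simp add: mult.commute)
  then have 1: "(\<Sum>i\<in>I. diameter (C i) ^ k) \<le> e / 2" by (rule mult_left_le_imp_le) (use \<omega> in simp)
  have "(\<Sum>i\<in>I. e / 2 * (1/2) ^ Suc i) \<le> (\<Sum>i. e / 2 * (1/2) ^ Suc i)"
    by (rule sum_le_suminf) (use I e sums_summable[OF sums_mult[OF power_half_series, of "e/2"]] in auto)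
  also have "\<dots> = e / 2" using sums_unique[OF sums_mult[OF power_half_series, of "e/2"]] by simp
  finally have 2: "(\<Sum>i\<in>I. e / 2 * (1/2) ^ Suc i) \<le> e / 2" .
  have "(\<Sum>i\<in>I. r i ^ k) \<le> (\<Sum>i\<in>I. diameter (C i) ^ k + e / 2 * (1/2) ^ Suc i)"
    by (intro sum_mono less_imp_le r)
  also have "\<dots> \<le> e" using 1 2 by (simp add: sum.distrib)
  finally show ?thesis using that[of I a r] I r(2) rpos a(2) by blast
qed

text \<open>The cutoff of a ball of radius r has a gradient of size at most 3/r, supported in the ball
of radius 2r. Its integral is at most a multiple of r^(m-1), and these powers have a small
sum for suitable covers of a set of vanishing (m-1)-dimensional measure.\<close>

theorem hausdorff_null_cutoff:
  fixes K :: "'a::euclidean_space set"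
  assumes K: "compact K" "hausdorff_measure (DIM('a) - 1) K = 0" and e: "0 < e" and \<rho>: "0 < \<rho>"
  obtains \<eta> D N where "\<And>x. (\<eta> has_derivative (\<lambda>h. D x \<bullet> h)) (at x)" "continuous_on UNIV D"
    "\<And>x. 0 \<le> \<eta> x" "\<And>x. \<eta> x \<le> 1" "open N" "K \<subseteq> N" "\<And>x. x \<in> N \<Longrightarrow> \<eta> x = 0"
    "\<And>x. (\<And>y. y \<in> K \<Longrightarrow> \<rho> \<le> dist x y) \<Longrightarrow> \<eta> x = 1"
    "integrable lborel (\<lambda>x. norm (D x))" "(LINT x|lborel. norm (D x)) \<le> e"
proof -
  let ?m = "DIM('a)"
  define C where "C = 3 * unit_ball_vol (real ?m) * 2 ^ ?m"
  have C: "0 < C" unfolding C_def by (simp add: unit_ball_vol_pos)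
  have pos: "0 < e / C" "0 < \<rho> / 2" using e C \<rho> by auto
  obtain I :: "nat set" and a r where I: "finite I" "K \<subseteq> (\<Union>i\<in>I. ball (a i) (r i))"
    "\<And>i. i \<in> I \<Longrightarrow> 0 < r i \<and> r i < \<rho> / 2 \<and> a i \<in> K" "(\<Sum>i\<in>I. r i ^ (?m - 1)) \<le> e / C"
    by (rule hausdorff_null_ball_cover[OF K pos]) blast
  obtain \<eta> D where "(\<forall>x. (\<eta> has_derivative (\<lambda>h. D x \<bullet> h)) (at x)) \<and> continuous_on UNIV D \<and>
    (\<forall>x. 0 \<le> \<eta> x \<and> \<eta> x \<le> 1) \<and> (\<forall>x. \<forall>i\<in>I. dist x (a i) \<le> r i \<longrightarrow> \<eta> x = 0) \<and>
    (\<forall>x. (\<forall>i\<in>I. 2 * r i \<le> dist x (a i)) \<longrightarrow> \<eta> x = 1) \<and>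
    (\<forall>x. norm (D x) \<le> (\<Sum>i\<in>I. 3 / r i * indicator (cball (a i) (2 * r i)) x))"
    using finite_balls_cutoff[of I r a] I(1,3) by blast
  then have \<eta>: "\<And>x. (\<eta> has_derivative (\<lambda>h. D x \<bullet> h)) (at x)" "continuous_on UNIV D"
    "\<And>x. 0 \<le> \<eta> x" "\<And>x. \<eta> x \<le> 1" "\<And>x j. j \<in> I \<Longrightarrow> dist x (a j) \<le> r j \<Longrightarrow> \<eta> x = 0"
    "\<And>x. (\<And>j. j \<in> I \<Longrightarrow> 2 * r j \<le> dist x (a j)) \<Longrightarrow> \<eta> x = 1"
    "\<And>x. norm (D x) \<le> (\<Sum>i\<in>I. 3 / r i * indicator (cball (a i) (2 * r i)) x)"
    by blast+
  have fin: "emeasure lborel (cball c s) < top" for c :: 'a and s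
    using emeasure_bounded_finite[OF bounded_cball, of c s] by simp
  have int: "integrable lborel (\<lambda>x. \<Sum>i\<in>I. 3 / r i * indicator (cball (a i) (2 * r i)) x)"
    by (intro Bochner_Integration.integrable_sum integrable_mult_right integrable_real_indicator)
       (auto simp: fin)
  have nD: "integrable lborel (\<lambda>x. norm (D x))"
  proof (rule Bochner_Integration.integrable_bound[OF int])
    show "(\<lambda>x. norm (D x)) \<in> borel_measurable lborel"
      using borel_measurable_continuous_onI[OF \<eta>(2)] by simp
    show "AE x in lborel. norm (norm (D x)) \<le> norm (\<Sum>i\<in>I. 3 / r i * indicator (cball (a i) (2 * r i)) x)"
      using \<eta>(7) by (intro AE_I2) (simp add: order_trans[OF _ abs_ge_self])
  qed
  have "(LINT x|lborel. norm (D x)) \<le> (LINT x|lborel. (\<Sum>i\<in>I. 3 / r i * indicator (cball (a i) (2 * r i)) x))"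
    by (rule integral_mono[OF nD int \<eta>(7)])
  also have "\<dots> = (\<Sum>i\<in>I. 3 / r i * measure lborel (cball (a i) (2 * r i)))"
    by (subst Bochner_Integration.integral_sum)
       (auto intro!: integrable_mult_right integrable_real_indicator simp: fin)
  also have "\<dots> = (\<Sum>i\<in>I. C * r i ^ (?m - 1))"
  proof (rule sum.cong[OF refl])
    fix i assume "i \<in> I"
    then have ri: "0 < r i" using I(3) by blast
    have "r i ^ ?m = r i * r i ^ (?m - 1)" by (metis DIM_positive power_minus_mult mult.commute)
    then show "3 / r i * measure lborel (cball (a i) (2 * r i)) = C * r i ^ (?m - 1)"
      using ri by (simp add: content_cball C_def power_mult_distrib)
  qed
  also have "\<dots> = C * (\<Sum>i\<in>I. r i ^ (?m - 1))" by (simp add: sum_distrib_left)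
  also have "\<dots> \<le> C * (e / C)" using C I(4) by (intro mult_left_mono) auto
  also have "\<dots> = e" using C by simp
  finally have le: "(LINT x|lborel. norm (D x)) \<le> e" .
  show ?thesis
  proof (rule that[of \<eta> D "\<Union>i\<in>I. ball (a i) (r i)"])
    fix x assume "x \<in> (\<Union>i\<in>I. ball (a i) (r i))"
    then obtain i where "i \<in> I" "dist (a i) x < r i" by auto
    then show "\<eta> x = 0" using \<eta>(5)[of i x] by (simp add: dist_commute)
  next
    fix x assume x: "\<And>y. y \<in> K \<Longrightarrow> \<rho> \<le> dist x y"
    show "\<eta> x = 1"
    proof (rule \<eta>(6))
      fix j assume "j \<in> I"
      then show "2 * r j \<le> dist x (a j)" using I(3)[of j] x[of "a j"] by auto
    qed
  qed (use \<eta> I le nD in auto)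
qed

section \<open>Minimal graphs as minimizers\<close>

lemma area_density_graph:
  fixes f :: "'a::euclidean_space \<Rightarrow> real"
  assumes "(f has_derivative (\<lambda>h. D \<bullet> h)) (at u)"
  shows "area_density F (\<lambda>u. (u, f u)) u = enn2real (hausdorff_measure DIM('a) (ball (0::'a) 1) /
    hausdorff_measure DIM('a) {v. F (u, f u) (v, D \<bullet> v) \<le> 1})"
proof -
  have "((\<lambda>u. (u, f u)) has_derivative (\<lambda>h. (h, D \<bullet> h))) (at u)"
    by (rule has_derivative_Pair[OF has_derivative_ident assms])
  then have "frechet_derivative (\<lambda>u. (u, f u)) (at u) = (\<lambda>h. (h, D \<bullet> h))" by (rule frechet_derivative_at[symmetric])
  then show ?thesis unfolding area_density_def by simp
qed

lemma set_integrable_continuous_relatively_compact: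
  fixes g :: "'a::euclidean_space \<Rightarrow> real"
  assumes "open V" "compact (closure V)" "closure V \<subseteq> U" "continuous_on U g"
  shows "set_integrable lborel V g"
proof -
  have "integrable lborel (\<lambda>x. indicator (closure V) x *\<^sub>R g x)"
    by (rule borel_integrable_compact[OF assms(2) continuous_on_subset[OF assms(4,3)]])
  then have "set_integrable lborel (closure V) g" unfolding set_integrable_def .
  then show ?thesis by (rule set_integrable_subset) (use assms(1) closure_subset in auto)
qed

lemma convex_critical_point_le:
  fixes I :: "real \<Rightarrow> real"
  assumes "(I has_real_derivative 0) (at 0)"
    and "\<And>t. 0 < t \<Longrightarrow> t < 1 \<Longrightarrow> I t \<le> (1-t) * I 0 + t * I 1"
  shows "I 0 \<le> I 1"
proof -
  have "((\<lambda>h. (I (0 + h) - I 0) / h) \<longlongrightarrow> 0) (at 0)" using assms(1) unfolding DERIV_def .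
  then have l: "((\<lambda>h. (I (0 + h) - I 0) / h) \<longlongrightarrow> 0) (at_right 0)"
    by (rule tendsto_mono[OF at_le, rotated]) simp
  have "eventually (\<lambda>h. (I (0 + h) - I 0) / h \<le> I 1 - I 0) (at_right 0)"
    unfolding eventually_at_right_field
  proof (intro exI[of _ 1] conjI allI impI)
    fix h :: real assume "0 < h" "h < 1"
    then have "I h - I 0 \<le> (I 1 - I 0) * h" using assms(2)[of h] by (simp add: algebra_simps)
    then show "(I (0 + h) - I 0) / h \<le> I 1 - I 0" using \<open>0 < h\<close> by (simp add: pos_divide_le_eq)
  qed simp
  from tendsto_upperbound[OF l this] show ?thesis by simp
qed

text \<open>The area density as a function A of the gradient, with the properties that the comparison
arguments use.\<close>

locale area_integrand =
  fixes F :: "'a::euclidean_space \<times> real \<Rightarrow> 'a \<times> real \<Rightarrow> real" and A :: "'a \<Rightarrow> real" and L :: real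
  assumes density: "enn2real (hausdorff_measure DIM('a) (ball (0::'a) 1) / hausdorff_measure DIM('a) {v. F x (v, p \<bullet> v) \<le> 1}) = A p"
    and L_nonneg: "0 \<le> L" and Lipschitz: "\<bar>A p - A q\<bar> \<le> L * norm (p - q)"
    and strictly_convex: "\<lbrakk>0 < t; t < 1; p \<noteq> q\<rbrakk> \<Longrightarrow> A ((1-t) *\<^sub>R p + t *\<^sub>R q) < (1-t) * A p + t * A q"
begin

lemma continuous: "continuous_on S A"
proof -
  have "L-lipschitz_on S A"
    by (rule lipschitz_onI) (use Lipschitz L_nonneg in \<open>auto simp: dist_norm\<close>)
  then show ?thesis by (rule lipschitz_on_continuous_on)
qed

lemma continuous_compose: "continuous_on S p \<Longrightarrow> continuous_on S (\<lambda>u. A (p u))"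
  by (rule continuous_on_compose2[OF continuous[of UNIV]]) auto

lemma convex: "0 \<le> t \<Longrightarrow> t \<le> 1 \<Longrightarrow> A ((1-t) *\<^sub>R p + t *\<^sub>R q) \<le> (1-t) * A p + t * A q"
proof (cases "t = 0 \<or> t = 1 \<or> p = q")
  case True
  have "(1-t) *\<^sub>R q + t *\<^sub>R q = q" "(1-t) * A q + t * A q = A q" by (simp_all add: algebra_simps)
  then show ?thesis using True by auto
qed (use strictly_convex[of t p q] in auto)

text \<open>The two new slopes are convex combinations of the old ones, with exchanged weights.\<close>

lemma exchange_le:
  assumes "0 \<le> \<theta>" "\<theta> \<le> 1"
  shows "A (p - \<theta> *\<^sub>R (p - q)) + A (q + \<theta> *\<^sub>R (p - q)) \<le> A p + A q"
proof -
  have "p - \<theta> *\<^sub>R (p - q) = (1-\<theta>) *\<^sub>R p + \<theta> *\<^sub>R q" "q + \<theta> *\<^sub>R (p - q) = (1-\<theta>) *\<^sub>R q + \<theta> *\<^sub>R p"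
    by (simp_all add: algebra_simps)
  then show ?thesis using convex[OF assms, of p q] convex[OF assms, of q p] by (simp add: algebra_simps)
qed

lemma exchange_less:
  assumes "0 < \<theta>" "\<theta> < 1" "p \<noteq> q"
  shows "A (p - \<theta> *\<^sub>R (p - q)) + A (q + \<theta> *\<^sub>R (p - q)) < A p + A q"
proof -
  have "p - \<theta> *\<^sub>R (p - q) = (1-\<theta>) *\<^sub>R p + \<theta> *\<^sub>R q" "q + \<theta> *\<^sub>R (p - q) = (1-\<theta>) *\<^sub>R q + \<theta> *\<^sub>R p"
    by (simp_all add: algebra_simps)
  then show ?thesis using strictly_convex[OF assms] strictly_convex[OF assms(1,2), of q p] assms(3) by (simp add: algebra_simps)
qed

lemma finsler_area_graph:
  assumes "V \<in> sets borel" "\<And>u. u \<in> V \<Longrightarrow> (f has_derivative (\<lambda>h. D u \<bullet> h)) (at u)"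
  shows "finsler_area F V (\<lambda>u. (u, f u)) = (LINT u:V|lborel. A (D u))"
  unfolding finsler_area_def
  by (rule set_lebesgue_integral_cong) (use assms(1) area_density_graph[OF assms(2)] density in auto)

text \<open>By convexity of A the area of the graph of f + t\<psi> is a convex function of t, whose
critical point t = 0 is a minimum.\<close>

lemma minimal_graph_smooth_comparison:
  assumes min: "finsler_minimal_on F U (\<lambda>u. (u, f u))" and U: "open U"
    and f: "\<And>u. u \<in> U \<Longrightarrow> (f has_derivative (\<lambda>h. p u \<bullet> h)) (at u)" "continuous_on U p"
    and \<psi>: "smooth_on UNIV \<psi>" "\<And>u. (\<psi> has_derivative (\<lambda>h. d u \<bullet> h)) (at u)" "continuous_on UNIV d"
    and V: "open V" "compact (closure V)" "closure V \<subseteq> U"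
    and C: "compact C" "C \<subseteq> V" "\<And>u. u \<notin> C \<Longrightarrow> \<psi> u = 0"
  shows "(LINT u:V|lborel. A (p u)) \<le> (LINT u:V|lborel. A (p u + d u))"
proof -
  define Y where "Y t u = (u, f u + t * \<psi> u)" for t u
  have VU: "V \<subseteq> U" using V(3) closure_subset by blast
  define I where "I t = (LINT u:V|lborel. A (p u + t *\<^sub>R d u))" for t
  have area: "finsler_area F V (Y t) = I t" for t
    unfolding Y_def I_def
  proof (rule finsler_area_graph)
    fix u assume "u \<in> V"
    then have "u \<in> U" using VU by blast
    have "((\<lambda>u. f u + t * \<psi> u) has_derivative (\<lambda>h. p u \<bullet> h + t * (d u \<bullet> h))) (at u)"
      by (intro has_derivative_add f \<open>u \<in> U\<close> has_derivative_mult_right \<psi>(2))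
    then show "((\<lambda>u. f u + t * \<psi> u) has_derivative (\<lambda>h. (p u + t *\<^sub>R d u) \<bullet> h)) (at u)"
      by (simp add: inner_add_left)
  qed (use V in simp)
  have var: "smooth_variation U (\<lambda>u. (u, f u)) C 2 Y"
  proof -
    have "smooth_on ({-2<..<2} \<times> U) (\<lambda>(t, u). (0 :: 'a, t * \<psi> u))"
      by (rule smooth_on_scaled_graph_displacement[OF _ \<psi>(1)]) (use U in \<open>auto intro: open_Times\<close>)
    moreover have "(\<lambda>(t, u). Y t u - (u, f u)) = (\<lambda>(t, u). (0 :: 'a, t * \<psi> u))"
      by (auto simp: Y_def fun_eq_iff)
    ultimately show ?thesis unfolding smooth_variation_def using C VU by (auto simp: Y_def)
  qed
  have "((\<lambda>t. finsler_area F V (Y t)) has_real_derivative 0) (at 0)"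
    using min V C(2) var unfolding finsler_minimal_on_def by blast
  then have der: "(I has_real_derivative 0) (at 0)" unfolding area .
  have cd: "continuous_on U d" using \<psi>(3) continuous_on_subset by blast
  have si: "set_integrable lborel V (\<lambda>u. A (p u + t *\<^sub>R d u))" for t
    by (rule set_integrable_continuous_relatively_compact[OF V]) (intro continuous_compose continuous_intros f cd)
  have "I t \<le> (1-t) * I 0 + t * I 1" if t: "0 < t" "t < 1" for t
  proof -
    have "I t \<le> (LINT u:V|lborel. (1-t) * A (p u + 0 *\<^sub>R d u) + t * A (p u + 1 *\<^sub>R d u))"
      unfolding I_def
    proof (rule set_integral_mono)
      show "set_integrable lborel V (\<lambda>u. (1-t) * A (p u + 0 *\<^sub>R d u) + t * A (p u + 1 *\<^sub>R d u))"
        by (intro set_integral_add set_integrable_mult_right si)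
      fix u
      have "p u + t *\<^sub>R d u = (1-t) *\<^sub>R (p u + 0 *\<^sub>R d u) + t *\<^sub>R (p u + 1 *\<^sub>R d u)" by (simp add: algebra_simps)
      then show "A (p u + t *\<^sub>R d u) \<le> (1-t) * A (p u + 0 *\<^sub>R d u) + t * A (p u + 1 *\<^sub>R d u)"
        using convex[of t "p u + 0 *\<^sub>R d u" "p u + 1 *\<^sub>R d u"] t by simp
    qed (rule si)
    also have "\<dots> = (1-t) * I 0 + t * I 1"
      unfolding I_def
      by (subst set_integral_add(2)[OF set_integrable_mult_right[OF si] set_integrable_mult_right[OF si]])
         (simp only: set_integral_mult_right)
    finally show ?thesis .
  qed
  then have "I 0 \<le> I 1" by (rule convex_critical_point_le[OF der])
  then show ?thesis unfolding I_def by simp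
qed

text \<open>The inequality for smooth functions passes to functions that are continuously differentiable,
since A is Lipschitz and the gradients are approximated uniformly.\<close>

lemma minimal_graph_C1_comparison:
  assumes min: "finsler_minimal_on F U (\<lambda>u. (u, f u))" and U: "open U"
    and f: "\<And>u. u \<in> U \<Longrightarrow> (f has_derivative (\<lambda>h. p u \<bullet> h)) (at u)" "continuous_on U p"
    and \<phi>: "\<And>u. (\<phi> has_derivative (\<lambda>h. d u \<bullet> h)) (at u)" "continuous_on UNIV d"
    and V: "open V" "compact (closure V)" "closure V \<subseteq> U"
    and S: "compact S" "S \<subseteq> V" "\<And>u. u \<notin> S \<Longrightarrow> \<phi> u = 0"
  shows "(LINT u:V|lborel. A (p u)) \<le> (LINT u:V|lborel. A (p u + d u))"
proof (rule field_le_epsilon)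
  fix \<epsilon> :: real assume \<epsilon>: "0 < \<epsilon>"
  define \<mu> where "\<mu> = measure lborel V"
  have bV: "bounded V" using V(2) by (meson bounded_subset closure_subset compact_imp_bounded)
  have fV: "emeasure lborel V < \<infinity>" by (rule emeasure_bounded_finite[OF bV])
  define \<delta> where "\<delta> = \<epsilon> / (L * \<mu> + 1)"
  have \<mu>: "0 \<le> \<mu>" unfolding \<mu>_def by simp
  then have pos: "0 < L * \<mu> + 1" using L_nonneg by (simp add: add_nonneg_pos)
  have \<delta>: "0 < \<delta>" unfolding \<delta>_def using \<epsilon> pos by simp
  obtain e where e: "0 < e" "(\<Union>x\<in>S. ball x e) \<subseteq> V"
    using compact_subset_open_imp_ball_epsilon_subset[OF S(1) V(1) S(2)] by metis
  have e2: "0 < e / 2" using e by simp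
  obtain \<psi> d' where \<psi>: "smooth_on UNIV \<psi>" "\<And>x. (\<psi> has_derivative (\<lambda>h. d' x \<bullet> h)) (at x)" "continuous_on UNIV d'"
    "\<And>x. norm (d' x - d x) \<le> \<delta>" "\<And>x. (\<And>y. y \<in> S \<Longrightarrow> e / 2 \<le> dist x y) \<Longrightarrow> \<psi> x = 0"
  proof (rule smooth_approximation[OF \<phi> S(1) S(3) e2 \<delta>])
    fix \<psi> and d' :: "'a \<Rightarrow> 'a"
    assume a: "smooth_on UNIV \<psi>" "\<And>x. (\<psi> has_derivative (\<lambda>h. d' x \<bullet> h)) (at x)" "continuous_on UNIV d'"
      "\<And>x. norm (d' x - d x) \<le> \<delta>" "\<And>x. (\<And>y. y \<in> S \<Longrightarrow> e / 2 \<le> dist x y) \<Longrightarrow> \<psi> x = 0"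
    show thesis by (rule that[OF a(1,2,3,4)]) (rule a(5), blast)
  qed
  define C where "C = (\<Union>x\<in>S. cball x (e / 2))"
  have C: "compact C" unfolding C_def by (rule compact_minkowski_sum_cball[OF S(1)])
  have CV: "C \<subseteq> V" unfolding C_def using e by (force intro: subsetD[OF e(2)])
  have C0: "\<psi> u = 0" if "u \<notin> C" for u
    by (rule \<psi>(5)) (use that in \<open>force simp: C_def dist_commute\<close>)
  have cd: "continuous_on U d" "continuous_on U d'" using \<phi>(2) \<psi>(3) continuous_on_subset by blast+
  have si: "set_integrable lborel V (\<lambda>u. A (p u + d u))" "set_integrable lborel V (\<lambda>u. A (p u + d' u))"
    by (rule set_integrable_continuous_relatively_compact[OF V], intro continuous_compose continuous_intros f cd)+
  have sc: "set_integrable lborel V (\<lambda>u. L * \<delta>)"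
    by (rule set_integrable_continuous_relatively_compact[OF V continuous_on_const])
  have "(LINT u:V|lborel. A (p u)) \<le> (LINT u:V|lborel. A (p u + d' u))"
    by (rule minimal_graph_smooth_comparison[OF min U f \<psi>(1,2,3) V C CV C0])
  also have "\<dots> \<le> (LINT u:V|lborel. A (p u + d u) + L * \<delta>)"
  proof (rule set_integral_mono[OF si(2)])
    show "set_integrable lborel V (\<lambda>u. A (p u + d u) + L * \<delta>)" by (rule set_integral_add(1)[OF si(1) sc])
    fix u
    have "A (p u + d' u) - A (p u + d u) \<le> L * norm (d' u - d u)"
      using Lipschitz[of "p u + d' u" "p u + d u"] by simp
    also have "\<dots> \<le> L * \<delta>" by (rule mult_left_mono[OF \<psi>(4) L_nonneg])
    finally show "A (p u + d' u) \<le> A (p u + d u) + L * \<delta>" by simp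
  qed
  also have "\<dots> = (LINT u:V|lborel. A (p u + d u)) + (LINT u:V|lborel. L * \<delta>)"
    by (rule set_integral_add(2)[OF si(1) sc])
  also have "(LINT u:V|lborel. L * \<delta>) = L * \<delta> * \<mu>"
    unfolding \<mu>_def set_lebesgue_integral_def using V(1) by (simp add: mult.commute)
  also have "L * \<delta> * \<mu> \<le> \<epsilon>"
  proof -
    have "L * \<delta> * \<mu> = \<epsilon> * (L * \<mu> / (L * \<mu> + 1))" unfolding \<delta>_def by simp
    also have "\<dots> \<le> \<epsilon> * 1" using \<epsilon> pos by (intro mult_left_mono) auto
    finally show ?thesis by simp
  qed
  finally show "(LINT u:V|lborel. A (p u)) \<le> (LINT u:V|lborel. A (p u + d u)) + \<epsilon>" by simp
qed

end

section \<open>Uniqueness\<close>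

text \<open>The function T^2/(1+T^2) with T = max(s-c, 0) has these properties; its derivative is at
most 1 because 2T \<le> 1 + T^2.\<close>

lemma bounded_cutoff_above:
  fixes c :: real
  obtains g g' where "\<And>s. (g has_real_derivative g' s) (at s)" "continuous_on UNIV g'"
    "\<And>s. 0 \<le> g s" "\<And>s. g s \<le> 1" "\<And>s. 0 \<le> g' s" "\<And>s. g' s \<le> 1"
    "\<And>s. s \<le> c \<Longrightarrow> g s = 0" "\<And>s. s \<le> c \<Longrightarrow> g' s = 0" "\<And>s. c < s \<Longrightarrow> 0 < g' s"
proof -
  define T where "T s = max 0 (s - c)" for s :: real
  define g where "g s = (T s)\<^sup>2 / (1 + (T s)\<^sup>2)" for s
  define g' where "g' s = 2 * T s / (1 + (T s)\<^sup>2)\<^sup>2" for s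
  have T0: "0 \<le> T s" for s unfolding T_def by simp
  have D: "0 < 1 + (T s)\<^sup>2" for s by (simp add: add_pos_nonneg)
  have dT: "((\<lambda>s. (T s)\<^sup>2) has_real_derivative 2 * T s) (at s)" for s
  proof -
    have "((\<lambda>s. s - c) has_real_derivative 1) (at s)" by (auto intro!: derivative_eq_intros)
    from DERIV_chain2[OF positive_part_square_has_derivative this] show ?thesis unfolding T_def by simp
  qed
  have "(g has_real_derivative g' s) (at s)" for s
  proof -
    have "((\<lambda>s. (T s)\<^sup>2 / (1 + (T s)\<^sup>2)) has_real_derivative
        (2 * T s * (1 + (T s)\<^sup>2) - (T s)\<^sup>2 * (0 + 2 * T s)) / ((1 + (T s)\<^sup>2) * (1 + (T s)\<^sup>2))) (at s)"
      by (intro DERIV_divide DERIV_add dT DERIV_const) (use D[of s] in simp)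
    moreover have "(2 * T s * (1 + (T s)\<^sup>2) - (T s)\<^sup>2 * (0 + 2 * T s)) / ((1 + (T s)\<^sup>2) * (1 + (T s)\<^sup>2)) = g' s"
      unfolding g'_def by (simp add: algebra_simps power2_eq_square)
    ultimately show ?thesis unfolding g_def[abs_def] by simp
  qed
  moreover have "continuous_on UNIV g'"
    unfolding g'_def[abs_def] T_def[abs_def]
    by (intro continuous_intros) (metis D T_def less_irrefl power_eq_0_iff)
  moreover have "g' s \<le> 1" for s
  proof -
    have "2 * T s \<le> 1 + (T s)\<^sup>2" using zero_le_power2[of "T s - 1"] by (simp add: power2_eq_square algebra_simps)
    also have "\<dots> \<le> (1 + (T s)\<^sup>2)\<^sup>2" using self_le_power[of "1 + (T s)\<^sup>2" 2] by simp
    finally show ?thesis unfolding g'_def using D[of s] by (simp add: divide_le_eq)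
  qed
  moreover have "0 \<le> g s" "g s \<le> 1" "0 \<le> g' s" for s
    unfolding g_def g'_def using T0[of s] D[of s] by (auto simp: divide_le_eq)
  moreover have "g s = 0" "g' s = 0" if "s \<le> c" for s unfolding g_def g'_def T_def using that by auto
  moreover have "0 < g' s" if "c < s" for s
  proof -
    have "0 < T s" unfolding T_def using that by simp
    then show ?thesis unfolding g'_def using D[of s] by (intro divide_pos_pos zero_less_power) auto
  qed
  ultimately show ?thesis using that[of g g'] by blast
qed

context area_integrand
begin

text \<open>Let w = f1 - f2 and suppose that the gradients differ at u0. The graph of f1 is lowered
and that of f2 raised by half of \<phi> = \<eta> g(w), where g is a bounded increasing function that vanishes
below w(u0)/2 and \<eta> is a cutoff that vanishes near K. As w = 0 on the boundary,
\<phi> has compact support off K, and minimality of both graphs says that the sum of their areas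
does not decrease.

On the other hand, up to the term g(w)\<nabla>\<eta>, the gradients are moved towards each other by
the fraction \<eta> g'(w)/2 of their difference. By convexity this does not increase the sum of the densities,
and near u0 strict convexity yields a gain that does not depend on \<eta>. The
neglected term costs at most L \<integral> |\<nabla>\<eta>|, which can be made smaller than the gain since
K has vanishing (m-1)-dimensional measure.\<close>

theorem gradients_agree_where_greater:
  fixes f1 f2 :: "'a \<Rightarrow> real"
  assumes \<Omega>: "open \<Omega>" "bounded \<Omega>" and K: "compact K" "K \<subseteq> \<Omega>" "hausdorff_measure (DIM('a) - 1) K = 0"
    and f1: "continuous_on (closure \<Omega> - K) f1" "Ck_on 2 (\<Omega> - K) f1"
    and f2: "continuous_on (closure \<Omega> - K) f2" "Ck_on 2 (\<Omega> - K) f2"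
    and min1: "finsler_minimal_on F (\<Omega> - K) (\<lambda>u. (u, f1 u))"
    and min2: "finsler_minimal_on F (\<Omega> - K) (\<lambda>u. (u, f2 u))"
    and bd: "\<And>u. u \<in> frontier \<Omega> \<Longrightarrow> f1 u = f2 u"
    and u0: "u0 \<in> \<Omega> - K" "f2 u0 < f1 u0"
  shows "gradient f1 u0 = gradient f2 u0"
proof (rule ccontr)
  assume ne: "gradient f1 u0 \<noteq> gradient f2 u0"
  define U where "U = \<Omega> - K"
  have U: "open U" unfolding U_def using \<Omega>(1) K(1) by (intro open_Diff compact_imp_closed)
  have UcK: "U \<subseteq> closure \<Omega> - K" unfolding U_def using closure_subset by blast
  define p q where "p = gradient f1" and "q = gradient f2"
  have C2: "Ck_on (Suc (Suc 0)) U f1" "Ck_on (Suc (Suc 0)) U f2" using f1(2) f2(2) by (simp_all only: U_def numeral_2_eq_2)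
  have d1: "(f1 has_derivative (\<lambda>h. p u \<bullet> h)) (at u)" if "u \<in> U" for u unfolding p_def by (rule Ck_on_has_gradient(1)[OF U C2(1) that])
  have d2: "(f2 has_derivative (\<lambda>h. q u \<bullet> h)) (at u)" if "u \<in> U" for u unfolding q_def by (rule Ck_on_has_gradient(1)[OF U C2(2) that])
  have cp: "continuous_on U p" and cq: "continuous_on U q" unfolding p_def q_def by (rule Ck_on_has_gradient(2)[OF U C2(1)], rule Ck_on_has_gradient(2)[OF U C2(2)])
  define w where "w u = f1 u - f2 u" for u
  have cw: "continuous_on (closure \<Omega> - K) w" unfolding w_def[abs_def] by (intro continuous_intros f1 f2)
  have cwU: "continuous_on U w" by (rule continuous_on_subset[OF cw UcK])
  define c where "c = w u0 / 2"
  have c: "0 < c" "c < w u0" unfolding c_def w_def using u0(2) by auto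
  obtain g g' where g: "\<And>s. (g has_real_derivative g' s) (at s)" "continuous_on UNIV g'"
    "\<And>s. 0 \<le> g s" "\<And>s. g s \<le> 1" "\<And>s. 0 \<le> g' s" "\<And>s. g' s \<le> 1"
    "\<And>s. s \<le> c \<Longrightarrow> g s = 0" "\<And>s. s \<le> c \<Longrightarrow> g' s = 0" "\<And>s. c < s \<Longrightarrow> 0 < g' s"
    by (rule bounded_cutoff_above[of c]) blast
  \<comment> \<open>What is gained at u where the cutoff equals one.\<close>
  define gap where "gap u = A (p u) + A (q u) - (A (p u - (g' (w u) / 2) *\<^sub>R (p u - q u)) + A (q u + (g' (w u) / 2) *\<^sub>R (p u - q u)))" for u
  have cg'w: "continuous_on U (\<lambda>u. g' (w u))" by (rule continuous_on_compose2[OF g(2) cwU]) simp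
  have cgap: "continuous_on U gap" unfolding gap_def[abs_def]
    by (intro continuous_intros continuous_compose cp cq cg'w) auto
  have u0U: "u0 \<in> U" using u0(1) unfolding U_def .
  have gap0: "0 < gap u0"
    unfolding gap_def using exchange_less[of "g' (w u0) / 2" "p u0" "q u0"] g(9)[OF c(2)] g(6)[of "w u0"] ne
    by (simp add: p_def q_def)
  define \<gamma> where "\<gamma> = gap u0 / 2"
  have \<gamma>: "0 < \<gamma>" "\<gamma> < gap u0" unfolding \<gamma>_def using gap0 by auto
  obtain r where r: "0 < r" "cball u0 (2 * r) \<subseteq> U" "\<And>u. u \<in> cball u0 r \<Longrightarrow> \<gamma> \<le> gap u \<and> c \<le> w u"
  proof -
    obtain r1 where r1: "0 < r1" "cball u0 r1 \<subseteq> U" using U u0U open_contains_cball by blast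
    have "isCont gap u0" "isCont w u0" using cgap cwU U u0U continuous_on_eq_continuous_at by blast+
    then have "eventually (\<lambda>u. \<gamma> < gap u) (at u0)" "eventually (\<lambda>u. c < w u) (at u0)"
      using \<gamma>(2) c(2) unfolding isCont_def by (auto intro: order_tendstoD)
    then have "eventually (\<lambda>u. \<gamma> < gap u \<and> c < w u) (at u0)" by (rule eventually_conj)
    then obtain r2 where r2: "0 < r2" "\<And>u. u \<noteq> u0 \<Longrightarrow> dist u u0 < r2 \<Longrightarrow> \<gamma> < gap u \<and> c < w u"
      unfolding eventually_at by auto
    show ?thesis
    proof (rule that[of "min (r1/2) (r2/2)"])
      show "cball u0 (2 * min (r1/2) (r2/2)) \<subseteq> U" using r1(2) by (rule order_trans[rotated]) auto
      fix u assume "u \<in> cball u0 (min (r1/2) (r2/2))"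
      then have "dist u u0 < r2" using r2(1) by (auto simp: dist_commute)
      then show "\<gamma> \<le> gap u \<and> c \<le> w u" using r2(2)[of u] \<gamma>(2) c(2) by (cases "u = u0") auto
    qed (use r1 r2 in auto)
  qed
  define B where "B = cball u0 r"
  have BU: "B \<subseteq> U" unfolding B_def by (rule order_trans[OF _ r(2)]) (use r(1) in auto)
  define \<beta> where "\<beta> = measure lborel B"
  have \<beta>: "0 < \<beta>" unfolding \<beta>_def B_def using r(1) by (simp add: content_cball_pos)
  \<comment> \<open>The admissible cost of the cutoff: the gain on B is at least \<gamma> \<beta>.\<close>
  define e where "e = \<gamma> * \<beta> / (L + 1)"
  have e: "0 < e" unfolding e_def using \<gamma> \<beta> L_nonneg by (intro divide_pos_pos mult_pos_pos) auto
  obtain \<eta> E N where \<eta>: "\<And>x. (\<eta> has_derivative (\<lambda>h. E x \<bullet> h)) (at x)" "continuous_on UNIV E"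
    "\<And>x. 0 \<le> \<eta> x" "\<And>x. \<eta> x \<le> 1" and N: "open N" "K \<subseteq> N" "\<And>x. x \<in> N \<Longrightarrow> \<eta> x = 0"
    and \<eta>1: "\<And>x. (\<And>y. y \<in> K \<Longrightarrow> r \<le> dist x y) \<Longrightarrow> \<eta> x = 1"
    and E: "integrable lborel (\<lambda>x. norm (E x))" "(LINT x|lborel. norm (E x)) \<le> e"
    using hausdorff_null_cutoff[OF K(1,3) e r(1)] by blast
  have \<eta>B: "\<eta> x = 1" if x: "x \<in> B" for x
  proof (rule \<eta>1, rule ccontr)
    fix y assume y: "y \<in> K" "\<not> r \<le> dist x y"
    have "dist u0 y \<le> dist u0 x + dist x y" by (rule dist_triangle)
    then have "y \<in> cball u0 (2 * r)" using x y unfolding B_def by simp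
    then show False using r(2) y(1) unfolding U_def by blast
  qed
  define \<phi> where "\<phi> u = (if u \<in> U then \<eta> u * g (w u) else 0)" for u
  define D where "D u = (if u \<in> U then (\<eta> u * g' (w u)) *\<^sub>R (p u - q u) + g (w u) *\<^sub>R E u else 0)" for u
  \<comment> \<open>Outside S the function \<phi> vanishes; S avoids K because N contains K, and the boundary because w vanishes there.\<close>
  define S where "S = {u \<in> closure \<Omega> - N. c \<le> w u}"
  have S: "compact S"
  proof -
    have "compact (closure \<Omega> - N)"
      using \<Omega>(2) N(1) by (metis Diff_eq bounded_closure closed_Compl closed_closure compact_Int_closed compact_eq_bounded_closed)
    moreover have "closed S"
    proof -
      have "continuous_on (closure \<Omega> - N) w" by (rule continuous_on_subset[OF cw]) (use N in blast)
      moreover have "closed (closure \<Omega> - N)" using N(1) by (intro closed_Diff) auto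
      ultimately have "closed ((closure \<Omega> - N) \<inter> w -` {c..})" by (rule continuous_closed_preimage) simp
      moreover have "S = (closure \<Omega> - N) \<inter> w -` {c..}" unfolding S_def by auto
      ultimately show ?thesis by simp
    qed
    moreover have "S \<subseteq> closure \<Omega> - N" unfolding S_def by blast
    ultimately show ?thesis by (metis compact_Int_closed inf.absorb_iff2)
  qed
  have SU: "S \<subseteq> U"
  proof
    fix u assume u: "u \<in> S"
    have "u \<in> \<Omega>"
    proof (rule ccontr)
      assume "u \<notin> \<Omega>"
      then have "u \<in> frontier \<Omega>" using u \<Omega>(1) unfolding S_def frontier_def by (simp add: interior_open)
      then show False using bd[of u] u c(1) unfolding S_def w_def by auto
    qed
    then show "u \<in> U" using u N(2) unfolding S_def U_def by blast
  qed
  have \<phi>0: "\<phi> u = 0" if "u \<notin> S" for u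
  proof (cases "u \<in> U")
    case True
    then have "u \<in> closure \<Omega>" using UcK by blast
    then have "u \<in> N \<or> w u \<le> c" using that unfolding S_def by auto
    then show ?thesis unfolding \<phi>_def using N(3)[of u] g(7)[of "w u"] by auto
  qed (simp add: \<phi>_def)
  have dw: "(w has_derivative (\<lambda>h. (p u - q u) \<bullet> h)) (at u)" if "u \<in> U" for u
    unfolding w_def[abs_def] inner_diff_left by (rule has_derivative_diff[OF d1[OF that] d2[OF that]])
  have d\<phi>U: "(\<phi> has_derivative (\<lambda>h. D u \<bullet> h)) (at u)" if u: "u \<in> U" for u
  proof -
    have "((\<lambda>u. g (w u)) has_derivative (\<lambda>h. g' (w u) * ((p u - q u) \<bullet> h))) (at u)"
      using has_derivative_compose[OF dw[OF u] g(1)[unfolded has_field_derivative_def]] .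
    from has_derivative_mult[OF \<eta>(1) this]
    have "((\<lambda>u. \<eta> u * g (w u)) has_derivative (\<lambda>h. \<eta> u * (g' (w u) * ((p u - q u) \<bullet> h)) + (E u \<bullet> h) * g (w u))) (at u)" .
    moreover have "(\<lambda>h. \<eta> u * (g' (w u) * ((p u - q u) \<bullet> h)) + (E u \<bullet> h) * g (w u)) = (\<lambda>h. D u \<bullet> h)"
      by (rule ext) (simp add: D_def u inner_add_left mult_ac)
    ultimately have "((\<lambda>u. \<eta> u * g (w u)) has_derivative (\<lambda>h. D u \<bullet> h)) (at u)" by simp
    then show ?thesis
      by (rule has_derivative_transform_within_open[OF _ U u]) (simp add: \<phi>_def)
  qed
  have oS: "open (- S)" using S compact_imp_closed by blast
  have d\<phi>S: "(\<phi> has_derivative (\<lambda>h. 0)) (at u)" if "u \<notin> S" for u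
    by (rule has_derivative_transform_within_open[OF has_derivative_const oS]) (use that \<phi>0 in auto)
  \<comment> \<open>The formula for the gradient on U is continued by zero; both formulas hold on the overlap of U with the complement of S.\<close>
  have D0: "D u = 0" if "u \<notin> S" for u
  proof (cases "u \<in> U")
    case True
    have "(\<lambda>h. D u \<bullet> h) = (\<lambda>h. 0)" by (rule has_derivative_unique[OF d\<phi>U[OF True] d\<phi>S[OF that]])
    then have "D u \<bullet> D u = 0" by metis
    then show ?thesis by simp
  qed (simp add: D_def)
  have d\<phi>: "(\<phi> has_derivative (\<lambda>h. D u \<bullet> h)) (at u)" for u
  proof (cases "u \<in> U")
    case True then show ?thesis by (rule d\<phi>U)
  next
    case False then have "u \<notin> S" using SU by blast
    then show ?thesis using d\<phi>S[of u] D0[of u] by simp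
  qed
  have cD: "continuous_on UNIV D"
  proof -
    have c\<eta>: "continuous_on U \<eta>" by (intro continuous_at_imp_continuous_on ballI has_derivative_continuous[OF \<eta>(1)])
    have cgw: "continuous_on U (\<lambda>u. g (w u))"
    proof (rule continuous_on_compose2[OF _ cwU])
      show "continuous_on UNIV g" by (intro continuous_at_imp_continuous_on ballI DERIV_isCont[OF g(1)])
    qed simp
    have "continuous_on U (\<lambda>u. (\<eta> u * g' (w u)) *\<^sub>R (p u - q u) + g (w u) *\<^sub>R E u)"
      by (intro continuous_intros c\<eta> cgw cg'w cp cq continuous_on_subset[OF \<eta>(2)]) auto
    then have "continuous_on U D" by (rule continuous_on_eq) (simp add: D_def)
    moreover have "continuous_on (- S) D" by (rule continuous_on_eq[OF continuous_on_const]) (simp add: D0)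
    ultimately have "continuous_on (U \<union> - S) D" using U oS by (rule continuous_on_open_Un[rotated 2])
    moreover have "U \<union> - S = UNIV" using SU by blast
    ultimately show ?thesis by simp
  qed
  have BS: "B \<subseteq> S"
  proof
    fix u assume u: "u \<in> B"
    have "u \<notin> N" using \<eta>B[OF u] N(3)[of u] by auto
    then show "u \<in> S" using u r(3)[of u] BU UcK unfolding S_def B_def by blast
  qed
  obtain d where d: "0 < d" "(\<Union>x\<in>S. ball x d) \<subseteq> U"
    using compact_subset_open_imp_ball_epsilon_subset[OF S U SU] by metis
  define V where "V = (\<Union>x\<in>S. ball x (d/2))"
  have V: "open V" "compact (closure V)" "closure V \<subseteq> U"
  proof -
    have k: "compact (\<Union>x\<in>S. cball x (d/2))" by (rule compact_minkowski_sum_cball[OF S])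
    have "V \<subseteq> (\<Union>x\<in>S. cball x (d/2))" unfolding V_def by force
    then have cl: "closure V \<subseteq> (\<Union>x\<in>S. cball x (d/2))" using k by (intro closure_minimal compact_imp_closed)
    then show "closure V \<subseteq> U" using d by (force intro: subsetD[OF d(2)])
    show "compact (closure V)" using cl k by (metis closed_closure compact_Int_closed inf.absorb_iff2)
    show "open V" unfolding V_def by blast
  qed
  have SV: "S \<subseteq> V" unfolding V_def using d(1) by force
  have VU: "V \<subseteq> U" using V(3) closure_subset by blast
  have m1: "(LINT u:V|lborel. A (p u)) \<le> (LINT u:V|lborel. A (p u + (- (1/2)) *\<^sub>R D u))"
  proof (rule minimal_graph_C1_comparison[OF min1[folded U_def] U d1 cp _ _ V S SV])
    show "((\<lambda>u. (- (1/2)) * \<phi> u) has_derivative (\<lambda>h. ((- (1/2)) *\<^sub>R D u) \<bullet> h)) (at u)" for u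
      unfolding inner_scaleR_left by (rule has_derivative_mult_right[OF d\<phi>])
    show "continuous_on UNIV (\<lambda>u. (- (1/2)) *\<^sub>R D u)" by (intro continuous_intros cD)
  qed (use \<phi>0 in auto)
  have m2: "(LINT u:V|lborel. A (q u)) \<le> (LINT u:V|lborel. A (q u + (1/2) *\<^sub>R D u))"
  proof (rule minimal_graph_C1_comparison[OF min2[folded U_def] U d2 cq _ _ V S SV])
    show "((\<lambda>u. (1/2) * \<phi> u) has_derivative (\<lambda>h. ((1/2) *\<^sub>R D u) \<bullet> h)) (at u)" for u
      unfolding inner_scaleR_left by (rule has_derivative_mult_right[OF d\<phi>])
    show "continuous_on UNIV (\<lambda>u. (1/2) *\<^sub>R D u)" by (intro continuous_intros cD)
  qed (use \<phi>0 in auto)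
  have key: "A (p u + (- (1/2)) *\<^sub>R D u) + A (q u + (1/2) *\<^sub>R D u) \<le> A (p u) + A (q u) + (L * norm (E u) - \<gamma> * indicat_real B u)"
    if u: "u \<in> V" for u
  proof -
    define \<theta> where "\<theta> = \<eta> u * g' (w u) / 2"
    define P Q where "P = p u - \<theta> *\<^sub>R (p u - q u)" and "Q = q u + \<theta> *\<^sub>R (p u - q u)"
    have uU: "u \<in> U" using u VU by blast
    have Du: "D u = (2 * \<theta>) *\<^sub>R (p u - q u) + g (w u) *\<^sub>R E u" unfolding D_def \<theta>_def using uU by simp
    define X where "X = (g (w u) / 2) *\<^sub>R E u"
    have P': "p u + (- (1/2)) *\<^sub>R D u = P - X"
      unfolding Du P_def X_def by (simp add: algebra_simps)
    have Q': "q u + (1/2) *\<^sub>R D u = Q + X"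
      unfolding Du Q_def X_def by (simp add: algebra_simps)
    have "norm X \<le> norm (E u) / 2"
      unfolding X_def using g(3,4)[of "w u"] mult_right_mono[of "g (w u)" 1 "norm (E u)"] by simp
    then have small: "L * norm X \<le> L * (norm (E u) / 2)" by (rule mult_left_mono[OF _ L_nonneg])
    have "A (p u + (- (1/2)) *\<^sub>R D u) - A P \<le> L * (norm (E u) / 2)"
      using Lipschitz[of "P - X" P] small unfolding P' by simp
    moreover have "A (q u + (1/2) *\<^sub>R D u) - A Q \<le> L * (norm (E u) / 2)"
      using Lipschitz[of "Q + X" Q] small unfolding Q' by simp
    moreover have "A P + A Q \<le> A (p u) + A (q u) - \<gamma> * indicat_real B u"
    proof (cases "u \<in> B")
      case True
      have "\<gamma> \<le> gap u" using r(3)[of u] True unfolding B_def by blast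
      then show ?thesis using True unfolding gap_def P_def Q_def \<theta>_def \<eta>B[OF True] by simp
    next
      case False
      have "\<theta> \<le> 1"
      proof -
        have "\<eta> u * g' (w u) \<le> 1 * 1" using \<eta>(3,4) g(5,6) by (intro mult_mono) auto
        then show ?thesis unfolding \<theta>_def by simp
      qed
      moreover have "0 \<le> \<theta>" unfolding \<theta>_def using \<eta>(3) g(5) by simp
      ultimately show ?thesis using exchange_le[of \<theta> "p u" "q u"] False unfolding P_def Q_def by simp
    qed
    ultimately show ?thesis by (simp add: field_simps)
  qed
  have cDU: "continuous_on U D" by (rule continuous_on_subset[OF cD]) simp
  note si = set_integrable_continuous_relatively_compact[OF V]
  have sp: "set_integrable lborel V (\<lambda>u. A (p u))" "set_integrable lborel V (\<lambda>u. A (q u))"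
    "set_integrable lborel V (\<lambda>u. A (p u + (- (1/2)) *\<^sub>R D u))" "set_integrable lborel V (\<lambda>u. A (q u + (1/2) *\<^sub>R D u))"
    by (rule si, intro continuous_compose continuous_intros cp cq cDU)+
  have sE: "set_integrable lborel V (\<lambda>u. L * norm (E u))"
    by (rule si, intro continuous_intros continuous_on_subset[OF \<eta>(2)]) auto
  have fB: "emeasure lborel B < \<infinity>" unfolding B_def by (rule emeasure_bounded_finite[OF bounded_cball])
  have sB: "set_integrable lborel V (\<lambda>u. \<gamma> * indicat_real B u)"
    unfolding set_integrable_def
    by (rule integrable_mult_indicator) (use V(1) fB in \<open>auto simp: B_def\<close>)
  have Vb: "V \<in> sets lborel" using V(1) by simp
  have "(LINT u:V|lborel. A (p u)) + (LINT u:V|lborel. A (q u))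
     \<le> (LINT u:V|lborel. A (p u + (- (1/2)) *\<^sub>R D u)) + (LINT u:V|lborel. A (q u + (1/2) *\<^sub>R D u))"
    using m1 m2 by (rule add_mono)
  also have "\<dots> = (LINT u:V|lborel. A (p u + (- (1/2)) *\<^sub>R D u) + A (q u + (1/2) *\<^sub>R D u))"
    by (rule set_integral_add(2)[OF sp(3,4), symmetric])
  also have "\<dots> \<le> (LINT u:V|lborel. A (p u) + A (q u) + (L * norm (E u) - \<gamma> * indicat_real B u))"
  proof (rule set_integral_mono[OF _ _ key])
    show "set_integrable lborel V (\<lambda>u. A (p u + (- (1/2)) *\<^sub>R D u) + A (q u + (1/2) *\<^sub>R D u))"
      by (rule set_integral_add(1)[OF sp(3,4)])
    show "set_integrable lborel V (\<lambda>u. A (p u) + A (q u) + (L * norm (E u) - \<gamma> * indicat_real B u))"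
      by (rule set_integral_add(1)[OF set_integral_add(1)[OF sp(1,2)] set_integral_diff(1)[OF sE sB]])
  qed
  also have "\<dots> = (LINT u:V|lborel. A (p u)) + (LINT u:V|lborel. A (q u)) + ((LINT u:V|lborel. L * norm (E u)) - (LINT u:V|lborel. \<gamma> * indicat_real B u))"
    by (simp add: set_integral_add(2) set_integral_diff(2) set_integral_add(1) set_integral_diff(1) sp sE sB)
  finally have "(LINT u:V|lborel. \<gamma> * indicat_real B u) \<le> (LINT u:V|lborel. L * norm (E u))" by simp
  also have "(LINT u:V|lborel. L * norm (E u)) \<le> (LINT u|lborel. L * norm (E u))"
    unfolding set_lebesgue_integral_def
  proof (rule integral_mono)
    show "integrable lborel (\<lambda>u. indicat_real V u *\<^sub>R (L * norm (E u)))" using sE unfolding set_integrable_def .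
    show "integrable lborel (\<lambda>u. L * norm (E u))" using E(1) by (rule integrable_mult_right)
    show "indicat_real V u *\<^sub>R (L * norm (E u)) \<le> L * norm (E u)" for u
      using L_nonneg by (simp add: indicator_def)
  qed
  also have "\<dots> = L * (LINT u|lborel. norm (E u))" by simp
  also have "\<dots> \<le> L * e" by (rule mult_left_mono[OF E(2) L_nonneg])
  also have "\<dots> < \<gamma> * \<beta>"
  proof -
    have "L * e < (L + 1) * e" using e by (simp add: distrib_right)
    also have "\<dots> = \<gamma> * \<beta>" unfolding e_def using L_nonneg by simp
    finally show ?thesis .
  qed
  also have "(LINT u:V|lborel. \<gamma> * indicat_real B u) = \<gamma> * \<beta>"
  proof -
    have "indicat_real V u *\<^sub>R (\<gamma> * indicat_real B u) = \<gamma> * indicat_real B u" for u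
      using BS SV by (auto simp: indicator_def)
    then have "(LINT u:V|lborel. \<gamma> * indicat_real B u) = (LINT u|lborel. \<gamma> * indicat_real B u)"
      unfolding set_lebesgue_integral_def by (simp only:)
    then show ?thesis unfolding \<beta>_def by (simp add: B_def)
  qed
  finally show False by simp
qed

end

text \<open>The set where w has the value w(a) \<noteq> 0 is closed in U, and open because w has vanishing
derivative near each of its points.\<close>

lemma locally_constant_imp_constant:
  fixes w :: "'a::euclidean_space \<Rightarrow> real"
  assumes U: "open U" "connected U" and w: "\<And>u. u \<in> U \<Longrightarrow> (w has_derivative (\<lambda>h. G u \<bullet> h)) (at u)"
    and zero: "\<And>u. u \<in> U \<Longrightarrow> w u \<noteq> 0 \<Longrightarrow> G u = 0" and a: "a \<in> U" "w a \<noteq> 0" and u: "u \<in> U"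
  shows "w u = w a"
proof -
  define Z where "Z = {u \<in> U. w u = w a}"
  have cont: "continuous_on U w" by (intro continuous_at_imp_continuous_on ballI has_derivative_continuous[OF w])
  have "open Z"
  proof (rule openI)
    fix z assume "z \<in> Z"
    then have z: "z \<in> U" "w z = w a" unfolding Z_def by auto
    have "open (U \<inter> w -` (- {0}))" by (rule continuous_open_preimage[OF cont U(1)]) auto
    moreover have "z \<in> U \<inter> w -` (- {0})" using z a by auto
    ultimately obtain e where e: "0 < e" "ball z e \<subseteq> U \<inter> w -` (- {0})" using open_contains_ball by blast
    have "w y = w a" if y: "y \<in> ball z e" for y
    proof -
      have "\<exists>c. \<forall>x\<in>ball z e. w x = c"
      proof (rule has_derivative_zero_constant[OF convex_ball])
        fix x assume x: "x \<in> ball z e"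
        then have "x \<in> U" "w x \<noteq> 0" using e(2) by auto
        then have "(w has_derivative (\<lambda>h. 0)) (at x)" using w[of x] zero[of x] by simp
        then show "(w has_derivative (\<lambda>h. 0)) (at x within ball z e)" by (rule has_derivative_at_withinI)
      qed
      then show ?thesis using y z(2) e(1) by (metis centre_in_ball)
    qed
    then show "\<exists>e>0. ball z e \<subseteq> Z" using e unfolding Z_def by blast
  qed
  moreover have "Z \<subseteq> U" unfolding Z_def by blast
  ultimately have "openin (top_of_set U) Z" by (intro open_subset)
  moreover have "closedin (top_of_set U) Z"
    using continuous_closedin_preimage_constant[OF cont, of "w a"] unfolding Z_def by simp
  moreover have "Z \<noteq> {}" unfolding Z_def using a by blast
  ultimately have "Z = U" using U(2) unfolding connected_clopen by blast
  then show ?thesis using u unfolding Z_def by blast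
qed

theorem theorem1p2:
  fixes F :: "(real ^ 'm::finite) \<times> real \<Rightarrow> (real ^ 'm) \<times> real \<Rightarrow> real"
    and \<Omega> K :: "(real ^ 'm) set"
    and f1 f2 :: "real ^ 'm \<Rightarrow> real"
  assumes "minkowski_metric F"
    and "finsler_metric (harmonic_symmetrization CARD('m) F)"
    and "open \<Omega>" and "connected \<Omega>" and "\<Omega> \<noteq> {}" and "bounded \<Omega>" and "C1_boundary \<Omega>"
    and "compact K" and "K \<subseteq> \<Omega>" and "hausdorff_measure (CARD('m) - 1) K = 0"
    and "connected (\<Omega> - K)"
    and "continuous_on (closure \<Omega> - K) f1" and "Ck_on 2 (\<Omega> - K) f1"
    and "continuous_on (closure \<Omega> - K) f2" and "Ck_on 2 (\<Omega> - K) f2"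
    and "finsler_minimal_on F (\<Omega> - K) (\<lambda>u. (u, f1 u))"
    and "finsler_minimal_on F (\<Omega> - K) (\<lambda>u. (u, f2 u))"
    and "\<forall>u\<in>frontier \<Omega>. f1 u = f2 u"
  shows "\<forall>u\<in>closure \<Omega> - K. f1 u = f2 u"
proof (rule ccontr)
  assume "\<not> (\<forall>u\<in>closure \<Omega> - K. f1 u = f2 u)"
  then obtain a where a: "a \<in> closure \<Omega> - K" "f1 a \<noteq> f2 a" by blast
  define U where "U = \<Omega> - K"
  have U: "open U" unfolding U_def using assms(3,8) by (intro open_Diff compact_imp_closed)
  have aU: "a \<in> U"
  proof -
    have "a \<notin> frontier \<Omega>" using a(2) assms(18) by blast
    then show ?thesis using a(1) assms(3) unfolding U_def frontier_def by (simp add: interior_open)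
  qed
  obtain A L where A: "area_integrand F A L"
  proof (rule area_integrand_strictly_convex_Lipschitz[OF assms(1)])
    show "finsler_metric (harmonic_symmetrization DIM(real ^ 'm) F)" using assms(2) by simp
    fix A :: "real ^ 'm \<Rightarrow> real" and L
    assume a: "\<And>x p. enn2real (hausdorff_measure DIM(real ^ 'm) (ball (0 :: real ^ 'm) 1) / hausdorff_measure DIM(real ^ 'm) {v. F x (v, p \<bullet> v) \<le> 1}) = A p"
      "0 \<le> L" "\<And>p q. \<bar>A p - A q\<bar> \<le> L * norm (p - q)"
      "\<And>p q t. \<lbrakk>0 < t; t < 1; p \<noteq> q\<rbrakk> \<Longrightarrow> A ((1-t) *\<^sub>R p + t *\<^sub>R q) < (1-t) * A p + t * A q"
    have "area_integrand F A L"
      by unfold_locales (rule a(1), rule a(2), rule a(3), rule a(4), assumption+)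
    then show thesis by (rule that)
  qed
  interpret area_integrand F A L by (rule A)
  have null: "hausdorff_measure (DIM(real ^ 'm) - 1) K = 0" using assms(10) by simp
  have C2: "Ck_on (Suc (Suc 0)) U f1" "Ck_on (Suc (Suc 0)) U f2" using assms(13,15) by (simp_all only: U_def numeral_2_eq_2)
  define w where "w u = f1 u - f2 u" for u
  have dw: "(w has_derivative (\<lambda>h. (gradient f1 u - gradient f2 u) \<bullet> h)) (at u)" if "u \<in> U" for u
    unfolding w_def[abs_def] inner_diff_left
    by (rule has_derivative_diff[OF Ck_on_has_gradient(1)[OF U C2(1) that] Ck_on_has_gradient(1)[OF U C2(2) that]])
  have grad: "gradient f1 u - gradient f2 u = 0" if "u \<in> U" "w u \<noteq> 0" for u
  proof (cases "f2 u < f1 u")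
    case True
    have "gradient f1 u = gradient f2 u"
      by (rule gradients_agree_where_greater[OF assms(3,6,8,9) null assms(12,13,14,15,16,17) _ that(1)[unfolded U_def] True])
         (use assms(18) in blast)
    then show ?thesis by simp
  next
    case False
    then have lt: "f1 u < f2 u" using that(2) unfolding w_def by simp
    have "gradient f2 u = gradient f1 u"
      by (rule gradients_agree_where_greater[OF assms(3,6,8,9) null assms(14,15,12,13,17,16) _ that(1)[unfolded U_def] lt])
         (use assms(18) in force)
    then show ?thesis by simp
  qed
  have const: "w u = w a" if "u \<in> U" for u
    by (rule locally_constant_imp_constant[OF U assms(11)[folded U_def] dw grad aU _ that]) (use a(2) in \<open>auto simp: w_def\<close>)
  \<comment> \<open>A nonzero constant difference contradicts the boundary values at any boundary point, which is approached from within the domain but away from K.\<close>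
  have "frontier \<Omega> \<noteq> {}" using assms(5,6) by (metis frontier_eq_empty not_bounded_UNIV)
  then obtain b where b: "b \<in> frontier \<Omega>" by blast
  have bK: "b \<in> closure \<Omega> - K" using b assms(3,9) unfolding frontier_def by (auto simp: interior_open)
  have wb: "w b = 0" using b assms(18) unfolding w_def by simp
  have wa: "0 < \<bar>w a\<bar>" using a(2) unfolding w_def by simp
  have "continuous_on (closure \<Omega> - K) w" unfolding w_def[abs_def] by (intro continuous_intros assms)
  then obtain d1 where d1: "0 < d1" "\<And>u. u \<in> closure \<Omega> - K \<Longrightarrow> dist u b < d1 \<Longrightarrow> dist (w u) (w b) < \<bar>w a\<bar>"
    unfolding continuous_on_iff using bK wa by metis
  have "open (- K)" using assms(8) compact_imp_closed by blast
  then obtain d2 where d2: "0 < d2" "ball b d2 \<subseteq> - K" using bK open_contains_ball by blast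
  have "b \<in> closure \<Omega>" using bK by blast
  then obtain u where u: "u \<in> \<Omega>" "dist u b < min d1 d2" using d1(1) d2(1) closure_approachable by (metis min_less_iff_conj)
  then have uK: "u \<notin> K" using d2(2) by (auto simp: dist_commute)
  have "dist (w u) (w b) < \<bar>w a\<bar>" using d1(2)[of u] u uK closure_subset by auto
  moreover have "w u = w a" using const[of u] u uK unfolding U_def by blast
  ultimately show False unfolding wb by (simp add: dist_real_def)
qed

end
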